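(* Let $c=2n$ (case $i=2$) or $c=n$ (case $i=3$). Let $\Upsilon_1=\{\Upsilon_{1,n}\}_{n}$ and $\Upsilon_2=\{\Upsilon_{2,n}\}_{n}$ be sequences of admissible quantum spin networks in $\mathcal S(S^2)$ with edges colored $n$ or $2n$, such that each $\Upsilon_{1,n}$ and each $\Upsilon_{2,n}$ contains a distinguished edge colored $c$ (that is, a projector $f^{(c)}$). Let $[\Upsilon_{1,n},\Upsilon_{2,n}]_i$ be the spin network obtained by cutting the distinguished edge of $\Upsilon_{1,n}$ and the distinguished edge of $\Upsilon_{2,n}$ and joining, planarly, the two loose ends of the first graph to the two loose ends of the second graph by two edges colored $c$ (the connected sum of the two graphs along the distinguished edges). Suppose that the tails $T_{\Upsilon_1}$ and $T_{\Upsilon_2}$ exist. Then, for $i=2,3$ and all $n$, $$[\Upsilon_{1,n},\Upsilon_{2,n}]_i\doteq_n (1-q)\,T_{\Upsilon_1}\,T_{\Upsilon_2}.$$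
   Context: Skein theory. Work over $\mathbb{Q}(A)$ and put $q=A^4$. $\mathcal S(S^2)$ is the Kauffman bracket skein module of the sphere: diagrams modulo (crossing) $=A\,(A\text{-smoothing})+A^{-1}(B\text{-smoothing})$ and $L\sqcup\bigcirc=-(A^2+A^{-2})L$; it is identified with $\mathbb{Q}(A)$ by sending the empty diagram to $1$. $f^{(n)}$ denotes the $n$-th Jones–Wenzl idempotent in $TL_n$. A triple $(a,b,c)$ of nonnegative integers is admissible if $a+b+c$ is even and $a+b\ge c\ge|a-b|$; then $\tau_{a,b,c}$ is the skein element in a disk with three boundary boxes $f^{(a)},f^{(b)},f^{(c)}$ in which $(a+b-c)/2$, $(a+c-b)/2$, $(b+c-a)/2$ parallel crossingless strands join the $a$- and $b$-boxes, the $a$- and $c$-boxes, and the $b$- and $c$-boxes respectively. A quantum spin network is a planar trivalent graph with edges labelled (colored) by nonnegative integers; it is admissible if the three colors at each vertex form an admissible triple. Its evaluation in $\mathcal S(S^2)=\mathbb{Q}(A)$ is obtained by replacing each edge colored $m$ by $f^{(m)}$ and each vertex colored $(a,b,c)$ by $\tau_{a,b,c}$. Tail. Rational functions are regarded as power series in $q$ after multiplication by a suitable (possibly fractional) power of $q$. $P_1\doteq_n P_2$ means that, once both are multiplied by powers of $q$ so as to be power series starting in degree $0$, their first $n$ coefficients agree up to a common sign. The tail $T_{\mathcal P}(q)\in\mathbb{Z}[[q]]$ of a sequence $\mathcal P=\{P_n\}$, if it exists, is the power series with $T_{\mathcal P}(q)\doteq_n P_n(q)$ for all $n$. The tail of a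 sequence of spin networks is the tail of the sequence of their evaluations. *)

theory Defs
  imports
    Complex_Main
    "HOL-Library.FuncSet"
    "HOL-Computational_Algebra.Computational_Algebra"
    "HOL-Computational_Algebra.Field_as_Ring"
    "HOL-Combinatorics.Transposition"
begin

section \<open>The field of rational functions in the variable A\<close>

type_synonym ratfun = "rat poly fract"

definition varA :: ratfun where
  "varA = Fract [:0, 1:] 1"

text \<open>The value of a crossingless circle.\<close>

definition loop_value :: ratfun where
  "loop_value = - (varA ^ 2 + inverse varA ^ 2)"

text \<open>The value of the \<open>n\<close>-coloured circle; it enters Wenzl's recursion below.\<close>

definition Delta :: "nat \<Rightarrow> ratfun" where
  "Delta n = (-1) ^ n *
     (varA ^ (2 * (n + 1)) - inverse varA ^ (2 * (n + 1))) / (varA ^ 2 - inverse varA ^ 2)"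

section \<open>Crossingless strands as matchings\<close>

text \<open>The equivalence relation on \<open>S\<close> generated by \<open>r\<close>, and its classes. Systems of strands with
  endpoints in \<open>S\<close> are sets of two-element subsets of \<open>S\<close>.\<close>

definition conn_rel :: "'a set \<Rightarrow> ('a \<times> 'a) set \<Rightarrow> ('a \<times> 'a) set" where
  "conn_rel S r = {(x, y). x \<in> S \<and> y \<in> S \<and> (x, y) \<in> (r \<union> r\<inverse>)\<^sup>*}"

definition conn_classes :: "'a set \<Rightarrow> ('a \<times> 'a) set \<Rightarrow> 'a set set" where
  "conn_classes S r = S // conn_rel S r"

definition strand_rel :: "'a set set \<Rightarrow> ('a \<times> 'a) set" where
  "strand_rel M = {(x, y). {x, y} \<in> M}"

definition perfect_matching_on :: "'a set \<Rightarrow> 'a set set \<Rightarrow> bool" where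
  "perfect_matching_on S M \<longleftrightarrow> (\<forall>s\<in>M. s \<subseteq> S \<and> card s = 2) \<and> (\<forall>x\<in>S. \<exists>!s. s \<in> M \<and> x \<in> s)"

section \<open>Temperley--Lieb algebras and Jones--Wenzl idempotents\<close>

text \<open>The boundary points of the box with \<open>m\<close> strands are \<open>(False, i)\<close> (bottom) and \<open>(True, i)\<close>
  (top), \<open>i < m\<close>, each row numbered in the same direction; \<open>box_pos\<close> numbers them along the boundary.\<close>

type_synonym tl_diagram = "(bool \<times> nat) set set"

definition box_points :: "nat \<Rightarrow> (bool \<times> nat) set" where
  "box_points m = UNIV \<times> {..<m}"

definition box_pos :: "nat \<Rightarrow> bool \<times> nat \<Rightarrow> nat" where
  "box_pos m p = (if fst p then 2 * m - 1 - snd p else snd p)"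

definition tl_diagrams :: "nat \<Rightarrow> tl_diagram set" where
  "tl_diagrams m = {D. perfect_matching_on (box_points m) D \<and>
     (\<forall>x y u v. {x, y} \<in> D \<longrightarrow> {u, v} \<in> D \<longrightarrow>
        \<not> (box_pos m x < box_pos m u \<and> box_pos m u < box_pos m y \<and> box_pos m y < box_pos m v))}"

text \<open>\<open>TL\<^sub>m\<close> is spanned by \<open>tl_diagrams m\<close>; its elements are given by their coefficients.
  Stacking \<open>D2\<close> on top of \<open>D1\<close> uses the levels 0, 1, 2, level 1 being the common row.\<close>

type_synonym tl_elem = "tl_diagram \<Rightarrow> ratfun"

definition tl_stack :: "nat \<Rightarrow> tl_diagram \<Rightarrow> tl_diagram \<Rightarrow> (nat \<times> nat) set set" where
  "tl_stack m D1 D2 =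
     conn_classes ({0, 1, 2} \<times> {..<m})
       (strand_rel (((`) (\<lambda>(t, i). (if t then 1 else 0, i)) ` D1) \<union>
                    ((`) (\<lambda>(t, i). (if t then 2 else 1, i)) ` D2)))"

definition tl_comp :: "nat \<Rightarrow> tl_diagram \<Rightarrow> tl_diagram \<Rightarrow> tl_diagram" where
  "tl_comp m D1 D2 =
     {{x, y} | x y. x \<in> box_points m \<and> y \<in> box_points m \<and> x \<noteq> y \<and>
        (\<exists>C \<in> tl_stack m D1 D2. (if fst x then 2 else 0, snd x) \<in> C \<and>
                                (if fst y then 2 else 0, snd y) \<in> C)}"

definition tl_loops :: "nat \<Rightarrow> tl_diagram \<Rightarrow> tl_diagram \<Rightarrow> nat" where
  "tl_loops m D1 D2 = card {C \<in> tl_stack m D1 D2. C \<subseteq> {1} \<times> {..<m}}"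

definition tl_mult :: "nat \<Rightarrow> tl_elem \<Rightarrow> tl_elem \<Rightarrow> tl_elem" where
  "tl_mult m x y = (\<lambda>D. \<Sum>D1\<in>tl_diagrams m. \<Sum>D2\<in>tl_diagrams m.
     if tl_comp m D1 D2 = D then loop_value ^ tl_loops m D1 D2 * x D1 * y D2 else 0)"

text \<open>\<open>tl_add_strand m x\<close> is \<open>x \<otimes> 1\<close>, for \<open>x\<close> in \<open>TL\<^sub>m\<close>; \<open>tl_hook m\<close> is the last standard generator
  (cap and cup on the last two strands) of the algebra on \<open>m + 2\<close> strands.\<close>

definition tl_add_strand :: "nat \<Rightarrow> tl_elem \<Rightarrow> tl_elem" where
  "tl_add_strand m x = (\<lambda>D. if D \<in> tl_diagrams (Suc m) \<and> {(False, m), (True, m)} \<in> D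
     then x (D - {{(False, m), (True, m)}}) else 0)"

definition tl_hook :: "nat \<Rightarrow> tl_elem" where
  "tl_hook m = (\<lambda>D. if D = (\<lambda>i. {(False, i), (True, i)}) ` {..<m} \<union>
     {{(False, m), (False, Suc m)}, {(True, m), (True, Suc m)}} then 1 else 0)"

text \<open>Wenzl's recursion.\<close>

fun jones_wenzl :: "nat \<Rightarrow> tl_elem" where
  "jones_wenzl 0 = (\<lambda>D. if D = {} then 1 else 0)"
| "jones_wenzl (Suc 0) = tl_add_strand 0 (jones_wenzl 0)"
| "jones_wenzl (Suc (Suc m)) =
     (let g = tl_add_strand (Suc m) (jones_wenzl (Suc m)) in
      (\<lambda>D. g D - Delta m / Delta (Suc m) *
           tl_mult (Suc (Suc m)) (tl_mult (Suc (Suc m)) g (tl_hook m)) g D))"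

section \<open>Quantum spin networks\<close>

text \<open>Planar graphs are given by their rotation systems. Every edge \<open>e\<close> has the two ends (darts)
  \<open>(e, False)\<close> and \<open>(e, True)\<close>; \<open>rot\<close> sends an end to the next one counterclockwise around its
  vertex, so that the vertices are the orbits of \<open>rot\<close>.\<close>

record 'e network =
  edges :: "'e set"
  rot :: "'e \<times> bool \<Rightarrow> 'e \<times> bool"
  colour :: "'e \<Rightarrow> nat"

definition darts :: "('e, 'z) network_scheme \<Rightarrow> ('e \<times> bool) set" where
  "darts N = edges N \<times> UNIV"

definition other_end :: "'e \<times> bool \<Rightarrow> 'e \<times> bool" where
  "other_end d = (fst d, \<not> snd d)"

definition dcol :: "('e, 'z) network_scheme \<Rightarrow> 'e \<times> bool \<Rightarrow> nat" where
  "dcol N d = colour N (fst d)"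

definition trivalent :: "('e, 'z) network_scheme \<Rightarrow> bool" where
  "trivalent N \<longleftrightarrow> finite (edges N) \<and>
     (\<forall>d\<in>darts N. rot N d \<in> darts N \<and> rot N d \<noteq> d \<and> rot N (rot N (rot N d)) = d)"

definition vertices :: "('e, 'z) network_scheme \<Rightarrow> ('e \<times> bool) set set" where
  "vertices N = conn_classes (darts N) {(d, rot N d) | d. d \<in> darts N}"

definition faces :: "('e, 'z) network_scheme \<Rightarrow> ('e \<times> bool) set set" where
  "faces N = conn_classes (darts N) {(d, rot N (other_end d)) | d. d \<in> darts N}"

definition components :: "('e, 'z) network_scheme \<Rightarrow> ('e \<times> bool) set set" where
  "components N = conn_classes (darts N)
     ({(d, rot N d) | d. d \<in> darts N} \<union> {(d, other_end d) | d. d \<in> darts N})"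

text \<open>Euler's formula, summed over the connected components: a component of genus \<open>g\<close> contributes
  \<open>2 - 2 g\<close> to \<open>V - E + F\<close>, so the equation says that all components are planar.
  (\<open>faces\<close> are the boundary cycles of the faces, taken component by component.)\<close>

definition planar :: "('e, 'z) network_scheme \<Rightarrow> bool" where
  "planar N \<longleftrightarrow>
     card (vertices N) + card (faces N) = card (edges N) + 2 * card (components N)"

definition admissible_triple :: "nat \<Rightarrow> nat \<Rightarrow> nat \<Rightarrow> bool" where
  "admissible_triple a b c \<longleftrightarrow>
     even (a + b + c) \<and> a + b \<ge> c \<and> int c \<ge> \<bar>int a - int b\<bar>"

definition admissible_spin_network :: "('e, 'z) network_scheme \<Rightarrow> bool" where
  "admissible_spin_network N \<longleftrightarrow> trivalent N \<and> planar N \<and>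
     (\<forall>d\<in>darts N. admissible_triple (dcol N d) (dcol N (rot N d)) (dcol N (rot N (rot N d))))"

section \<open>Evaluation in the skein module of the sphere\<close>

text \<open>Each end \<open>d\<close> of an edge of colour \<open>m\<close> carries \<open>m\<close> points \<open>(d, 0), \<dots>, (d, m - 1)\<close>, numbered
  counterclockwise as seen from the vertex at \<open>d\<close>. They are joined inside the vertices by the
  strands of \<open>\<tau>\<^bsub>a,b,c\<^esub>\<close> and along the edges by the strands of the Jones--Wenzl boxes.\<close>

definition points :: "('e, 'z) network_scheme \<Rightarrow> (('e \<times> bool) \<times> nat) set" where
  "points N = (SIGMA d:darts N. {..<dcol N d})"

text \<open>The last points of \<open>d\<close> are joined, in reverse order, to the first points of \<open>rot N d\<close>.\<close>

definition vertex_strands :: "('e, 'z) network_scheme \<Rightarrow> (('e \<times> bool) \<times> nat) set set" where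
  "vertex_strands N =
     {{(d, dcol N d - 1 - k), (rot N d, k)} | d k. d \<in> darts N \<and>
        k < (dcol N d + dcol N (rot N d) - dcol N (rot N (rot N d))) div 2}"

text \<open>The box on the edge \<open>e\<close> has its bottom at \<open>(e, False)\<close> and its top at \<open>(e, True)\<close>. The
  counterclockwise numberings at the two ends run in opposite directions, whence the reversal.\<close>

definition box_to_edge :: "('e, 'z) network_scheme \<Rightarrow> 'e \<Rightarrow> bool \<times> nat \<Rightarrow> ('e \<times> bool) \<times> nat" where
  "box_to_edge N e p = ((e, fst p), if fst p then colour N e - 1 - snd p else snd p)"

definition circles ::
  "('e, 'z) network_scheme \<Rightarrow> ('e \<Rightarrow> tl_diagram) \<Rightarrow> (('e \<times> bool) \<times> nat) set set" where
  "circles N s = conn_classes (points N)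
     (strand_rel (vertex_strands N \<union> (\<Union>e\<in>edges N. (`) (box_to_edge N e) ` s e)))"

text \<open>Expanding all the idempotents turns the network into a linear combination of disjoint unions
  of circles; a union of \<open>k\<close> circles equals \<open>loop_value ^ k\<close> times the empty diagram.\<close>

definition evaluation :: "('e, 'z) network_scheme \<Rightarrow> ratfun" where
  "evaluation N = (\<Sum>s \<in> (\<Pi>\<^sub>E e\<in>edges N. tl_diagrams (colour N e)).
     (\<Prod>e\<in>edges N. jones_wenzl (colour N e) (s e)) * loop_value ^ card (circles N s))"

section \<open>Connected sum\<close>

text \<open>The edges \<open>e1\<close> and \<open>e2\<close> are cut and the loose ends joined crosswise. The new edge named
  \<open>Inl e1\<close> joins the loose end at \<open>(e1, False)\<close> to the one at \<open>(e2, b)\<close>; the new edge named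
  \<open>Inr e2\<close> joins the two others. On the sphere both ways of pairing the loose ends, that is both
  values of \<open>b\<close>, are planar (turn the second graph upside down).\<close>

definition disjoint_rot ::
  "('a, 'y) network_scheme \<Rightarrow> ('b, 'z) network_scheme \<Rightarrow> ('a + 'b) \<times> bool \<Rightarrow> ('a + 'b) \<times> bool" where
  "disjoint_rot N1 N2 d = (case d of
       (Inl e, t) \<Rightarrow> map_prod Inl id (rot N1 (e, t))
     | (Inr e, t) \<Rightarrow> map_prod Inr id (rot N2 (e, t)))"

definition connected_sum :: "'a network \<Rightarrow> 'a \<Rightarrow> 'b network \<Rightarrow> 'b \<Rightarrow> bool \<Rightarrow> ('a + 'b) network" where
  "connected_sum N1 e1 N2 e2 b =
     (let swap = transpose (Inl e1, True) (Inr e2, b) in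
      \<lparr> edges = edges N1 <+> edges N2,
        rot = swap \<circ> disjoint_rot N1 N2 \<circ> swap,
        colour = case_sum (colour N1) (colour N2) \<rparr>)"

section \<open>Tails\<close>

text \<open>Rational functions in \<open>A\<close> and power series in \<open>q = A\<^sup>4\<close> are both compared inside the field of
  formal Laurent series in \<open>A\<close>; multiplying by \<open>A\<^sup>k\<close> is multiplying by the fractional power
  \<open>q\<^bsup>k/4\<^esup>\<close>.\<close>

definition expand :: "ratfun \<Rightarrow> rat fls" where
  "expand P = fps_to_fls (fps_of_poly (fst (quot_of_fract P))) /
              fps_to_fls (fps_of_poly (snd (quot_of_fract P)))"

definition q_series :: "rat fps \<Rightarrow> rat fls" where
  "q_series S = fps_to_fls (fps_compose S (fps_X ^ 4))"

definition int_q_series :: "int fps \<Rightarrow> rat fls" where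
  "int_q_series T = q_series (Abs_fps (\<lambda>j. of_int (fps_nth T j)))"

text \<open>\<open>S\<close> is the power series in \<open>q\<close>, starting in degree 0, obtained from \<open>F\<close> by multiplication by
  a power of \<open>q\<close>; the zero series counts as its own normalisation.\<close>

definition normalised :: "rat fls \<Rightarrow> rat fps \<Rightarrow> bool" where
  "normalised F S \<longleftrightarrow> (S = 0 \<or> fps_nth S 0 \<noteq> 0) \<and> (\<exists>k. fls_X_intpow k * F = q_series S)"

definition agree_upto :: "nat \<Rightarrow> rat fls \<Rightarrow> rat fls \<Rightarrow> bool" where
  "agree_upto n F G \<longleftrightarrow> (\<exists>S T \<epsilon>. normalised F S \<and> normalised G T \<and> \<epsilon> \<in> {1, -1} \<and>
     (\<forall>j<n. fps_nth S j = \<epsilon> * fps_nth T j))"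

definition is_tail :: "(nat \<Rightarrow> ratfun) \<Rightarrow> int fps \<Rightarrow> bool" where
  "is_tail P T \<longleftrightarrow> (\<forall>n. agree_upto n (int_q_series T) (expand (P n)))"

end

theory Submission
  imports Defs
begin

text \<open>Cut the distinguished edge, coloured \<open>c\<close>, of a planar network and expand all other idempotents.
  What remains outside the box of the cut edge is a crossingless matching of its \<open>2 c\<close> boundary points,
  together with some circles. The Jones--Wenzl idempotent kills every such matching except the identity,
  whose closure is \<open>Delta c\<close>. Hence a network evaluates to \<open>\<lambda> * Delta c\<close> for a scalar \<open>\<lambda>\<close>,
  and the connected sum to \<open>\<lambda>\<^sub>1 * \<lambda>\<^sub>2 * Delta c\<close>, so that its evaluation times \<open>Delta c\<close> is the product
  of the two evaluations. Up to sign and a power of \<open>A\<close>, \<open>Delta c\<close> is \<open>(1 - q\<^bsup>c+1\<^esup>) / (1 - q)\<close>,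
  and \<open>c \<ge> n\<close>.

  Planarity is given by Euler's formula; it enters by comparing dimensions over the field with two
  elements: every cycle is the boundary of a set of faces. This gives a two-colouring of the regions
  complementary to a strand, which no other strand can leave, whence the outside matching has no
  crossings.\<close>

text \<open>Skein identities are proved inside a context: a finite point set \<open>S\<close>, the
  relation \<open>R\<close> generated by the strands outside a box, and the positions
  \<open>\<iota>\<close> of the box boundary. Since a union of circles is worth a power of
  \<open>loop_value\<close>, every such identity reduces to comparing class counts of two relations,
  and no algebraic law of Temperley--Lieb multiplication is invoked. The obstacle in showing that
  caps are killed is a cap that meets the strand added by Wenzl's recursion: it requires a partial
  trace of the smaller idempotent, while the partial trace in turn requires that the smaller
  idempotent kills caps. The two facts are therefore proved in one induction. The scalars \<lambda>
  are not formed. The product formula is verified for each pair of states on the edges that are not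
  cut, with powers of \<open>loop_value\<close> on both sides in place of negative exponents. A
  connected sum has two boxes where each summand has one; expanding one of them turns its
  non-identity diagrams into caps for the other.\<close>

declare split_paired_All [simp del] split_paired_Ex [simp del]

section \<open>Counting connected components\<close>

text \<open>The relation lives on the whole type, so \<open>linked r\<close> behaves well under maps
  and unions without side conditions; the carrier \<open>S\<close> enters only when classes are
  counted.\<close>

definition linked :: "('a \<times> 'a) set \<Rightarrow> 'a \<Rightarrow> 'a \<Rightarrow> bool" where
  "linked r x y \<longleftrightarrow> (x, y) \<in> (r \<union> r\<inverse>)\<^sup>*"

definition comps :: "'a set \<Rightarrow> ('a \<times> 'a) set \<Rightarrow> nat" where
  "comps S r = card (conn_classes S r)"

lemma linked_refl [simp, intro]: "linked r x x"
  by (simp add: linked_def)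

lemma linked_trans [trans]: "linked r x y \<Longrightarrow> linked r y z \<Longrightarrow> linked r x z"
  by (auto simp: linked_def)

lemma linked_sym: "linked r x y \<Longrightarrow> linked r y x"
proof -
  have "sym ((r \<union> r\<inverse>)\<^sup>*)" by (intro sym_rtrancl) (auto simp: sym_def)
  then show "linked r x y \<Longrightarrow> linked r y x" by (auto simp: linked_def dest: symD)
qed

lemma linked_base: "(x, y) \<in> r \<Longrightarrow> linked r x y"
  by (auto simp: linked_def)

lemma linked_base': "(y, x) \<in> r \<Longrightarrow> linked r x y"
  by (auto simp: linked_def)

lemma linked_induct [consumes 1, case_names refl step]:
  assumes "linked r x y" "P x"
    and "\<And>y z. linked r x y \<Longrightarrow> P y \<Longrightarrow> (y, z) \<in> r \<or> (z, y) \<in> r \<Longrightarrow> P z"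
  shows "P y"
  using assms(1) unfolding linked_def
proof (induction rule: rtrancl_induct)
  case base
  show ?case by (fact assms(2))
next
  case (step y z)
  then show ?case using assms(3) unfolding linked_def by blast
qed

lemma linked_mono_gen:
  assumes "\<And>x y. (x, y) \<in> r \<Longrightarrow> linked r' (h x) (h y)" "linked r x y"
  shows "linked r' (h x) (h y)"
  using assms(2)
proof (induction rule: linked_induct)
  case (step y z)
  then show ?case using assms(1)[of y z] assms(1)[of z y] linked_sym linked_trans by metis
qed auto

lemma linked_mono: "linked r x y \<Longrightarrow> r \<subseteq> r' \<Longrightarrow> linked r' x y"
  by (rule linked_mono_gen[where h = "\<lambda>x. x"]) (auto intro: linked_base)

lemma linked_cong:
  assumes "\<And>x y. (x, y) \<in> r \<Longrightarrow> linked r' x y" "\<And>x y. (x, y) \<in> r' \<Longrightarrow> linked r x y"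
  shows "linked r = linked r'"
  using linked_mono_gen[where h = "\<lambda>x. x" and r = r and r' = r'] assms
    linked_mono_gen[where h = "\<lambda>x. x" and r = r' and r' = r] by (intro ext) metis

lemma linked_link: "linked r x' x \<Longrightarrow> linked r y' y \<Longrightarrow> linked r x y \<Longrightarrow> linked r x' y'"
  using linked_sym[of r y' y] linked_trans[of r x' x y] linked_trans[of r x' y y'] by simp

lemma linked_Un_cong:
  assumes "linked r = linked r'"
  shows "linked (r \<union> s) = linked (r' \<union> s)"
proof (rule linked_cong)
  show "linked (r' \<union> s) x y" if "(x, y) \<in> r \<union> s" for x y
    using that assms linked_mono[of r' x y "r' \<union> s"] linked_base[of x y] by (metis Un_iff Un_upper1)
  show "linked (r \<union> s) x y" if "(x, y) \<in> r' \<union> s" for x y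
    using that assms linked_mono[of r x y "r \<union> s"] linked_base[of x y] by (metis Un_iff Un_upper1)
qed

lemma linked_invariant:
  assumes "linked r x y" "\<And>x y. (x, y) \<in> r \<Longrightarrow> f x = f y"
  shows "f x = f y"
  using assms(1) by (induction rule: linked_induct) (use assms(2) in \<open>force+\<close>)

lemma linked_in: "linked r x y \<Longrightarrow> r \<subseteq> S \<times> S \<Longrightarrow> x \<in> S \<longleftrightarrow> y \<in> S"
  by (rule linked_invariant) auto

lemma linked_isolated: "linked r z y \<Longrightarrow> z \<notin> Field r \<Longrightarrow> y = z"
  by (induction rule: linked_induct) (auto simp: Field_def)

lemma conn_rel_linked: "conn_rel S r = {(x, y). x \<in> S \<and> y \<in> S \<and> linked r x y}"
  by (simp add: conn_rel_def linked_def)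

lemma conn_classes_eq: "conn_classes S r = (\<lambda>x. {y \<in> S. linked r x y}) ` S"
  unfolding conn_classes_def quotient_def conn_rel_linked by (auto simp: Image_def)

lemma finite_conn_classes: "finite S \<Longrightarrow> finite (conn_classes S r)"
  by (simp add: conn_classes_eq)

lemma class_eq_iff:
  "x \<in> S \<Longrightarrow> y \<in> S \<Longrightarrow> {z \<in> S. linked r x z} = {z \<in> S. linked r y z} \<longleftrightarrow> linked r x y"
  by (auto intro: linked_sym linked_trans)

text \<open>Two maps with the same kernel have equally many values. Taking both to be class maps
  compares class counts of relations on different carriers through representatives.\<close>

lemma card_eq_image_gen:
  assumes "\<And>x y. x \<in> S \<Longrightarrow> y \<in> S \<Longrightarrow> f x = f y \<longleftrightarrow> g x = g y"
  shows "card (f ` S) = card (g ` S)"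
proof -
  have "bij_betw (\<lambda>u. g (inv_into S f u)) (f ` S) (g ` S)"
  proof (rule bij_betw_imageI)
    show "inj_on (\<lambda>u. g (inv_into S f u)) (f ` S)"
      using assms by (intro inj_onI) (metis f_inv_into_f inv_into_into)
    have "g (inv_into S f (f x)) = g x" if "x \<in> S" for x
      using assms that by (metis f_inv_into_f imageI inv_into_into)
    then show "(\<lambda>u. g (inv_into S f u)) ` f ` S = g ` S"
      by (force simp: image_image)
  qed
  then show ?thesis by (rule bij_betw_same_card)
qed

lemma comps_cong_map:
  assumes "h ` S = T"
    and "\<And>x y. x \<in> S \<Longrightarrow> y \<in> S \<Longrightarrow> linked r x y \<longleftrightarrow> linked r' (h x) (h y)"
  shows "comps S r = comps T r'"
proof -
  have "comps T r' = card ((\<lambda>x. {y \<in> T. linked r' (h x) y}) ` S)"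
    unfolding comps_def conn_classes_eq assms(1)[symmetric] by (simp add: image_image)
  moreover have "comps S r = card ((\<lambda>x. {y \<in> S. linked r x y}) ` S)"
    by (simp add: comps_def conn_classes_eq)
  moreover have "card ((\<lambda>x. {y \<in> S. linked r x y}) ` S) =
      card ((\<lambda>x. {y \<in> T. linked r' (h x) y}) ` S)"
  proof (rule card_eq_image_gen)
    fix x y assume xy: "x \<in> S" "y \<in> S"
    then have hT: "h x \<in> T" "h y \<in> T" using assms(1) by auto
    show "({z \<in> S. linked r x z} = {z \<in> S. linked r y z}) \<longleftrightarrow>
        ({z \<in> T. linked r' (h x) z} = {z \<in> T. linked r' (h y) z})"
      using class_eq_iff[OF xy, of r] class_eq_iff[OF hT, of r'] assms(2)[OF xy] by simp
  qed
  ultimately show ?thesis by simp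
qed

lemma comps_cong_linked: "linked r = linked r' \<Longrightarrow> comps S r = comps S r'"
  by (rule comps_cong_map[where h = "\<lambda>x. x"]) auto

text \<open>A path downstairs is lifted edge by edge. The lift may have to jump between two points
  over the same vertex, which is harmless because each fibre of \<open>h\<close> lies in one
  class.\<close>

lemma linked_collapse:
  assumes rS: "r \<subseteq> S \<times> S"
    and fwd: "\<And>x y. (x, y) \<in> r \<Longrightarrow> linked r' (h x) (h y)"
    and bwd: "\<And>u v. (u, v) \<in> r' \<Longrightarrow> \<exists>x\<in>S. \<exists>y\<in>S. h x = u \<and> h y = v \<and> linked r x y"
    and fib: "\<And>x y. x \<in> S \<Longrightarrow> y \<in> S \<Longrightarrow> h x = h y \<Longrightarrow> linked r x y"
    and "x \<in> S" "y \<in> S"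
  shows "linked r x y \<longleftrightarrow> linked r' (h x) (h y)"
proof
  assume "linked r' (h x) (h y)"
  \<comment> \<open>All lifts of the endpoint are treated at once, since the next edge may start
    from any of them.\<close>
  then have "\<forall>w\<in>S. h w = h y \<longrightarrow> linked r x w"
  proof (induction rule: linked_induct)
    case refl
    then show ?case using fib assms(5) by metis
  next
    case (step u v)
    obtain p q where pq: "p \<in> S" "q \<in> S" "h p = u" "h q = v" "linked r p q"
      using step.hyps(2) bwd linked_sym by metis
    then have "linked r x q" using step.IH linked_trans by metis
    then show ?case using pq fib linked_trans by metis
  qed
  then show "linked r x y" using assms(6) by blast
qed (rule linked_mono_gen[OF fwd])

lemma comps_collapse:
  assumes "h ` S = T" "r \<subseteq> S \<times> S"
    and "\<And>x y. (x, y) \<in> r \<Longrightarrow> linked r' (h x) (h y)"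
    and "\<And>u v. (u, v) \<in> r' \<Longrightarrow> \<exists>x\<in>S. \<exists>y\<in>S. h x = u \<and> h y = v \<and> linked r x y"
    and "\<And>x y. x \<in> S \<Longrightarrow> y \<in> S \<Longrightarrow> h x = h y \<Longrightarrow> linked r x y"
  shows "comps S r = comps T r'"
  by (rule comps_cong_map[OF assms(1)]) (rule linked_collapse[OF assms(2-5)])

lemma comps_insert_isolated:
  assumes "finite S" "z \<notin> S" "r \<subseteq> S \<times> S"
  shows "comps (insert z S) r = Suc (comps S r)"
proof -
  have z: "{y \<in> insert z S. linked r z y} = {z}"
    using assms linked_isolated[of r z] by (auto simp: Field_def)
  have x: "{y \<in> insert z S. linked r x y} = {y \<in> S. linked r x y}" if "x \<in> S" for x
    using that assms linked_in[of r x z S] by auto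
  have "conn_classes (insert z S) r = insert {z} (conn_classes S r)"
    unfolding conn_classes_eq image_insert z using x by auto
  moreover have "{z} \<notin> conn_classes S r"
    using assms(2) by (auto simp: conn_classes_eq)
  ultimately show ?thesis
    using finite_conn_classes[OF assms(1)] by (simp add: comps_def)
qed

text \<open>A path that uses the new edge several times can be shortened to one that uses it at most
  once, in one of its two directions.\<close>

lemma linked_insert:
  "linked (insert (a, b) r) x y \<longleftrightarrow>
     linked r x y \<or> (linked r x a \<and> linked r b y) \<or> (linked r x b \<and> linked r a y)"
  (is "?L \<longleftrightarrow> ?R")
proof
  assume ?L
  then show ?R
  proof (induction rule: linked_induct)
    case (step y z)
    from step.hyps(2) consider "linked r y z" | "y = a" "z = b" | "y = b" "z = a"
      using linked_base[of y z r] linked_base'[of z y r] by blast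
    then show ?case using step.IH by cases (auto intro: linked_trans)
  qed auto
next
  have m: "linked r u v \<Longrightarrow> linked (insert (a, b) r) u v" for u v
    by (rule linked_mono) auto
  have ab: "linked (insert (a, b) r) a b" by (rule linked_base) auto
  then have ba: "linked (insert (a, b) r) b a" by (rule linked_sym)
  assume ?R
  then show ?L using m ab ba linked_trans by metis
qed

lemma linked_insert_absorb: "linked R a b \<Longrightarrow> linked (insert (a, b) R) = linked R"
  by (rule linked_cong) (auto intro: linked_base)

text \<open>The new edge merges the classes of \<open>a\<close> and \<open>b\<close> and leaves the
  others alone. Away from the old class of \<open>b\<close> both relations have the same kernel, and
  every new class is represented there through \<open>a\<close>.\<close>

lemma comps_insert_unlinked:
  assumes "finite S" "a \<in> S" "b \<in> S" "\<not> linked r a b"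
  shows "comps S r = Suc (comps S (insert (a, b) r))"
proof -
  let ?r' = "insert (a, b) r"
  let ?c = "\<lambda>r x. {y \<in> S. linked r x y}"
  let ?S0 = "{x \<in> S. \<not> linked r x b}"
  have *: "x \<in> ?S0 \<Longrightarrow> y \<in> ?S0 \<Longrightarrow> linked r x y \<longleftrightarrow> linked ?r' x y" for x y
    by (auto simp: linked_insert intro: linked_sym)
  have "card (?c r ` ?S0) = card (?c ?r' ` ?S0)"
  proof (rule card_eq_image_gen)
    fix x y assume xy: "x \<in> ?S0" "y \<in> ?S0"
    show "?c r x = ?c r y \<longleftrightarrow> ?c ?r' x = ?c ?r' y"
      using class_eq_iff[of x S y r] class_eq_iff[of x S y ?r'] *[OF xy] xy by simp
  qed
  also have "?c ?r' ` ?S0 = ?c ?r' ` S"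
  proof -
    have "?c ?r' x = ?c ?r' a" if "x \<in> S" "linked r x b" for x
      using that assms by (subst class_eq_iff) (auto simp: linked_insert)
    moreover have "a \<in> ?S0" using assms by simp
    ultimately show ?thesis by blast
  qed
  finally have 1: "card (?c r ` ?S0) = comps S ?r'" by (simp add: comps_def conn_classes_eq)
  have "?c r ` S = insert (?c r b) (?c r ` ?S0)"
    using class_eq_iff[of _ S b r] assms(3) by blast
  moreover have "?c r b \<notin> ?c r ` ?S0"
    using class_eq_iff[of _ S b r] assms(3) by blast
  ultimately have "card (?c r ` S) = Suc (card (?c r ` ?S0))"
    using assms(1) by simp
  then show ?thesis using 1 by (simp add: comps_def conn_classes_eq)
qed

lemma comps_insert_le:
  assumes "finite S" "a \<in> S" "b \<in> S"
  shows "comps S r \<le> Suc (comps S (insert (a, b) r))"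
  using comps_insert_unlinked[OF assms] comps_cong_linked[OF linked_insert_absorb, of r a b S]
  by (cases "linked r a b") auto

lemma comps_empty [simp]: "finite S \<Longrightarrow> comps S {} = card S"
proof -
  have "linked {} x y \<longleftrightarrow> x = y" for x y :: 'a by (auto simp: linked_def)
  moreover have "(\<lambda>x. {y \<in> S. x = y}) ` S = (\<lambda>x. {x}) ` S" by auto
  ultimately show "comps S {} = card S"
    by (simp add: comps_def conn_classes_eq card_image)
qed

lemma comps_one:
  assumes "x \<in> S" "\<And>y. y \<in> S \<Longrightarrow> linked r x y"
  shows "comps S r = 1"
proof -
  have "comps S r = comps {x} {}"
    using assms by (intro comps_cong_map[where h = "\<lambda>_. x"]) (auto intro: linked_sym linked_trans)
  then show ?thesis by simp
qed

text \<open>\<open>h\<close> and \<open>g\<close> act as homotopy inverses: every point is linked to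
  the representative \<open>g (h x)\<close>. With \<open>g\<close> the identity, this is the tool
  for shrinking strands to one of their points.\<close>

lemma comps_section:
  assumes "h ` S = T"
    and "\<And>x y. (x, y) \<in> r \<Longrightarrow> linked r' (h x) (h y)"
    and "\<And>u v. (u, v) \<in> r' \<Longrightarrow> linked r (g u) (g v)"
    and "\<And>x. x \<in> S \<Longrightarrow> linked r x (g (h x))"
  shows "comps S r = comps T r'"
proof (rule comps_cong_map[OF assms(1)])
  fix x y assume xy: "x \<in> S" "y \<in> S"
  show "linked r x y \<longleftrightarrow> linked r' (h x) (h y)"
  proof
    assume "linked r' (h x) (h y)"
    with assms(3) have "linked r (g (h x)) (g (h y))" by (rule linked_mono_gen[where h = g])
    then show "linked r x y" using assms(4) xy linked_sym linked_trans by metis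
  qed (rule linked_mono_gen[where h = h, OF assms(2)])
qed

lemma comps_relabel:
  assumes "inj_on h S" "r \<subseteq> S \<times> S"
  shows "comps (h ` S) (map_prod h h ` r) = comps S r"
proof (rule comps_section[symmetric, where h = h and g = "inv_into S h"])
  show "linked r (inv_into S h u) (inv_into S h v)" if uv: "(u, v) \<in> map_prod h h ` r" for u v
  proof -
    obtain x y where "(x, y) \<in> r" "u = h x" "v = h y" using uv by auto
    moreover have "x \<in> S" "y \<in> S" using calculation assms(2) by auto
    ultimately show ?thesis using assms(1) by (auto intro: linked_base)
  qed
  show "linked (map_prod h h ` r) (h x) (h y)" if "(x, y) \<in> r" for x y
    using that by (intro linked_base) (auto intro: rev_image_eqI)
qed (use assms in auto)

lemma comps_Un_isolated:
  assumes "finite Z" "finite S" "Z \<inter> S = {}" "r \<subseteq> S \<times> S"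
  shows "comps (S \<union> Z) r = comps S r + card Z"
  using assms(1,3)
proof (induction Z rule: finite_induct)
  case (insert z Z)
  have "comps (insert z (S \<union> Z)) r = Suc (comps (S \<union> Z) r)"
    using insert.hyps insert.prems assms(2,4) by (intro comps_insert_isolated) auto
  then show ?case using insert.IH insert.hyps insert.prems by simp
qed simp

text \<open>A piece \<open>P\<close> with internal connections \<open>Q\<close> is attached along
  \<open>B\<close> by \<open>\<iota>\<close>, its interior points being renamed to fresh ones by
  \<open>\<mu>\<close>. Classes of \<open>P\<close> that miss \<open>B\<close> split off as closed
  components; any other class matters only through the connections it makes between boundary
  points.\<close>

lemma comps_glue:
  fixes \<iota> \<mu> :: "'b \<Rightarrow> 'a"
  assumes fin: "finite P" "finite S"
    and QP: "Q \<subseteq> P \<times> P" and BP: "B \<subseteq> P" and RS: "R \<subseteq> S \<times> S" and \<iota>: "\<iota> ` B \<subseteq> S"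
    and inj: "inj_on \<mu> (P - B)" and fresh: "\<mu> ` (P - B) \<inter> S = {}"
    and \<kappa>: "\<And>p. \<kappa> p = (if p \<in> B then \<iota> p else \<mu> p)"
  shows "comps (S \<union> \<mu> ` (P - B)) (R \<union> map_prod \<kappa> \<kappa> ` Q) =
    card {C \<in> conn_classes P Q. C \<inter> B = {}} +
    comps S (R \<union> {(\<iota> x, \<iota> y) | x y. x \<in> B \<and> y \<in> B \<and> linked Q x y})"
proof -
  define cl where "cl p = {y \<in> P. linked Q p y}" for p
  define r where "r = R \<union> map_prod \<kappa> \<kappa> ` Q"
  define r0 where "r0 = R \<union> {(\<iota> x, \<iota> y) | x y. x \<in> B \<and> y \<in> B \<and> linked Q x y}"
  define r' where "r' = map_prod (Inl :: 'a \<Rightarrow> 'a + 'b set) (Inl :: 'a \<Rightarrow> 'a + 'b set) ` r0"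
  define T where "T = (Inl :: 'a \<Rightarrow> 'a + 'b set) ` S \<union> Inr ` {C \<in> conn_classes P Q. C \<inter> B = {}}"
  \<comment> \<open>A class meeting \<open>B\<close> is collapsed to the image of one chosen
    boundary point; a closed class survives as an isolated point, kept apart from \<open>S\<close>
    by the sum type. The choice is immaterial because \<open>r0\<close> links all boundary images of
    one class.\<close>
  define hp where "hp p = (if cl p \<inter> B = {} then Inr (cl p) else Inl (\<iota> (SOME b. b \<in> cl p \<inter> B)))" for p
  define h where "h x = (if x \<in> S then Inl x else hp (inv_into (P - B) \<mu> x))" for x
  have hS: "h x = Inl x" if "x \<in> S" for x using that by (simp add: h_def)
  have hm: "h (\<mu> p) = hp p" if "p \<in> P - B" for p
    using that inj fresh by (auto simp: h_def)
  have cl_eq: "cl p = cl p'" if "linked Q p p'" for p p'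
    using that by (auto simp: cl_def intro: linked_trans linked_sym)
  have pcl: "p \<in> cl p" if "p \<in> P" for p using that by (simp add: cl_def)
  have some: "(SOME b. b \<in> cl p \<inter> B) \<in> cl p \<inter> B" if "cl p \<inter> B \<noteq> {}" for p
    using that by (metis some_in_eq)
  have r'_r0: "linked r' (Inl x) (Inl y)" if "(x, y) \<in> r0" for x y
    using that by (intro linked_base) (auto simp: r'_def)
  have h\<kappa>: "linked r' (h (\<kappa> p)) (hp p)" if p: "p \<in> P" for p
  proof (cases "p \<in> B")
    case True
    then have ne: "cl p \<inter> B \<noteq> {}" using pcl p by blast
    have "(\<iota> p, \<iota> (SOME b. b \<in> cl p \<inter> B)) \<in> r0"
      using some[OF ne] True by (auto simp: r0_def cl_def)
    moreover have "h (\<kappa> p) = Inl (\<iota> p)" using True \<iota> hS by (auto simp: \<kappa>)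
    ultimately show ?thesis using ne r'_r0 by (simp add: hp_def)
  next
    case False
    then show ?thesis using hm[of p] p by (simp add: \<kappa>)
  qed
  have lQ: "linked r (\<kappa> p) (\<kappa> q)" if "linked Q p q" for p q
    using that by (rule linked_mono_gen[rotated]) (auto simp: r_def intro: linked_base rev_image_eqI)
  have "comps (S \<union> \<mu> ` (P - B)) r = comps T r'"
  proof (rule comps_collapse[where h = h])
    have "hp p \<in> T" if "p \<in> P - B" for p
      using that some[of p] \<iota> by (auto simp: hp_def T_def conn_classes_eq cl_def)
    moreover have "\<exists>p. C = cl p \<and> p \<in> P - B" if "C \<in> conn_classes P Q" "C \<inter> B = {}" for C
      using that pcl by (auto simp: conn_classes_eq cl_def)
    moreover have "hp p = Inr (cl p)" if "cl p \<inter> B = {}" for p using that by (simp add: hp_def)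
    ultimately show "h ` (S \<union> \<mu> ` (P - B)) = T"
      proof -
      assume hpT: "\<And>p. p \<in> P - B \<Longrightarrow> hp p \<in> T"
        and ex: "\<And>C. C \<in> conn_classes P Q \<Longrightarrow> C \<inter> B = {} \<Longrightarrow> \<exists>p. C = cl p \<and> p \<in> P - B"
        and hpI: "\<And>p. cl p \<inter> B = {} \<Longrightarrow> hp p = Inr (cl p)"
      have "Inr C \<in> hp ` (P - B)" if "C \<in> conn_classes P Q" "C \<inter> B = {}" for C
        using ex[OF that] hpI that(2) by (metis imageI)
      then have "T \<subseteq> Inl ` S \<union> hp ` (P - B)" by (auto simp: T_def)
      moreover have "Inl ` S \<union> hp ` (P - B) \<subseteq> T" using hpT by (auto simp: T_def)
      moreover have "h ` (S \<union> \<mu> ` (P - B)) = Inl ` S \<union> hp ` (P - B)"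
      proof -
        have "h ` S = Inl ` S" using hS by (rule image_cong[OF refl])
        moreover have "(\<lambda>p. h (\<mu> p)) ` (P - B) = hp ` (P - B)" using hm by (rule image_cong[OF refl])
        ultimately show ?thesis unfolding image_Un image_image by simp
      qed
      ultimately show ?thesis by auto
    qed
    have "\<kappa> p \<in> S \<union> \<mu> ` (P - B)" if "p \<in> P" for p using that \<iota> by (auto simp: \<kappa>)
    then show "r \<subseteq> (S \<union> \<mu> ` (P - B)) \<times> (S \<union> \<mu> ` (P - B))"
      using RS QP unfolding r_def by auto
    show "linked r' (h x) (h y)" if "(x, y) \<in> r" for x y
      using that unfolding r_def
    proof
      assume "(x, y) \<in> R"
      then show ?thesis using RS by (subst (1 2) hS) (auto simp: r0_def intro!: r'_r0)
    next
      assume "(x, y) \<in> map_prod \<kappa> \<kappa> ` Q"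
      then obtain p q where pq: "(p, q) \<in> Q" "x = \<kappa> p" "y = \<kappa> q" by auto
      then have "hp p = hp q" using cl_eq[OF linked_base[OF pq(1)]] by (simp add: hp_def)
      moreover have "p \<in> P" "q \<in> P" using pq(1) QP by auto
      ultimately show ?thesis using h\<kappa>[of p] h\<kappa>[of q] pq linked_sym linked_trans by metis
    qed
    show "\<exists>x\<in>S \<union> \<mu> ` (P - B). \<exists>y\<in>S \<union> \<mu> ` (P - B). h x = u \<and> h y = v \<and> linked r x y"
      if "(u, v) \<in> r'" for u v
    proof -
      from that obtain x y where xy: "u = Inl x" "v = Inl y" "(x, y) \<in> r0" by (auto simp: r'_def)
      then have "x \<in> S" "y \<in> S" using RS \<iota> by (auto simp: r0_def)
      moreover have "linked r x y" using xy(3) unfolding r0_def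
      proof
        assume "(x, y) \<in> {(\<iota> x, \<iota> y) | x y. x \<in> B \<and> y \<in> B \<and> linked Q x y}"
        then obtain p q where "x = \<iota> p" "y = \<iota> q" "p \<in> B" "q \<in> B" "linked Q p q" by auto
        then show ?thesis using lQ[of p q] by (simp add: \<kappa>)
      qed (auto simp: r_def intro: linked_base)
      ultimately show ?thesis using xy hS by blast
    qed
    have toS: "linked r (\<mu> p) s" if "p \<in> P - B" "hp p = Inl s" for p s
    proof -
      have ne: "cl p \<inter> B \<noteq> {}" using that by (auto simp: hp_def split: if_splits)
      then have "s = \<iota> (SOME b. b \<in> cl p \<inter> B)" using that by (simp add: hp_def)
      moreover have "linked r (\<kappa> p) (\<kappa> (SOME b. b \<in> cl p \<inter> B))"
        using some[OF ne] by (intro lQ) (auto simp: cl_def)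
      ultimately show ?thesis using that(1) some[OF ne] by (auto simp: \<kappa>)
    qed
    show "linked r x y" if xy: "x \<in> S \<union> \<mu> ` (P - B)" "y \<in> S \<union> \<mu> ` (P - B)" "h x = h y" for x y
    proof (cases "\<exists>s. h x = Inl s")
      case True
      then obtain s where s: "h x = Inl s" "h y = Inl s" using \<open>h x = h y\<close> by auto
      have "linked r x s" "linked r y s"
        using that s hS hm toS by auto
      then show ?thesis using linked_sym linked_trans by metis
    next
      case False
      then have "x \<notin> S" "y \<notin> S" using hS[of x] hS[of y] \<open>h x = h y\<close> by auto
      then obtain p q where pq: "x = \<mu> p" "y = \<mu> q" "p \<in> P - B" "q \<in> P - B"
        using xy(1,2) by blast
      then have "hp p = hp q" "\<And>s. hp p \<noteq> Inl s" using \<open>h x = h y\<close> False hm by auto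
      then have "cl p = cl q" by (auto simp: hp_def split: if_splits)
      then have "linked Q p q" using pcl[of q] pq by (auto simp: cl_def)
      then show ?thesis using lQ[of p q] pq by (simp add: \<kappa>)
    qed
  qed
  also have "\<dots> = comps (Inl ` S) r' + card {C \<in> conn_classes P Q. C \<inter> B = {}}"
  proof -
    have "comps T r' = comps (Inl ` S) r' + card ((Inr :: 'b set \<Rightarrow> 'a + 'b set) ` {C \<in> conn_classes P Q. C \<inter> B = {}})"
      unfolding T_def using fin finite_conn_classes RS \<iota>
      by (intro comps_Un_isolated) (auto simp: r'_def r0_def)
    then show ?thesis by (simp add: card_image)
  qed
  also have "comps (Inl ` S) r' = comps S r0"
    unfolding r'_def using RS \<iota> by (intro comps_relabel) (auto simp: r0_def)
  finally show ?thesis by (simp add: r_def r0_def)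
qed

section \<open>Strands\<close>

lemma strand_rel_iff [simp]: "(x, y) \<in> strand_rel M \<longleftrightarrow> {x, y} \<in> M"
  by (simp add: strand_rel_def)

lemma strand_rel_Un: "strand_rel (M \<union> M') = strand_rel M \<union> strand_rel M'"
  by auto

lemma strand_rel_empty [simp]: "strand_rel {} = {}"
  by auto

lemma strand_rel_sub: "\<Union>M \<subseteq> S \<Longrightarrow> strand_rel M \<subseteq> S \<times> S"
  by (auto simp: strand_rel_def subset_eq)

text \<open>The size condition matters: a larger set could have a two-element image, which would be
  taken for a strand. The map may identify both ends of a strand, which then yields a reflexive
  pair.\<close>

lemma strand_rel_image:
  assumes "\<And>s. s \<in> M \<Longrightarrow> card s = 2"
  shows "strand_rel ((`) f ` M) = {(f x, f y) | x y. {x, y} \<in> M}"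
proof -
  have "\<exists>u v. x = f u \<and> y = f v \<and> {u, v} \<in> M" if xy: "{x, y} = f ` s" and s: "s \<in> M" for x y s
  proof -
    obtain u v where uv: "s = {u, v}" using assms[OF s] by (auto simp: card_2_iff)
    then consider "x = f u" "y = f v" | "x = f v" "y = f u" using xy by (auto simp: doubleton_eq_iff)
    then show ?thesis using uv s proof cases
      case 2
      then show ?thesis using uv s by (intro exI[of _ v] exI[of _ u]) (auto simp: insert_commute)
    qed auto
  qed
  then have "strand_rel ((`) f ` M) \<subseteq> {(f x, f y) | x y. {x, y} \<in> M}"
    by (auto simp: strand_rel_def image_iff)
  moreover have "{f x, f y} \<in> (`) f ` M" if "{x, y} \<in> M" for x y
    using that by (intro image_eqI[of _ _ "{x, y}"]) auto
  ultimately show ?thesis by auto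
qed

text \<open>Starting from the discrete set, each strand lowers the number of components by at most
  one: the inequality V - E \<le> C for graphs.\<close>

lemma comps_strands_ge:
  assumes "finite S" "finite M" "\<And>s. s \<in> M \<Longrightarrow> s \<subseteq> S \<and> card s = 2"
  shows "card S \<le> comps S (strand_rel M) + card M"
  using assms(2,3)
proof (induction rule: finite_induct)
  case empty
  then show ?case using assms(1) by simp
next
  case (insert s M)
  obtain a b where ab: "s = {a, b}" using insert.prems[of s] by (auto simp: card_2_iff)
  have "linked (strand_rel (insert s M)) = linked (insert (a, b) (strand_rel M))"
  proof (rule linked_cong)
    show "linked (insert (a, b) (strand_rel M)) x y" if "(x, y) \<in> strand_rel (insert s M)" for x y
      using that ab by (auto simp: doubleton_eq_iff linked_insert intro: linked_base)
    show "linked (strand_rel (insert s M)) x y" if "(x, y) \<in> insert (a, b) (strand_rel M)" for x y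
      using that ab by (intro linked_base) auto
  qed
  then have "comps S (strand_rel (insert s M)) = comps S (insert (a, b) (strand_rel M))"
    by (rule comps_cong_linked)
  moreover have "comps S (strand_rel M) \<le> Suc (comps S (insert (a, b) (strand_rel M)))"
    using insert.prems[of s] ab assms(1) by (intro comps_insert_le) auto
  ultimately show ?case using insert.IH insert.prems insert.hyps by fastforce
qed

lemma perfect_matching_onD:
  assumes "perfect_matching_on S M"
  shows "s \<in> M \<Longrightarrow> s \<subseteq> S" "s \<in> M \<Longrightarrow> card s = 2"
    "x \<in> S \<Longrightarrow> \<exists>y. y \<noteq> x \<and> y \<in> S \<and> {x, y} \<in> M"
    "{x, y} \<in> M \<Longrightarrow> {x, z} \<in> M \<Longrightarrow> y = z"
    "s \<in> M \<Longrightarrow> t \<in> M \<Longrightarrow> x \<in> s \<Longrightarrow> x \<in> t \<Longrightarrow> s = t"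
proof -
  have P1: "\<forall>s\<in>M. s \<subseteq> S \<and> card s = 2" and P2: "\<forall>x\<in>S. \<exists>!s. s \<in> M \<and> x \<in> s"
    using assms unfolding perfect_matching_on_def by auto
  show sub: "s \<subseteq> S" if "s \<in> M" for s using P1 that by blast
  show c2: "card s = 2" if "s \<in> M" for s using P1 that by blast
  show uni: "s = t" if "s \<in> M" "t \<in> M" "x \<in> s" "x \<in> t" for s t x
  proof -
    have "x \<in> S" using sub that by blast
    then show ?thesis using P2 that by (metis (lifting))
  qed
  show "\<exists>y. y \<noteq> x \<and> y \<in> S \<and> {x, y} \<in> M" if "x \<in> S"
  proof -
    obtain s where s: "s \<in> M" "x \<in> s" using P2 \<open>x \<in> S\<close> by blast
    obtain a b where ab: "s = {a, b}" "a \<noteq> b" using c2[OF s(1)] by (auto simp: card_2_iff)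
    then consider "x = a" | "x = b" using s by blast
    then show ?thesis using ab s sub[OF s(1)] by cases (auto simp: insert_commute)
  qed
  show "y = z" if "{x, y} \<in> M" "{x, z} \<in> M"
    using uni[OF that, of x] by (auto simp: doubleton_eq_iff)
qed

lemma perfect_matching_onI:
  assumes "\<And>s. s \<in> M \<Longrightarrow> s \<subseteq> S \<and> card s = 2" "\<And>x. x \<in> S \<Longrightarrow> \<exists>s\<in>M. x \<in> s"
    "\<And>s t x. s \<in> M \<Longrightarrow> t \<in> M \<Longrightarrow> x \<in> s \<Longrightarrow> x \<in> t \<Longrightarrow> s = t"
  shows "perfect_matching_on S M"
proof -
  have "\<exists>!s. s \<in> M \<and> x \<in> s" if x: "x \<in> S" for x
  proof -
    obtain s where "s \<in> M" "x \<in> s" using assms(2)[OF x] by blast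
    then show ?thesis
    proof (intro ex1I[of _ s] conjI)
      show "t = s" if "t \<in> M \<and> x \<in> t" for t
        using assms(3)[of t s x] that \<open>s \<in> M\<close> \<open>x \<in> s\<close> by simp
    qed
  qed
  then show ?thesis unfolding perfect_matching_on_def using assms(1) by blast
qed

lemma card_perfect_matching:
  assumes "perfect_matching_on S M" "finite S"
  shows "finite M" "card S = 2 * card M"
proof -
  have sub: "M \<subseteq> Pow S" using perfect_matching_onD[OF assms(1)] by auto
  then show fin: "finite M" using assms(2) finite_subset by blast
  have "S = \<Union>M" using assms(1) unfolding perfect_matching_on_def by blast
  moreover have "card (\<Union>M) = sum card M"
    using sub assms(2) perfect_matching_onD(5)[OF assms(1)]
    by (intro card_Union_disjoint pairwiseI) (auto simp: disjnt_iff dest: finite_subset)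
  moreover have "sum card M = (\<Sum>s\<in>M. 2)"
    using perfect_matching_onD[OF assms(1)] by (intro sum.cong) auto
  ultimately show "card S = 2 * card M" by simp
qed

lemma perfect_matching_restrict:
  assumes "perfect_matching_on S M"
    and closed: "\<And>x y. {x, y} \<in> M \<Longrightarrow> x \<in> C \<Longrightarrow> y \<in> C"
  shows "perfect_matching_on (S \<inter> C) {s \<in> M. s \<subseteq> C}"
proof (rule perfect_matching_onI)
  fix x assume x: "x \<in> S \<inter> C"
  then obtain y where "{x, y} \<in> M" using perfect_matching_onD(3)[OF assms(1)] by blast
  then show "\<exists>s\<in>{s \<in> M. s \<subseteq> C}. x \<in> s" using closed[of x y] x by (intro bexI[of _ "{x, y}"]) auto
qed (use perfect_matching_onD[OF assms(1)] in auto)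

lemma even_card_closed:
  assumes "perfect_matching_on S M" "finite S" "\<And>x y. {x, y} \<in> M \<Longrightarrow> x \<in> C \<Longrightarrow> y \<in> C"
  shows "even (card (S \<inter> C))"
  using card_perfect_matching(2)[OF perfect_matching_restrict[OF assms(1,3)]] assms(2) by auto

text \<open>In the union of two matchings the component of a point covered only once is a path: as a
  connected graph it has at least one strand fewer than points, so at most two of its points are
  covered only once, and their number is even.\<close>

lemma two_matchings_card:
  assumes M1: "perfect_matching_on P1 M1" and M2: "perfect_matching_on P2 M2"
    and fin: "finite P1" "finite P2" and x: "x \<in> P1 - P2 \<union> (P2 - P1)"
  shows "card {y \<in> P1 - P2 \<union> (P2 - P1). linked (strand_rel (M1 \<union> M2)) x y} = 2"
proof -
  define B where "B = P1 - P2 \<union> (P2 - P1)"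
  define r where "r = strand_rel (M1 \<union> M2)"
  define C where "C = {y \<in> P1 \<union> P2. linked r x y}"
  have cl1: "y \<in> C" if "{z, y} \<in> M1" "z \<in> C" for z y
    using that perfect_matching_onD(1)[OF M1] linked_base[of z y r] linked_trans[of r x z y]
    by (auto simp: C_def r_def)
  have cl2: "y \<in> C" if "{z, y} \<in> M2" "z \<in> C" for z y
    using that perfect_matching_onD(1)[OF M2] linked_base[of z y r] linked_trans[of r x z y]
    by (auto simp: C_def r_def)
  define N1 where "N1 = {s \<in> M1. s \<subseteq> C}"
  define N2 where "N2 = {s \<in> M2. s \<subseteq> C}"
  have N: "perfect_matching_on (P1 \<inter> C) N1" "perfect_matching_on (P2 \<inter> C) N2"
    unfolding N1_def N2_def using perfect_matching_restrict M1 M2 cl1 cl2 by blast+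
  have finC: "finite C" using fin by (simp add: C_def)
  note N12 = card_perfect_matching[OF N(1)] card_perfect_matching[OF N(2)]
  have fN: "finite N1" "finite N2" using N12 fin by auto
  have xC: "x \<in> C" using x by (auto simp: C_def)
  have "comps C (strand_rel (N1 \<union> N2)) = 1"
  proof (rule comps_one[OF xC])
    fix y assume "y \<in> C"
    then have "linked r x y" by (simp add: C_def)
    then show "linked (strand_rel (N1 \<union> N2)) x y"
    proof (induction rule: linked_induct)
      case (step y z)
      have yz: "{y, z} \<in> M1 \<union> M2" using step.hyps(2) by (auto simp: r_def insert_commute)
      have yC: "y \<in> C" using step.hyps(1) yz perfect_matching_onD(1)[OF M1] perfect_matching_onD(1)[OF M2]
        by (auto simp: C_def)
      have "z \<in> C" using yC yz cl1 cl2 by blast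
      then have "{y, z} \<in> N1 \<union> N2" using yz yC by (auto simp: N1_def N2_def)
      then show ?case using step.IH linked_base linked_trans by (metis strand_rel_iff)
    qed simp
  qed
  moreover have "card C \<le> comps C (strand_rel (N1 \<union> N2)) + card (N1 \<union> N2)"
    using finC fN perfect_matching_onD(1,2)[OF N(1)] perfect_matching_onD(1,2)[OF N(2)]
    by (intro comps_strands_ge) blast+
  moreover have "card (N1 \<union> N2) \<le> card N1 + card N2" by (rule card_Un_le)
  ultimately have le: "card C \<le> 1 + card N1 + card N2" by linarith
  have C1: "card (P1 \<inter> C) = 2 * card N1" and C2: "card (P2 \<inter> C) = 2 * card N2"
    using N12 fin by auto
  have "card (P1 \<inter> C) + card (P2 \<inter> C) = card C + card (P1 \<inter> P2 \<inter> C)"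
  proof -
    have "P1 \<inter> C \<union> P2 \<inter> C = C" "P1 \<inter> C \<inter> (P2 \<inter> C) = P1 \<inter> P2 \<inter> C" by (auto simp: C_def)
    then show ?thesis using card_Un_Int[of "P1 \<inter> C" "P2 \<inter> C"] fin by simp
  qed
  moreover have CC: "card C = card (B \<inter> C) + card (P1 \<inter> P2 \<inter> C)"
  proof -
    have "C = B \<inter> C \<union> P1 \<inter> P2 \<inter> C" "B \<inter> C \<inter> (P1 \<inter> P2 \<inter> C) = {}" by (auto simp: B_def C_def)
    then show ?thesis using card_Un_disjoint[of "B \<inter> C" "P1 \<inter> P2 \<inter> C"] finC by simp
  qed
  ultimately have BC: "card (B \<inter> C) + 2 * card (P1 \<inter> P2 \<inter> C) = 2 * card N1 + 2 * card N2"
    using C1 C2 by linarith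
  then have "even (card (B \<inter> C))" by presburger
  \<comment> \<open>Doubling \<open>le\<close>, the bound V \<le> E + 1 for a connected graph, and
    subtracting \<open>BC\<close> leaves at most two points that are covered once.\<close>
  moreover have "card (B \<inter> C) \<le> 2" using BC CC le by linarith
  moreover have "card (B \<inter> C) \<noteq> 0"
    using finC xC x by (auto simp: B_def)
  ultimately have "card (B \<inter> C) = 2"
    by presburger
  moreover have "B \<inter> C = {y \<in> P1 - P2 \<union> (P2 - P1). linked (strand_rel (M1 \<union> M2)) x y}"
    by (auto simp: B_def C_def r_def)
  ultimately show ?thesis by simp
qed

section \<open>Crossingless diagrams in a box\<close>

lemma finite_box_points [simp]: "finite (box_points m)"
  by (simp add: box_points_def)

lemma in_box_points [simp]: "(t, i) \<in> box_points m \<longleftrightarrow> i < m"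
  by (simp add: box_points_def)

lemma tl_diagramsD:
  assumes "D \<in> tl_diagrams m"
  shows "perfect_matching_on (box_points m) D"
    "{x, y} \<in> D \<Longrightarrow> {u, v} \<in> D \<Longrightarrow> box_pos m x < box_pos m u \<Longrightarrow> box_pos m u < box_pos m y \<Longrightarrow>
       box_pos m y < box_pos m v \<Longrightarrow> False"
proof -
  have "perfect_matching_on (box_points m) D" and
    nc: "\<forall>x y u v. {x, y} \<in> D \<longrightarrow> {u, v} \<in> D \<longrightarrow>
      \<not> (box_pos m x < box_pos m u \<and> box_pos m u < box_pos m y \<and> box_pos m y < box_pos m v)"
    using assms by (simp_all add: tl_diagrams_def)
  then show "perfect_matching_on (box_points m) D" by simp
  show "{x, y} \<in> D \<Longrightarrow> {u, v} \<in> D \<Longrightarrow> box_pos m x < box_pos m u \<Longrightarrow> box_pos m u < box_pos m y \<Longrightarrow>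
      box_pos m y < box_pos m v \<Longrightarrow> False"
    using nc[rule_format, of x y u v] by simp
qed

lemma tl_diagrams_sub: "D \<in> tl_diagrams m \<Longrightarrow> D \<subseteq> Pow (box_points m)"
  using perfect_matching_onD(1)[OF tl_diagramsD(1)] by blast

lemma finite_tl_diagrams [simp]: "finite (tl_diagrams m)"
  by (rule finite_subset[of _ "Pow (Pow (box_points m))"]) (auto dest: tl_diagrams_sub)

lemma tl_diagrams_in: "D \<in> tl_diagrams m \<Longrightarrow> {p, q} \<in> D \<Longrightarrow> p \<in> box_points m \<and> q \<in> box_points m"
  using tl_diagrams_sub by blast

lemma inj_box_pos: "inj_on (box_pos m) (box_points m)"
  by (auto simp: inj_on_def box_pos_def box_points_def)

text \<open>The strand through \<open>p\<close> separates the box, and \<open>\<Gamma>\<close> meets either side an even number of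
  times.\<close>

lemma tl_parity:
  assumes D: "D \<in> tl_diagrams m" and closed: "\<And>r s. {r, s} \<in> D \<Longrightarrow> r \<in> \<Gamma> \<Longrightarrow> s \<in> \<Gamma>"
    and pq: "{p, q} \<in> D" "p \<notin> \<Gamma>"
  shows "even (card {r \<in> box_points m \<inter> \<Gamma>. box_pos m r < box_pos m p}) \<longleftrightarrow>
    even (card {r \<in> box_points m \<inter> \<Gamma>. box_pos m r < box_pos m q})"
proof -
  have main: "even (card {r \<in> box_points m \<inter> \<Gamma>. box_pos m r < box_pos m p}) \<longleftrightarrow>
      even (card {r \<in> box_points m \<inter> \<Gamma>. box_pos m r < box_pos m q})"
    if pq: "{p, q} \<in> D" "p \<notin> \<Gamma>" "q \<notin> \<Gamma>" and lt: "box_pos m p < box_pos m q" for p q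
  proof -
    define C where "C = {r \<in> \<Gamma>. box_pos m p < box_pos m r \<and> box_pos m r < box_pos m q}"
    have pm: "p \<in> box_points m" using tl_diagrams_in[OF D pq(1)] by simp
    have "even (card (box_points m \<inter> C))"
    proof (rule even_card_closed[OF tl_diagramsD(1)[OF D]])
      fix r s assume rs: "{r, s} \<in> D" "r \<in> C"
      then have s: "s \<in> \<Gamma>" "{s, r} \<in> D" using closed[of r s] by (simp_all add: C_def insert_commute)
      have "s \<noteq> p" "s \<noteq> q" using s pq by auto
      then have ne: "box_pos m s \<noteq> box_pos m p" "box_pos m s \<noteq> box_pos m q"
        using inj_box_pos[of m] tl_diagrams_in[OF D pq(1)] tl_diagrams_in[OF D rs(1)]
        by (auto simp: inj_on_def)
      have "\<not> box_pos m s < box_pos m p"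
        using tl_diagramsD(2)[OF D s(2) pq(1)] rs(2) by (auto simp: C_def)
      moreover have "\<not> box_pos m q < box_pos m s"
        using tl_diagramsD(2)[OF D pq(1) rs(1)] rs(2) by (auto simp: C_def)
      ultimately show "s \<in> C" using s ne by (auto simp: C_def)
    qed simp
    moreover have "{r \<in> box_points m \<inter> \<Gamma>. box_pos m r < box_pos m q} =
        {r \<in> box_points m \<inter> \<Gamma>. box_pos m r < box_pos m p} \<union> (box_points m \<inter> C)"
      using lt pq(2) inj_onD[OF inj_box_pos[of m], of _ p] pm
      by (auto simp: C_def) (metis linorder_neqE_nat)
    moreover have "card ({r \<in> box_points m \<inter> \<Gamma>. box_pos m r < box_pos m p} \<union> (box_points m \<inter> C)) =
        card {r \<in> box_points m \<inter> \<Gamma>. box_pos m r < box_pos m p} + card (box_points m \<inter> C)"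
      by (intro card_Un_disjoint) (auto simp: C_def)
    ultimately show ?thesis by simp
  qed
  have qp: "{q, p} \<in> D" "q \<notin> \<Gamma>" using pq closed[of q p] by (auto simp: insert_commute)
  show ?thesis using main[of p q] main[of q p] pq qp
    by (cases "box_pos m p" "box_pos m q" rule: linorder_cases) auto
qed

text \<open>The boundary order runs through the top row backwards. Hence the points after a top
  point are those on its left in its own row, and since the total is even, the parity before it
  equals the parity on its left.\<close>

lemma box_parity_row:
  assumes "p \<in> box_points m" "p \<notin> \<Gamma>" "even (card (box_points m \<inter> \<Gamma>))"
  shows "even (card {r \<in> box_points m \<inter> \<Gamma>. box_pos m r < box_pos m p}) \<longleftrightarrow>
    even (card {k. k < snd p \<and> (fst p, k) \<in> \<Gamma>})"
proof (cases p)
  case (Pair t i)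
  have i: "i < m" using assms(1) Pair by simp
  have e: "card {k. k < i \<and> (t, k) \<in> \<Gamma>} = card (Pair t ` {k. k < i \<and> (t, k) \<in> \<Gamma>})"
    by (intro card_image[symmetric]) (auto simp: inj_on_def)
  show ?thesis
  proof (cases t)
    case False
    have "{r \<in> box_points m \<inter> \<Gamma>. box_pos m r < box_pos m p} = Pair t ` {k. k < i \<and> (t, k) \<in> \<Gamma>}"
      using i False Pair by (auto simp: box_pos_def box_points_def split: if_splits)
    then show ?thesis using e Pair by simp
  next
    case True
    have nx: "(t, i) \<notin> \<Gamma>" using assms(2) Pair by simp
    have ki: "k < i" if "\<not> 2 * m - Suc k < 2 * m - Suc i" "k < m" "(t, k) \<in> \<Gamma>" for k
      using that i nx by (cases "k = i") auto
    have "box_points m \<inter> \<Gamma> =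
        {r \<in> box_points m \<inter> \<Gamma>. box_pos m r < box_pos m p} \<union> Pair t ` {k. k < i \<and> (t, k) \<in> \<Gamma>}"
      using i True Pair ki by (auto simp: box_pos_def box_points_def image_iff split: if_splits)
    moreover have "card ({r \<in> box_points m \<inter> \<Gamma>. box_pos m r < box_pos m p} \<union>
        Pair t ` {k. k < i \<and> (t, k) \<in> \<Gamma>}) =
        card {r \<in> box_points m \<inter> \<Gamma>. box_pos m r < box_pos m p} + card (Pair t ` {k. k < i \<and> (t, k) \<in> \<Gamma>})"
      using i True Pair by (intro card_Un_disjoint) (auto simp: box_pos_def box_points_def)
    ultimately have "card (box_points m \<inter> \<Gamma>) =
        card {r \<in> box_points m \<inter> \<Gamma>. box_pos m r < box_pos m p} + card {k. k < i \<and> (t, k) \<in> \<Gamma>}"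
      unfolding e by presburger
    then have "even (card {r \<in> box_points m \<inter> \<Gamma>. box_pos m r < box_pos m p} + card {k. k < i \<and> (t, k) \<in> \<Gamma>})"
      using assms(3) by presburger
    then show ?thesis unfolding Pair fst_conv snd_conv even_add .
  qed
qed

text \<open>In this form the parity depends only on the position within a row, so the values
  computed in two stacked boxes agree on their common row.\<close>

lemma tl_parity_row:
  assumes D: "D \<in> tl_diagrams m" and closed: "\<And>r s. {r, s} \<in> D \<Longrightarrow> r \<in> \<Gamma> \<Longrightarrow> s \<in> \<Gamma>"
    and pq: "{p, q} \<in> D" "p \<notin> \<Gamma>"
  shows "even (card {k. k < snd p \<and> (fst p, k) \<in> \<Gamma>}) \<longleftrightarrow> even (card {k. k < snd q \<and> (fst q, k) \<in> \<Gamma>})"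
proof -
  have "q \<notin> \<Gamma>" using pq closed[of q p] by (auto simp: insert_commute)
  moreover have "even (card (box_points m \<inter> \<Gamma>))"
    using even_card_closed[OF tl_diagramsD(1)[OF D]] closed by simp
  ultimately show ?thesis
    using box_parity_row[of p m \<Gamma>] box_parity_row[of q m \<Gamma>] tl_parity[OF assms] tl_diagrams_in[OF D pq(1)] pq(2)
    by simp
qed

text \<open>Classes of size two form a matching. A crossing x < u < y < v would put one point of the
  class of \<open>x\<close> before \<open>u\<close> and two before \<open>v\<close>, against the
  parity hypothesis. Stacked diagrams and cut networks both obtain their crossingless matchings from
  this criterion.\<close>

lemma induced_diagram:
  assumes Qr: "\<And>x. Q x x" and Qs: "\<And>x y. Q x y \<Longrightarrow> Q y x" and Qt: "\<And>x y z. Q x y \<Longrightarrow> Q y z \<Longrightarrow> Q x z"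
    and two: "\<And>x. x \<in> box_points m \<Longrightarrow> card {y \<in> box_points m. Q x y} = 2"
    and par: "\<And>x u v. x \<in> box_points m \<Longrightarrow> u \<in> box_points m \<Longrightarrow> v \<in> box_points m \<Longrightarrow> Q u v \<Longrightarrow> \<not> Q x u \<Longrightarrow>
      even (card {r \<in> box_points m \<inter> {y. Q x y}. box_pos m r < box_pos m u}) \<longleftrightarrow>
      even (card {r \<in> box_points m \<inter> {y. Q x y}. box_pos m r < box_pos m v})"
  shows "{{x, y} | x y. x \<in> box_points m \<and> y \<in> box_points m \<and> x \<noteq> y \<and> Q x y} \<in> tl_diagrams m"
proof -
  define K where "K = {{x, y} | x y. x \<in> box_points m \<and> y \<in> box_points m \<and> x \<noteq> y \<and> Q x y}"
  have KI: "{x, y} \<in> K \<longleftrightarrow> x \<in> box_points m \<and> y \<in> box_points m \<and> x \<noteq> y \<and> Q x y" for x y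
    unfolding K_def by (blast intro: Qs elim: doubleton_eq_iff[THEN iffD1, elim_format])
  have cls: "{z \<in> box_points m. Q x z} = {x, y}" if "{x, y} \<in> K" for x y
  proof -
    have xy: "x \<in> box_points m" "y \<in> box_points m" "x \<noteq> y" "Q x y" using that KI by auto
    have "{x, y} \<subseteq> {z \<in> box_points m. Q x z}" using xy Qr by auto
    moreover have "card {x, y} = 2" using xy by simp
    ultimately show ?thesis using two[OF xy(1)] card_seteq[of "{z \<in> box_points m. Q x z}" "{x, y}"] by simp
  qed
  have "perfect_matching_on (box_points m) K"
  proof (rule perfect_matching_onI)
    fix x assume x: "x \<in> box_points m"
    have "{z \<in> box_points m. Q x z} \<noteq> {x}" using two[OF x] by auto
    then obtain y where "y \<in> box_points m" "Q x y" "x \<noteq> y" using x Qr by blast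
    then show "\<exists>s\<in>K. x \<in> s" using x KI[of x y] by (intro bexI[of _ "{x, y}"]) auto
  next
    fix s t x assume st: "s \<in> K" "t \<in> K" "x \<in> s" "x \<in> t"
    have s_eq: "s = {z \<in> box_points m. Q x z}" if s: "s \<in> K" "x \<in> s" for s
    proof -
      obtain a b where ab: "s = {a, b}" using s(1) unfolding K_def by blast
      then have "s = {x, if x = a then b else a}" using s(2) by auto
      then show ?thesis using cls s(1) by metis
    qed
    show "s = t" by (rule trans[OF s_eq[OF st(1,3)] s_eq[OF st(2,4), symmetric]])
  next
    fix s assume "s \<in> K"
    then obtain a b where "s = {a, b}" "a \<in> box_points m" "b \<in> box_points m" "a \<noteq> b"
      unfolding K_def by blast
    then show "s \<subseteq> box_points m \<and> card s = 2" by simp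
  qed
  moreover have False
    if K: "{x, y} \<in> K" "{u, v} \<in> K" and lt: "box_pos m x < box_pos m u" "box_pos m u < box_pos m y"
      "box_pos m y < box_pos m v" for x y u v
  proof -
    have uv: "u \<in> box_points m" "v \<in> box_points m" "Q u v" and x: "x \<in> box_points m" using K KI by blast+
    have "u \<notin> {x, y}" using lt by auto
    then have nQ: "\<not> Q x u" using cls[OF K(1)] uv(1) by blast
    have eq: "box_points m \<inter> {y. Q x y} = {x, y}" using cls[OF K(1)] by blast
    have "{r \<in> {x, y}. box_pos m r < box_pos m u} = {x}" "{r \<in> {x, y}. box_pos m r < box_pos m v} = {x, y}"
      using lt by auto
    moreover have "x \<noteq> y" using lt by auto
    ultimately show False using par[OF x uv nQ] unfolding eq by simp
  qed
  ultimately have "K \<in> tl_diagrams m" unfolding tl_diagrams_def by blast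
  then show ?thesis unfolding K_def .
qed

lemma perfect_matching_image:
  assumes "perfect_matching_on S M" "inj_on f S"
  shows "perfect_matching_on (f ` S) ((`) f ` M)"
proof (rule perfect_matching_onI)
  note M = perfect_matching_onD[OF assms(1)]
  show "s \<subseteq> f ` S \<and> card s = 2" if s: "s \<in> (`) f ` M" for s
  proof -
    obtain s' where s': "s' \<in> M" "s = f ` s'" using s by auto
    then show ?thesis using M(1,2)[OF s'(1)] card_image[of f s'] inj_on_subset[OF assms(2)] by auto
  qed
  show "\<exists>s\<in>(`) f ` M. x \<in> s" if "x \<in> f ` S" for x
  proof -
    from that obtain y where y: "x = f y" "y \<in> S" by auto
    then obtain z where "{y, z} \<in> M" using M(3) by blast
    then have "f ` {y, z} \<in> (`) f ` M" by blast
    then show ?thesis using y by (intro bexI[of _ "f ` {y, z}"]) auto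
  qed
  show "s = t" if st: "s \<in> (`) f ` M" "t \<in> (`) f ` M" "x \<in> s" "x \<in> t" for s t x
  proof -
    obtain s' t' y z where *: "s' \<in> M" "s = f ` s'" "t' \<in> M" "t = f ` t'" "y \<in> s'" "x = f y" "z \<in> t'" "x = f z"
      using st by auto
    then have "y = z" using assms(2) M(1)[of s'] M(1)[of t'] by (auto simp: inj_on_def subset_iff)
    then show ?thesis using M(5)[of s' t' y] * by simp
  qed
qed

section \<open>Composition of crossingless diagrams\<close>

definition lo :: "bool \<times> nat \<Rightarrow> nat \<times> nat" where "lo = (\<lambda>(t, i). (if t then 1 else 0, i))"
definition hi :: "bool \<times> nat \<Rightarrow> nat \<times> nat" where "hi = (\<lambda>(t, i). (if t then 2 else 1, i))"
definition outer :: "bool \<times> nat \<Rightarrow> nat \<times> nat" where "outer = (\<lambda>(t, i). (if t then 2 else 0, i))"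

definition stack_rel :: "tl_diagram \<Rightarrow> tl_diagram \<Rightarrow> ((nat \<times> nat) \<times> (nat \<times> nat)) set" where
  "stack_rel D1 D2 = strand_rel ((`) lo ` D1 \<union> (`) hi ` D2)"

lemma tl_stack_eq: "tl_stack m D1 D2 = conn_classes ({0, 1, 2} \<times> {..<m}) (stack_rel D1 D2)"
  by (simp add: tl_stack_def stack_rel_def lo_def hi_def)

lemma inj_lo: "inj lo" and inj_hi: "inj hi" and inj_outer: "inj outer"
  by (auto simp: inj_def lo_def hi_def outer_def split: if_splits)

lemma lo_box: "lo ` box_points m = {0, 1} \<times> {..<m}"
  and hi_box: "hi ` box_points m = {1, 2} \<times> {..<m}"
  and outer_box: "outer ` box_points m = {0, 2} \<times> {..<m}"
proof -
  have U: "box_points m = Pair False ` {..<m} \<union> Pair True ` {..<m}"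
    by (auto simp: box_points_def)
  show "lo ` box_points m = {0, 1} \<times> {..<m}" "hi ` box_points m = {1, 2} \<times> {..<m}"
    "outer ` box_points m = {0, 2} \<times> {..<m}"
    by (auto simp: U image_Un image_image lo_def hi_def outer_def)
qed

lemma stack_rel_eq:
  assumes "D1 \<in> tl_diagrams m" "D2 \<in> tl_diagrams m"
  shows "stack_rel D1 D2 = {(lo x, lo y) | x y. {x, y} \<in> D1} \<union> {(hi x, hi y) | x y. {x, y} \<in> D2}"
  unfolding stack_rel_def strand_rel_Un
  using assms by (subst (1 2) strand_rel_image) (auto dest: perfect_matching_onD(2)[OF tl_diagramsD(1)])

lemma stack_rel_sub:
  assumes "D1 \<in> tl_diagrams m" "D2 \<in> tl_diagrams m"
  shows "stack_rel D1 D2 \<subseteq> ({0, 1, 2} \<times> {..<m}) \<times> ({0, 1, 2} \<times> {..<m})"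
proof -
  have "lo x \<in> {0, 1, 2} \<times> {..<m}" "hi x \<in> {0, 1, 2} \<times> {..<m}" if "x \<in> box_points m" for x
    using that by (cases x; cases "fst x"; simp add: lo_def hi_def box_points_def)+
  then show ?thesis unfolding stack_rel_eq[OF assms]
    using tl_diagrams_in[OF assms(1)] tl_diagrams_in[OF assms(2)] by blast
qed

lemma tl_comp_eq:
  "tl_comp m D1 D2 = {{x, y} | x y. x \<in> box_points m \<and> y \<in> box_points m \<and> x \<noteq> y \<and>
     linked (stack_rel D1 D2) (outer x) (outer y)}"
proof -
  have o: "(if fst x then 2 else 0, snd x) = outer x" for x by (auto simp: outer_def split: prod.splits)
  have "(\<exists>C\<in>tl_stack m D1 D2. outer x \<in> C \<and> outer y \<in> C) \<longleftrightarrow> linked (stack_rel D1 D2) (outer x) (outer y)"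
    if "x \<in> box_points m" "y \<in> box_points m" for x y
  proof -
    have "outer z \<in> {0, 1, 2} \<times> {..<m}" if "z \<in> box_points m" for z
      using that by (cases z; cases "fst z"; simp add: outer_def box_points_def)
    then have "outer x \<in> {0, 1, 2} \<times> {..<m}" "outer y \<in> {0, 1, 2} \<times> {..<m}"
      using that by blast+
    then show ?thesis unfolding tl_stack_eq conn_classes_eq by (auto intro: linked_sym linked_trans)
  qed
  then show ?thesis unfolding tl_comp_def o by (simp cong: conj_cong)
qed

text \<open>The embedded matchings overlap exactly on level 1, so \<open>two_matchings_card\<close>
  links each outer point to one other. Crossings are excluded by a colouring of the complement of a
  strand \<open>\<Gamma>\<close> that is constant along all other strands.\<close>

lemma tl_comp_in:
  assumes D1: "D1 \<in> tl_diagrams m" and D2: "D2 \<in> tl_diagrams m"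
  shows "tl_comp m D1 D2 \<in> tl_diagrams m"
  unfolding tl_comp_eq
proof (rule induced_diagram)
  let ?r = "stack_rel D1 D2"
  have pm: "perfect_matching_on ({0, 1} \<times> {..<m}) ((`) lo ` D1)"
    "perfect_matching_on ({1, 2} \<times> {..<m}) ((`) hi ` D2)"
    using perfect_matching_image[OF tl_diagramsD(1)[OF D1], of lo] perfect_matching_image[OF tl_diagramsD(1)[OF D2], of hi]
      inj_on_subset[OF inj_lo] inj_on_subset[OF inj_hi] by (auto simp: lo_box hi_box)
  show two: "card {y \<in> box_points m. linked ?r (outer x) (outer y)} = 2" if x: "x \<in> box_points m" for x
  proof -
    have B: "{0, 1} \<times> {..<m} - {1, 2} \<times> {..<m} \<union> ({1, 2} \<times> {..<m} - {0, 1} \<times> {..<m}) = outer ` box_points m"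
      unfolding outer_box by auto
    have "card {y \<in> outer ` box_points m. linked ?r (outer x) y} = 2"
      using two_matchings_card[OF pm, of "outer x"] x unfolding B stack_rel_def by simp
    moreover have "{y \<in> outer ` box_points m. linked ?r (outer x) y} =
        outer ` {y \<in> box_points m. linked ?r (outer x) (outer y)}" by auto
    ultimately show ?thesis by (simp add: card_image inj_on_subset[OF inj_outer])
  qed
  show "even (card {r \<in> box_points m \<inter> {y. linked ?r (outer x) (outer y)}. box_pos m r < box_pos m u}) \<longleftrightarrow>
      even (card {r \<in> box_points m \<inter> {y. linked ?r (outer x) (outer y)}. box_pos m r < box_pos m v})"
    if x: "x \<in> box_points m" and u: "u \<in> box_points m" and v: "v \<in> box_points m"
      and uv: "linked ?r (outer u) (outer v)" and xu: "\<not> linked ?r (outer x) (outer u)" for x u v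
  proof -
    define \<Gamma> where "\<Gamma> = {y. linked ?r (outer x) y}"
    have cl: "b \<in> \<Gamma>" if "(a, b) \<in> ?r" "a \<in> \<Gamma>" for a b
      using that linked_base linked_trans by (fastforce simp: \<Gamma>_def)
    \<comment> \<open>The colour counts the points of \<open>\<Gamma>\<close> to the left in the
      same row, modulo 2. It is defined on levels rather than boxes, so a single value serves the
      middle row for both boxes.\<close>
    define \<chi> where "\<chi> y = even (card {k. k < snd y \<and> (fst y, k) \<in> \<Gamma>})" for y :: "nat \<times> nat"
    have \<chi>lo: "\<chi> (lo p) = even (card {k. k < snd p \<and> (fst p, k) \<in> lo -` \<Gamma>})"
      and \<chi>hi: "\<chi> (hi p) = even (card {k. k < snd p \<and> (fst p, k) \<in> hi -` \<Gamma>})"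
      and \<chi>outer: "\<chi> (outer p) = even (card {k. k < snd p \<and> (fst p, k) \<in> outer -` \<Gamma>})" for p
      by (auto simp: \<chi>_def lo_def hi_def outer_def split: prod.splits)
    have step: "\<chi> a = \<chi> b" if "(a, b) \<in> ?r" "a \<notin> \<Gamma>" for a b
      using that(1) unfolding stack_rel_eq[OF D1 D2]
    proof
      assume "(a, b) \<in> {(lo x, lo y) | x y. {x, y} \<in> D1}"
      then obtain p q where pq: "a = lo p" "b = lo q" "{p, q} \<in> D1" by auto
      have "s \<in> lo -` \<Gamma>" if "{r, s} \<in> D1" "r \<in> lo -` \<Gamma>" for r s
        using that cl[of "lo r" "lo s"] by (auto simp: stack_rel_eq[OF D1 D2])
      then show ?thesis using tl_parity_row[OF D1 _ pq(3), of "lo -` \<Gamma>"] that(2) pq by (simp add: \<chi>lo)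
    next
      assume "(a, b) \<in> {(hi x, hi y) | x y. {x, y} \<in> D2}"
      then obtain p q where pq: "a = hi p" "b = hi q" "{p, q} \<in> D2" by auto
      have "s \<in> hi -` \<Gamma>" if "{r, s} \<in> D2" "r \<in> hi -` \<Gamma>" for r s
        using that cl[of "hi r" "hi s"] by (auto simp: stack_rel_eq[OF D1 D2])
      then show ?thesis using tl_parity_row[OF D2 _ pq(3), of "hi -` \<Gamma>"] that(2) pq by (simp add: \<chi>hi)
    qed
    have sym: "(b, a) \<in> ?r" if "(a, b) \<in> ?r" for a b
      using that by (auto simp: stack_rel_def insert_commute)
    from uv have "\<chi> (outer v) = \<chi> (outer u) \<and> outer v \<notin> \<Gamma>"
    proof (induction rule: linked_induct)
      case refl
      then show ?case using xu by (simp add: \<Gamma>_def)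
    next
      case (step y z)
      then have "(y, z) \<in> ?r" "(z, y) \<in> ?r" using sym by blast+
      then show ?case using step.IH \<open>\<And>b a. (a, b) \<in> ?r \<Longrightarrow> a \<notin> \<Gamma> \<Longrightarrow> \<chi> a = \<chi> b\<close> cl by metis
    qed
    moreover have ev: "even (card (box_points m \<inter> outer -` \<Gamma>))"
    proof -
      have "box_points m \<inter> outer -` \<Gamma> = {y \<in> box_points m. linked ?r (outer x) (outer y)}"
        by (auto simp: \<Gamma>_def)
      then show ?thesis using two[OF x] by simp
    qed
    moreover have "outer u \<notin> \<Gamma>" using xu by (simp add: \<Gamma>_def)
    ultimately show ?thesis
      using box_parity_row[of u m "outer -` \<Gamma>"] box_parity_row[of v m "outer -` \<Gamma>"] u v
      by (simp add: \<chi>outer) (simp add: \<Gamma>_def vimage_def)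
  qed
qed (rule linked_refl, erule linked_sym, erule (1) linked_trans)

section \<open>The identity diagram, caps, and insertion of a vertical strand\<close>

definition tl_id :: "nat \<Rightarrow> tl_diagram" where
  "tl_id m = (\<lambda>i. {(False, i), (True, i)}) ` {..<m}"

lemma tl_idI: "i < m \<Longrightarrow> {(t, i), (\<not> t, i)} \<in> tl_id m"
  by (cases t) (auto simp: tl_id_def insert_commute)

lemma box_pos_False [simp]: "box_pos m (False, i) = i"
  and box_pos_True [simp]: "box_pos m (True, i) = 2 * m - Suc i"
  by (simp_all add: box_pos_def)

text \<open>The strand leaving the neighbour of \<open>i\<close> is trapped under the cap from
  \<open>i\<close> to \<open>j\<close>, so it is a shorter cap on the same row; an innermost one
  joins neighbours.\<close>

lemma short_cap:
  assumes D: "D \<in> tl_diagrams m" and ij: "i < j" "{(t, i), (t, j)} \<in> D"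
  shows "\<exists>k. Suc k < m \<and> {(t, k), (t, Suc k)} \<in> D"
  using ij
proof (induction "j - i" arbitrary: i j rule: less_induct)
  case less
  have jm: "j < m" using tl_diagrams_in[OF D less.prems(2)] by simp
  show ?case
  proof (cases "j = Suc i")
    case False
    have "(t, Suc i) \<in> box_points m" using jm less.prems(1) by simp
    then obtain y where y: "{(t, Suc i), y} \<in> D" "y \<in> box_points m" "y \<noteq> (t, Suc i)"
      using perfect_matching_onD(3)[OF tl_diagramsD(1)[OF D]] by blast
    have y': "{y, (t, Suc i)} \<in> D" "{(t, j), (t, i)} \<in> D" using y less.prems(2) by (simp_all add: insert_commute)
    have "y \<noteq> (t, i)"
      using perfect_matching_onD(4)[OF tl_diagramsD(1)[OF D] less.prems(2), of "(t, Suc i)"] y' False by auto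
    moreover have "y \<noteq> (t, j)"
      using perfect_matching_onD(4)[OF tl_diagramsD(1)[OF D] y'(2), of "(t, Suc i)"] y' by auto
    ultimately have ne: "box_pos m y \<noteq> box_pos m (t, i)" "box_pos m y \<noteq> box_pos m (t, j)"
      using inj_onD[OF inj_box_pos, of m y "(t, i)"] inj_onD[OF inj_box_pos, of m y "(t, j)"] y(2) jm less.prems(1)
      by auto
    note cr = tl_diagramsD(2)[OF D]
    have "\<exists>k. y = (t, k) \<and> i < k \<and> k < j"
    proof (cases t)
      case True
      have "Suc i < j" using less.prems(1) False by simp
      then have "2 * m - Suc j < 2 * m - Suc (Suc i)" "2 * m - Suc (Suc i) < 2 * m - Suc i"
        using jm by arith+
      then have "box_pos m (t, j) < box_pos m (t, Suc i)" "box_pos m (t, Suc i) < box_pos m (t, i)"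
        using True by simp_all
      then have "\<not> box_pos m y < box_pos m (t, j)" "\<not> box_pos m (t, i) < box_pos m y"
        using cr[OF y'(1) y'(2)] cr[OF y'(2) y(1)] by blast+
      then show ?thesis using ne y(2) True jm less.prems(1) by (cases y) (auto simp: box_pos_def split: if_splits)
    next
      case tF: False
      have "Suc i < j" using less.prems(1) False by simp
      then have "box_pos m (t, Suc i) < box_pos m (t, j)" "box_pos m (t, i) < box_pos m (t, Suc i)"
        using tF by simp_all
      then have "\<not> box_pos m y < box_pos m (t, i)" "\<not> box_pos m (t, j) < box_pos m y"
        using cr[OF y'(1) less.prems(2)] cr[OF less.prems(2) y(1)] by blast+
      then show ?thesis using ne y(2) tF jm less.prems(1) by (cases y) (auto simp: box_pos_def split: if_splits)
    qed
    then obtain k where k: "y = (t, k)" "i < k" "k < j" by blast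
    then have "Suc i < k" using y(3) by auto
    then show ?thesis using less.hyps[of k "Suc i"] k y(1) by simp
  qed (use less.prems jm in auto)
qed

lemma strict_mono_self_map:
  fixes \<sigma> :: "nat \<Rightarrow> nat"
  assumes mono: "\<And>i j. i < j \<Longrightarrow> j < m \<Longrightarrow> \<sigma> i < \<sigma> j" and bd: "\<And>i. i < m \<Longrightarrow> \<sigma> i < m" and "i < m"
  shows "\<sigma> i = i"
proof (rule antisym)
  show "i \<le> \<sigma> i" using assms(3)
  proof (induction i)
    case (Suc i)
    then show ?case using mono[of i "Suc i"] by simp
  qed simp
  have "\<sigma> (m - Suc k) \<le> m - Suc k" if "k < m" for k using that
  proof (induction k)
    case 0
    then show ?case using bd[of "m - 1"] by simp
  next
    case (Suc k)
    have "\<sigma> (m - Suc (Suc k)) < \<sigma> (m - Suc k)" using Suc.prems by (intro mono) auto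
    then show ?case using Suc by simp
  qed
  from this[of "m - Suc i"] show "\<sigma> i \<le> i" using assms(3) by simp
qed

text \<open>If no strand returns to row \<open>t\<close>, all points of that row are joined to the
  opposite row, and absence of crossings makes the resulting map increasing, hence the identity. The
  row \<open>t\<close> is free, so a cap can be requested on whichever side faces another
  box.\<close>

lemma tl_cap:
  assumes D: "D \<in> tl_diagrams m" and "D \<noteq> tl_id m"
  shows "\<exists>i. Suc i < m \<and> {(t, i), (t, Suc i)} \<in> D"
proof (cases "\<exists>i j. i < j \<and> {(t, i), (t, j)} \<in> D")
  case True
  then show ?thesis using short_cap[OF D] by blast
next
  case False
  note pm = perfect_matching_onD[OF tl_diagramsD(1)[OF D]]
  have "\<exists>j. j < m \<and> {(t, i), (\<not> t, j)} \<in> D" if i: "i < m" for i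
  proof -
    obtain y where y: "y \<noteq> (t, i)" "y \<in> box_points m" "{(t, i), y} \<in> D" using pm(3)[of "(t, i)"] i by auto
    obtain u j where uj: "y = (u, j)" by (cases y)
    have "u = (\<not> t)"
    proof (rule ccontr)
      assume "u \<noteq> (\<not> t)"
      then have "{(t, i), (t, j)} \<in> D" "i \<noteq> j" using y uj by auto
      moreover from this(1) have "{(t, j), (t, i)} \<in> D" by (simp add: insert_commute)
      ultimately show False using False by (cases i j rule: linorder_cases) auto
    qed
    then show ?thesis using y uj by auto
  qed
  then obtain \<sigma> where \<sigma>: "\<And>i. i < m \<Longrightarrow> \<sigma> i < m \<and> {(t, i), (\<not> t, \<sigma> i)} \<in> D" by metis
  have "\<sigma> i = i" if "i < m" for i
  proof (rule strict_mono_self_map[OF _ _ that])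
    fix i j assume ij: "i < j" "j < m"
    then have s: "{(t, i), (\<not> t, \<sigma> i)} \<in> D" "{(t, j), (\<not> t, \<sigma> j)} \<in> D" "\<sigma> i < m" "\<sigma> j < m"
      using \<sigma>[of i] \<sigma>[of j] by auto
    then have s': "{(\<not> t, \<sigma> i), (t, i)} \<in> D" "{(\<not> t, \<sigma> j), (t, j)} \<in> D" by (simp_all add: insert_commute)
    have "\<sigma> i \<noteq> \<sigma> j" using pm(4)[of "(\<not> t, \<sigma> i)" "(t, i)" "(t, j)"] s' ij by auto
    moreover have "\<not> \<sigma> j < \<sigma> i"
    proof
      assume lt: "\<sigma> j < \<sigma> i"
      show False
      proof (cases t)
        case True
        have "\<sigma> i < 2 * m - Suc j" "2 * m - Suc j < 2 * m - Suc i" using ij s by arith+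
        then show False using tl_diagramsD(2)[OF D s'(2) s'(1)] lt True by simp
      next
        case False
        have "j < 2 * m - Suc (\<sigma> i)" "2 * m - Suc (\<sigma> i) < 2 * m - Suc (\<sigma> j)" using ij s lt by arith+
        then show False using tl_diagramsD(2)[OF D s(1) s(2)] ij False by simp
      qed
    qed
    ultimately show "\<sigma> i < \<sigma> j" by simp
  qed (use \<sigma> in auto)
  then have id: "{(t, i), (\<not> t, i)} \<in> D" if "i < m" for i using \<sigma>[OF that] that by simp
  have id': "{(False, i), (True, i)} \<in> D" if "i < m" for i
    using id[OF that] by (cases t) (auto simp: insert_commute)
  have "s \<in> tl_id m" if s: "s \<in> D" for s
  proof -
    obtain u i v where "s = {(u, i), v}" using pm(2)[OF s] unfolding card_2_iff by (metis surj_pair)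
    then have ui: "(u, i) \<in> s" by simp
    then have im: "i < m" using pm(1)[OF s] by auto
    then have "s = {(False, i), (True, i)}" using pm(5)[OF s id'[OF im] ui] by (cases u) auto
    then show ?thesis using im by (auto simp: tl_id_def)
  qed
  moreover have "tl_id m \<subseteq> D" using id' by (auto simp: tl_id_def)
  ultimately show ?thesis using assms(2) by blast
qed

lemma tl_comp_keeps_cap:
  assumes "D1 \<in> tl_diagrams m" "D2 \<in> tl_diagrams m" "i < m" "j < m" "i \<noteq> j"
  shows "{(False, i), (False, j)} \<in> D1 \<Longrightarrow> {(False, i), (False, j)} \<in> tl_comp m D1 D2"
    and "{(True, i), (True, j)} \<in> D2 \<Longrightarrow> {(True, i), (True, j)} \<in> tl_comp m D1 D2"
proof -
  show "{(False, i), (False, j)} \<in> tl_comp m D1 D2" if "{(False, i), (False, j)} \<in> D1"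
  proof -
    have "(lo (False, i), lo (False, j)) \<in> stack_rel D1 D2" using that by (auto simp: stack_rel_eq[OF assms(1,2)])
    then have "linked (stack_rel D1 D2) (outer (False, i)) (outer (False, j))"
      by (intro linked_base) (simp add: lo_def outer_def)
    then show ?thesis unfolding tl_comp_eq using assms
      by (intro CollectI exI[of _ "(False, i)"] exI[of _ "(False, j)"]) auto
  qed
  show "{(True, i), (True, j)} \<in> tl_comp m D1 D2" if "{(True, i), (True, j)} \<in> D2"
  proof -
    have "(hi (True, i), hi (True, j)) \<in> stack_rel D1 D2" using that by (auto simp: stack_rel_eq[OF assms(1,2)])
    then have "linked (stack_rel D1 D2) (outer (True, i)) (outer (True, j))"
      by (intro linked_base) (simp add: hi_def outer_def)
    then show ?thesis unfolding tl_comp_eq using assms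
      by (intro CollectI exI[of _ "(True, i)"] exI[of _ "(True, j)"]) auto
  qed
qed

lemma cap_not_tl_id: "{(t, i), (t, Suc i)} \<notin> tl_id m"
  by (auto simp: tl_id_def doubleton_eq_iff)

text \<open>The diagrams other than the identity span a two-sided ideal, because a cap on an outer
  row of a factor survives stacking. The outer row is the bottom for \<open>D1\<close> and the top
  for \<open>D2\<close>.\<close>

lemma tl_comp_eq_id:
  assumes "D1 \<in> tl_diagrams m" "D2 \<in> tl_diagrams m" "tl_comp m D1 D2 = tl_id m"
  shows "D1 = tl_id m" "D2 = tl_id m"
proof -
  show "D1 = tl_id m"
  proof (rule ccontr)
    assume "D1 \<noteq> tl_id m"
    then obtain i where "Suc i < m" "{(False, i), (False, Suc i)} \<in> D1" using tl_cap[OF assms(1)] by blast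
    then have "{(False, i), (False, Suc i)} \<in> tl_comp m D1 D2" using assms by (intro tl_comp_keeps_cap) auto
    then show False using assms(3) cap_not_tl_id by simp
  qed
  show "D2 = tl_id m"
  proof (rule ccontr)
    assume "D2 \<noteq> tl_id m"
    then obtain i where "Suc i < m" "{(True, i), (True, Suc i)} \<in> D2" using tl_cap[OF assms(2)] by blast
    then have "{(True, i), (True, Suc i)} \<in> tl_comp m D1 D2" using assms by (intro tl_comp_keeps_cap) auto
    then show False using assms(3) cap_not_tl_id by simp
  qed
qed

text \<open>The new vertical strand occupies the adjacent positions \<open>n\<close> and
  \<open>Suc n\<close> of the boundary order and the other points keep their relative order, so no
  crossing can appear.\<close>

lemma tl_insert_strand:
  assumes D: "D \<in> tl_diagrams n"
  shows "insert {(False, n), (True, n)} D \<in> tl_diagrams (Suc n)" "{(False, n), (True, n)} \<notin> D"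
proof -
  let ?s = "{(False, n), (True, n)}"
  note pm = perfect_matching_onD[OF tl_diagramsD(1)[OF D]]
  show "?s \<notin> D" using pm(1)[of ?s] by auto
  have disj: "x \<notin> t" if "t \<in> D" "x \<in> ?s" for x t using pm(1)[OF that(1)] that(2) by auto
  have "perfect_matching_on (box_points (Suc n)) (insert ?s D)"
  proof (rule perfect_matching_onI)
    show "s \<subseteq> box_points (Suc n) \<and> card s = 2" if "s \<in> insert ?s D" for s
    proof (cases "s = ?s")
      case False
      have "box_points n \<subseteq> box_points (Suc n)" by (auto simp: box_points_def)
      then show ?thesis using that False pm(1)[of s] pm(2)[of s] by blast
    qed simp
    show "\<exists>s\<in>insert ?s D. x \<in> s" if x: "x \<in> box_points (Suc n)" for x
    proof (cases "x \<in> box_points n")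
      case True
      then show ?thesis using pm(3)[of x] by auto
    next
      case False
      then show ?thesis using x by (cases x; cases "fst x") (auto simp: box_points_def)
    qed
    show "s = t" if "s \<in> insert ?s D" "t \<in> insert ?s D" "x \<in> s" "x \<in> t" for s t x
      using that disj[of s x] disj[of t x] pm(5)[of s t x] by (cases "s = ?s"; cases "t = ?s") auto
  qed
  moreover have False
    if s: "{x, y} \<in> insert ?s D" "{u, v} \<in> insert ?s D" and
      lt: "box_pos (Suc n) x < box_pos (Suc n) u" "box_pos (Suc n) u < box_pos (Suc n) y"
       "box_pos (Suc n) y < box_pos (Suc n) v" for x y u v
  proof -
    have new: "box_pos (Suc n) a = n \<and> box_pos (Suc n) b = Suc n \<or> box_pos (Suc n) b = n \<and> box_pos (Suc n) a = Suc n"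
      if "{a, b} = ?s" for a b using that by (auto simp: doubleton_eq_iff)
    have "{x, y} \<noteq> ?s" using new[of x y] lt by linarith
    moreover have "{u, v} \<noteq> ?s" using new[of u v] lt by linarith
    ultimately have xy: "{x, y} \<in> D" "{u, v} \<in> D" using s by auto
    have old: "box_pos (Suc n) a < box_pos (Suc n) b \<longleftrightarrow> box_pos n a < box_pos n b"
      if "a \<in> box_points n" "b \<in> box_points n" for a b
      using that by (cases a; cases b; cases "fst a"; cases "fst b") (auto simp: box_pos_def)
    show False using tl_diagramsD(2)[OF D xy] lt old tl_diagrams_in[OF D xy(1)] tl_diagrams_in[OF D xy(2)] by auto
  qed
  ultimately show "insert ?s D \<in> tl_diagrams (Suc n)" unfolding tl_diagrams_def by blast
qed

lemma tl_delete_strand: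
  assumes D: "D \<in> tl_diagrams (Suc n)" "{(False, n), (True, n)} \<in> D"
  shows "D - {{(False, n), (True, n)}} \<in> tl_diagrams n"
proof -
  let ?s = "{(False, n), (True, n)}"
  note pm = perfect_matching_onD[OF tl_diagramsD(1)[OF D(1)]]
  have sub: "t \<subseteq> box_points n" if t: "t \<in> D" "t \<noteq> ?s" for t
  proof
    fix x assume x: "x \<in> t"
    have "x \<notin> ?s" using pm(5)[OF t(1) D(2) x] t by blast
    then show "x \<in> box_points n" using pm(1)[OF t(1)] x by (cases x; cases "fst x") (auto simp: box_points_def less_Suc_eq)
  qed
  have "perfect_matching_on (box_points n) (D - {?s})"
  proof (rule perfect_matching_onI)
    show "s \<subseteq> box_points n \<and> card s = 2" if "s \<in> D - {?s}" for s
      using that sub[of s] pm(2)[of s] by auto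
    show "\<exists>s\<in>D - {?s}. x \<in> s" if x: "x \<in> box_points n" for x
    proof -
      have "x \<in> box_points (Suc n)" using x by (auto simp: box_points_def)
      then obtain y where "{x, y} \<in> D" using pm(3) by blast
      moreover have "x \<notin> ?s" using x by auto
      ultimately show ?thesis by (intro bexI[of _ "{x, y}"]) auto
    qed
    show "s = t" if "s \<in> D - {?s}" "t \<in> D - {?s}" "x \<in> s" "x \<in> t" for s t x
      using that pm(5)[of s t x] by blast
  qed
  moreover have False
    if s: "{x, y} \<in> D - {?s}" "{u, v} \<in> D - {?s}" and
      lt: "box_pos n x < box_pos n u" "box_pos n u < box_pos n y" "box_pos n y < box_pos n v" for x y u v
  proof -
    have "box_pos (Suc n) a < box_pos (Suc n) b \<longleftrightarrow> box_pos n a < box_pos n b"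
      if "a \<in> box_points n" "b \<in> box_points n" for a b
      using that by (cases a; cases b; cases "fst a"; cases "fst b") (auto simp: box_pos_def)
    moreover have "x \<in> box_points n" "y \<in> box_points n" "u \<in> box_points n" "v \<in> box_points n"
      using s sub[of "{x, y}"] sub[of "{u, v}"] by auto
    ultimately show False using tl_diagramsD(2)[OF D(1), of x y u v] s lt by simp
  qed
  ultimately show ?thesis unfolding tl_diagrams_def by blast
qed

lemma sum_add_strand:
  "(\<Sum>D\<in>tl_diagrams (Suc n). tl_add_strand n f D * G D) =
   (\<Sum>D\<in>tl_diagrams n. f D * G (insert {(False, n), (True, n)} D))"
proof -
  let ?s = "{(False, n), (True, n)}"
  let ?X = "{D \<in> tl_diagrams (Suc n). ?s \<in> D}"
  have "(\<Sum>D\<in>tl_diagrams (Suc n). tl_add_strand n f D * G D) = (\<Sum>D\<in>?X. f (D - {?s}) * G D)"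
    by (rule sum.mono_neutral_cong_right) (auto simp: tl_add_strand_def)
  also have "\<dots> = (\<Sum>D\<in>tl_diagrams n. f D * G (insert ?s D))"
  proof (rule sum.reindex_bij_witness[where i = "insert ?s" and j = "\<lambda>D. D - {?s}"])
    fix D assume "D \<in> tl_diagrams n"
    then show "insert ?s D \<in> ?X" "insert ?s D - {?s} = D" using tl_insert_strand by auto
  next
    fix D assume "D \<in> ?X"
    then show "D - {?s} \<in> tl_diagrams n" using tl_delete_strand by auto
  qed (auto simp: insert_absorb)
  finally show ?thesis .
qed

definition hook_diagram :: "nat \<Rightarrow> tl_diagram" where
  "hook_diagram m = tl_id m \<union> {{(False, m), (False, Suc m)}, {(True, m), (True, Suc m)}}"

lemma tl_hook_eq: "tl_hook m = (\<lambda>D. if D = hook_diagram m then 1 else 0)"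
  by (simp add: tl_hook_def hook_diagram_def tl_id_def)

lemma hook_diagram_in: "hook_diagram m \<in> tl_diagrams (Suc (Suc m))"
proof -
  let ?M = "Suc (Suc m)"
  have "perfect_matching_on (box_points ?M) (hook_diagram m)"
  proof (rule perfect_matching_onI)
    show "s \<subseteq> box_points ?M \<and> card s = 2" if "s \<in> hook_diagram m" for s
      using that by (auto simp: hook_diagram_def tl_id_def)
    show "\<exists>s\<in>hook_diagram m. x \<in> s" if x: "x \<in> box_points ?M" for x
    proof -
      obtain t i where ti: "x = (t, i)" "i < ?M" using x by (cases x) auto
      then consider "i < m" | "i = m" | "i = Suc m" by linarith
      then show ?thesis using ti by cases (cases t; auto simp: hook_diagram_def tl_id_def)+
    qed
    show "s = t" if "s \<in> hook_diagram m" "t \<in> hook_diagram m" "x \<in> s" "x \<in> t" for s t x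
      using that by (auto simp: hook_diagram_def tl_id_def)
  qed
  moreover have False
    if s: "{x, y} \<in> hook_diagram m" "{u, v} \<in> hook_diagram m" and
      lt: "box_pos ?M x < box_pos ?M u" "box_pos ?M u < box_pos ?M y" "box_pos ?M y < box_pos ?M v" for x y u v
  proof -
    \<comment> \<open>With M = m + 2 the two end positions of a vertical strand add up to 2 M - 1 =
      2 m + 3. These strands are nested around the two short arcs, which occupy m, m + 1 and m + 2,
      m + 3.\<close>
    have pos: "box_pos ?M a + box_pos ?M b = 2 * m + 3 \<and> (box_pos ?M a < m \<or> box_pos ?M b < m) \<or>
        box_pos ?M a = m \<and> box_pos ?M b = m + 1 \<or> box_pos ?M b = m \<and> box_pos ?M a = m + 1 \<or>
        box_pos ?M a = m + 2 \<and> box_pos ?M b = m + 3 \<or> box_pos ?M b = m + 2 \<and> box_pos ?M a = m + 3"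
      if "{a, b} \<in> hook_diagram m" for a b
    proof -
      from that consider i where "i < m" "{a, b} = {(False, i), (True, i)}"
        | "{a, b} = {(False, m), (False, Suc m)}" | "{a, b} = {(True, m), (True, Suc m)}"
        unfolding hook_diagram_def tl_id_def by blast
      then show ?thesis by cases (auto simp: doubleton_eq_iff)
    qed
    show False using pos[OF s(1)] pos[OF s(2)] lt by (elim disjE conjE; linarith)
  qed
  ultimately show ?thesis unfolding tl_diagrams_def by blast
qed

lemma tl_id_in: "tl_id m \<in> tl_diagrams m"
proof (induction m)
  case 0
  then show ?case by (simp add: tl_id_def tl_diagrams_def perfect_matching_on_def box_points_def)
next
  case (Suc m)
  have "tl_id (Suc m) = insert {(False, m), (True, m)} (tl_id m)"
    by (simp add: tl_id_def lessThan_Suc)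
  then show ?case using tl_insert_strand(1)[OF Suc] by simp
qed

lemma tl_diagrams_0 [simp]: "tl_diagrams 0 = {{}}"
proof -
  have "D = {}" if D: "D \<in> tl_diagrams 0" for D
  proof -
    have "s = {}" if "s \<in> D" for s using tl_diagrams_sub[OF D] that by (auto simp: box_points_def)
    then show ?thesis using perfect_matching_onD(2)[OF tl_diagramsD(1)[OF D]] by fastforce
  qed
  then show ?thesis using tl_id_in[of 0] by (auto simp: tl_id_def)
qed

text \<open>The correction term in Wenzl's recursion contains the hook, which is not the identity,
  so it lies in the ideal of \<open>tl_comp_eq_id\<close> and does not affect the coefficient of the
  identity.\<close>

lemma jones_wenzl_id: "jones_wenzl m (tl_id m) = 1"
proof (induction m rule: jones_wenzl.induct)
  case 1
  then show ?case by (simp add: tl_id_def)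
next
  case 2
  have "tl_id (Suc 0) = {{(False, 0), (True, 0)}}" by (auto simp: tl_id_def)
  then show ?case using tl_id_in[of "Suc 0"] by (simp add: tl_add_strand_def)
next
  case (3 m)
  let ?M = "Suc (Suc m)"
  define g where "g = tl_add_strand (Suc m) (jones_wenzl (Suc m))"
  have s: "tl_id ?M = insert {(False, Suc m), (True, Suc m)} (tl_id (Suc m))"
    by (simp add: tl_id_def lessThan_Suc)
  have "g (tl_id ?M) = jones_wenzl (Suc m) (tl_id ?M - {{(False, Suc m), (True, Suc m)}})"
    using tl_id_in[of ?M] by (simp add: g_def tl_add_strand_def s)
  also have "tl_id ?M - {{(False, Suc m), (True, Suc m)}} = tl_id (Suc m)"
    using tl_insert_strand(2)[OF tl_id_in[of "Suc m"]] s by simp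
  finally have g1: "g (tl_id ?M) = 1" using 3 by simp
  have ne: "hook_diagram m \<noteq> tl_id ?M"
    using cap_not_tl_id[of False m ?M] by (auto simp: hook_diagram_def)
  have "tl_mult ?M g (tl_hook m) (tl_id ?M) = 0"
    unfolding tl_mult_def tl_hook_eq
  proof (intro sum.neutral ballI)
    fix D1 D2 assume D: "D1 \<in> tl_diagrams ?M" "D2 \<in> tl_diagrams ?M"
    show "(if tl_comp ?M D1 D2 = tl_id ?M then loop_value ^ tl_loops ?M D1 D2 * g D1 *
        (if D2 = hook_diagram m then 1 else 0) else 0) = 0"
      using tl_comp_eq_id(2)[OF D] ne by auto
  qed
  then have "tl_mult ?M (tl_mult ?M g (tl_hook m)) g (tl_id ?M) = 0"
    unfolding tl_mult_def[of ?M "tl_mult ?M g (tl_hook m)"]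
  proof (intro sum.neutral ballI)
    fix D1 D2 assume D: "D1 \<in> tl_diagrams ?M" "D2 \<in> tl_diagrams ?M"
    show "(if tl_comp ?M D1 D2 = tl_id ?M then loop_value ^ tl_loops ?M D1 D2 *
        tl_mult ?M g (tl_hook m) D1 * g D2 else 0) = 0"
      using tl_comp_eq_id(1)[OF D] \<open>tl_mult ?M g (tl_hook m) (tl_id ?M) = 0\<close> by auto
  qed
  then show ?case using g1 by (simp add: Let_def g_def)
qed

section \<open>Diagrams inside a context\<close>

definition glue :: "(bool \<times> nat \<Rightarrow> 'a) \<Rightarrow> tl_diagram \<Rightarrow> ('a \<times> 'a) set" where
  "glue \<iota> D = {(\<iota> x, \<iota> y) | x y. {x, y} \<in> D}"

text \<open>The map \<open>\<iota>\<close> from the boundary of the box need not be injective: the ends of a trivial outside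
  strand may be identified.\<close>

definition skein :: "nat \<Rightarrow> tl_elem \<Rightarrow> 'a set \<Rightarrow> ('a \<times> 'a) set \<Rightarrow> (bool \<times> nat \<Rightarrow> 'a) \<Rightarrow> ratfun" where
  "skein m f S R \<iota> = (\<Sum>D\<in>tl_diagrams m. f D * loop_value ^ comps S (R \<union> glue \<iota> D))"

lemma glueI: "{x, y} \<in> D \<Longrightarrow> (\<iota> x, \<iota> y) \<in> glue \<iota> D"
  by (auto simp: glue_def)

lemma glue_sub: "D \<in> tl_diagrams m \<Longrightarrow> \<iota> ` box_points m \<subseteq> S \<Longrightarrow> glue \<iota> D \<subseteq> S \<times> S"
  using tl_diagrams_in unfolding glue_def by blast

lemma glue_insert: "glue \<iota> (insert {a, b} D) = {(\<iota> a, \<iota> b), (\<iota> b, \<iota> a)} \<union> glue \<iota> D"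
  unfolding glue_def by (auto simp: doubleton_eq_iff)

lemma glue_tl_id:
  "(a, b) \<in> glue \<iota> (tl_id m) \<longleftrightarrow>
     (\<exists>i<m. a = \<iota> (False, i) \<and> b = \<iota> (True, i) \<or> a = \<iota> (True, i) \<and> b = \<iota> (False, i))"
proof -
  have "{x, y} \<in> tl_id m \<longleftrightarrow> (\<exists>i<m. x = (False, i) \<and> y = (True, i) \<or> x = (True, i) \<and> y = (False, i))" for x y
    unfolding tl_id_def by (auto simp: doubleton_eq_iff)
  then show ?thesis unfolding glue_def by (simp, blast)
qed

text \<open>The added vertical strand is the same in every term of the expansion, so it can be
  handed over to the context as one more connection.\<close>

lemma skein_add_strand:
  "skein (Suc n) (tl_add_strand n f) S R \<iota> = skein n f S (insert (\<iota> (False, n), \<iota> (True, n)) R) \<iota>"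
  unfolding skein_def sum_add_strand
proof (intro sum.cong refl)
  fix D
  have "linked (R \<union> glue \<iota> (insert {(False, n), (True, n)} D)) =
      linked (insert (\<iota> (False, n), \<iota> (True, n)) R \<union> glue \<iota> D)"
    unfolding glue_insert by (rule linked_cong) (auto intro: linked_base linked_base')
  from comps_cong_linked[OF this, of S]
  show "f D * loop_value ^ comps S (R \<union> glue \<iota> (insert {(False, n), (True, n)} D)) =
      f D * loop_value ^ comps S (insert (\<iota> (False, n), \<iota> (True, n)) R \<union> glue \<iota> D)"
    by (rule arg_cong)
qed

lemma image_Collect_ex2:
  fixes \<kappa> :: "'b \<Rightarrow> 'd" and f :: "'c \<Rightarrow> 'b"
  shows "map_prod \<kappa> \<kappa> ` {(f x, f y) | x y. P x y} = {(\<kappa> (f x), \<kappa> (f y)) | x y. P x y}"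
proof -
  have *: "{(g x, g y) | x y. P x y} = (\<lambda>(x, y). (g x, g y)) ` {(x, y). P x y}" for g :: "'c \<Rightarrow> 'd"
    by auto
  have "{(g x, g y) | x y. P x y} = (\<lambda>(x, y). (g x, g y)) ` {(x, y). P x y}" for g :: "'c \<Rightarrow> 'b"
    by auto
  then show ?thesis by (simp add: image_image case_prod_beta * )
qed

text \<open>This is \<open>comps_glue\<close> for the piece formed by both diagrams: the interior is
  the common row, renamed by \<open>\<mu>\<close>, and the boundary consists of the two outer rows.
  The closed classes are exactly the loops of \<open>tl_loops\<close>.\<close>

lemma comps_stack:
  assumes D: "D1 \<in> tl_diagrams m" "D2 \<in> tl_diagrams m" and S: "finite S" "R \<subseteq> S \<times> S" "\<iota> ` box_points m \<subseteq> S"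
    and \<mu>: "inj_on \<mu> {..<m}" "\<mu> ` {..<m} \<inter> S = {}"
  shows "comps (S \<union> \<mu> ` {..<m}) (R \<union> glue (\<lambda>p. if fst p then \<mu> (snd p) else \<iota> p) D1 \<union>
      glue (\<lambda>p. if fst p then \<iota> p else \<mu> (snd p)) D2) =
    tl_loops m D1 D2 + comps S (R \<union> glue \<iota> (tl_comp m D1 D2))"
proof -
  define P where "P = {0, 1, 2 :: nat} \<times> {..<m}"
  define B where "B = outer ` box_points m"
  define \<iota>' where "\<iota>' q = \<iota> (fst q = (2 :: nat), snd q)" for q
  define \<mu>' where "\<mu>' q = \<mu> (snd q)" for q :: "nat \<times> nat"
  define \<kappa> where "\<kappa> q = (if q \<in> B then \<iota>' q else \<mu>' q)" for q
  let ?r = "stack_rel D1 D2"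
  have PB: "P - B = {1} \<times> {..<m}" by (auto simp: P_def B_def outer_box)
  have \<mu>'PB: "\<mu>' ` (P - B) = \<mu> ` {..<m}" unfolding PB by (auto simp: \<mu>'_def image_iff)
  have \<iota>'o: "\<iota>' (outer p) = \<iota> p" for p by (cases p) (simp add: \<iota>'_def outer_def)
  have \<kappa>lo: "\<kappa> (lo p) = (if fst p then \<mu> (snd p) else \<iota> p)" if "p \<in> box_points m" for p
    using that unfolding \<kappa>_def B_def outer_box by (cases p; cases "fst p") (auto simp: lo_def \<iota>'_def \<mu>'_def)
  have \<kappa>hi: "\<kappa> (hi p) = (if fst p then \<iota> p else \<mu> (snd p))" if "p \<in> box_points m" for p
    using that unfolding \<kappa>_def B_def outer_box by (cases p; cases "fst p") (auto simp: hi_def \<iota>'_def \<mu>'_def)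
  have "map_prod \<kappa> \<kappa> ` ?r = {(\<kappa> (lo x), \<kappa> (lo y)) | x y. {x, y} \<in> D1} \<union> {(\<kappa> (hi x), \<kappa> (hi y)) | x y. {x, y} \<in> D2}"
    unfolding stack_rel_eq[OF D] by (simp only: image_Un image_Collect_ex2)
  also have "\<dots> = glue (\<lambda>p. if fst p then \<mu> (snd p) else \<iota> p) D1 \<union> glue (\<lambda>p. if fst p then \<iota> p else \<mu> (snd p)) D2"
    unfolding glue_def using \<kappa>lo \<kappa>hi tl_diagrams_in[OF D(1)] tl_diagrams_in[OF D(2)]
    by (intro arg_cong2[where f = "(\<union>)"] Collect_cong iff_exI) (auto cong: conj_cong)
  finally have Q: "map_prod \<kappa> \<kappa> ` ?r = \<dots>" .
  have "comps (S \<union> \<mu>' ` (P - B)) (R \<union> map_prod \<kappa> \<kappa> ` ?r) =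
      card {C \<in> conn_classes P ?r. C \<inter> B = {}} + comps S (R \<union> {(\<iota>' x, \<iota>' y) | x y. x \<in> B \<and> y \<in> B \<and> linked ?r x y})"
  proof (rule comps_glue)
    show "finite P" "finite S" "R \<subseteq> S \<times> S" using S by (auto simp: P_def)
    show "?r \<subseteq> P \<times> P" unfolding P_def by (rule stack_rel_sub[OF D])
    show "B \<subseteq> P" by (auto simp: P_def B_def outer_box)
    show "\<iota>' ` B \<subseteq> S" using S(3) by (auto simp: B_def \<iota>'o image_image)
    show "inj_on \<mu>' (P - B)" unfolding PB using \<mu>(1) by (auto simp: inj_on_def \<mu>'_def)
    show "\<mu>' ` (P - B) \<inter> S = {}" using \<mu>(2) \<mu>'PB by simp
  qed (simp add: \<kappa>_def)
  moreover have "{C \<in> conn_classes P ?r. C \<inter> B = {}} = {C \<in> tl_stack m D1 D2. C \<subseteq> {1} \<times> {..<m}}"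
  proof -
    have "C \<inter> B = {} \<longleftrightarrow> C \<subseteq> {1} \<times> {..<m}" if "C \<in> conn_classes P ?r" for C
    proof -
      have "C \<subseteq> P" using that by (auto simp: conn_classes_eq)
      moreover have "({1} \<times> {..<m}) \<inter> B = {}" using PB by blast
      ultimately show ?thesis using PB by blast
    qed
    then show ?thesis unfolding tl_stack_eq P_def[symmetric] by blast
  qed
  moreover have "comps S (R \<union> {(\<iota>' x, \<iota>' y) | x y. x \<in> B \<and> y \<in> B \<and> linked ?r x y}) =
      comps S (R \<union> glue \<iota> (tl_comp m D1 D2))"
  proof (rule comps_cong_linked, rule linked_cong)
    fix a b assume "(a, b) \<in> R \<union> {(\<iota>' x, \<iota>' y) | x y. x \<in> B \<and> y \<in> B \<and> linked ?r x y}"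
    then show "linked (R \<union> glue \<iota> (tl_comp m D1 D2)) a b"
    proof
      assume "(a, b) \<in> {(\<iota>' x, \<iota>' y) | x y. x \<in> B \<and> y \<in> B \<and> linked ?r x y}"
      then obtain x y where xy: "a = \<iota> x" "b = \<iota> y" "x \<in> box_points m" "y \<in> box_points m"
          "linked ?r (outer x) (outer y)"
        unfolding B_def using \<iota>'o by auto
      show ?thesis
      proof (cases "x = y")
        case False
        then have "{x, y} \<in> tl_comp m D1 D2" unfolding tl_comp_eq using xy by blast
        then show ?thesis using xy by (intro linked_base) (auto intro: glueI)
      qed (use xy in auto)
    qed (auto intro: linked_base)
  next
    fix a b assume "(a, b) \<in> R \<union> glue \<iota> (tl_comp m D1 D2)"
    then show "linked (R \<union> {(\<iota>' x, \<iota>' y) | x y. x \<in> B \<and> y \<in> B \<and> linked ?r x y}) a b"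
    proof
      assume "(a, b) \<in> glue \<iota> (tl_comp m D1 D2)"
      then obtain x y where ab: "a = \<iota> x" "b = \<iota> y" "{x, y} \<in> tl_comp m D1 D2" by (auto simp: glue_def)
      then have xy: "x \<in> box_points m" "y \<in> box_points m" "linked ?r (outer x) (outer y)"
        unfolding tl_comp_eq by (auto simp: doubleton_eq_iff intro: linked_sym)
      then have "\<iota>' (outer x) = a" "\<iota>' (outer y) = b" "outer x \<in> B" "outer y \<in> B"
        using ab by (auto simp: \<iota>'o B_def)
      then show ?thesis using xy(3) by (intro linked_base) blast
    qed (auto intro: linked_base)
  qed
  ultimately show ?thesis unfolding Q \<mu>'PB tl_loops_def by (simp add: Un_assoc)
qed

text \<open>A product evaluated in a context is a pair of separate boxes joined along a fresh row
  \<open>\<mu>\<close>. The loop factors of the algebra become ordinary components, so later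
  rearrangements are mere changes of the order of summation.\<close>

lemma skein_mult:
  assumes S: "finite S" "R \<subseteq> S \<times> S" "\<iota> ` box_points m \<subseteq> S"
    and \<mu>: "inj_on \<mu> {..<m}" "\<mu> ` {..<m} \<inter> S = {}"
  shows "skein m (tl_mult m f g) S R \<iota> = (\<Sum>D1\<in>tl_diagrams m. \<Sum>D2\<in>tl_diagrams m. f D1 * g D2 *
    loop_value ^ comps (S \<union> \<mu> ` {..<m}) (R \<union> glue (\<lambda>p. if fst p then \<mu> (snd p) else \<iota> p) D1 \<union>
      glue (\<lambda>p. if fst p then \<iota> p else \<mu> (snd p)) D2))"
proof -
  let ?c = "\<lambda>D. loop_value ^ comps S (R \<union> glue \<iota> D)"
  let ?t = "\<lambda>D1 D2. loop_value ^ tl_loops m D1 D2 * f D1 * g D2"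
  have "skein m (tl_mult m f g) S R \<iota> =
      (\<Sum>D\<in>tl_diagrams m. \<Sum>D1\<in>tl_diagrams m. \<Sum>D2\<in>tl_diagrams m. if tl_comp m D1 D2 = D then ?t D1 D2 * ?c D else 0)"
    unfolding skein_def tl_mult_def sum_distrib_right by (intro sum.cong refl) auto
  also have "\<dots> = (\<Sum>D1\<in>tl_diagrams m. \<Sum>D2\<in>tl_diagrams m. \<Sum>D\<in>tl_diagrams m. if tl_comp m D1 D2 = D then ?t D1 D2 * ?c D else 0)"
    by (subst sum.swap) (intro sum.cong refl sum.swap)
  also have "\<dots> = (\<Sum>D1\<in>tl_diagrams m. \<Sum>D2\<in>tl_diagrams m. ?t D1 D2 * ?c (tl_comp m D1 D2))"
    by (intro sum.cong refl) (simp add: sum.delta' tl_comp_in)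
  also have "\<dots> = (\<Sum>D1\<in>tl_diagrams m. \<Sum>D2\<in>tl_diagrams m. f D1 * g D2 *
    loop_value ^ comps (S \<union> \<mu> ` {..<m}) (R \<union> glue (\<lambda>p. if fst p then \<mu> (snd p) else \<iota> p) D1 \<union>
      glue (\<lambda>p. if fst p then \<iota> p else \<mu> (snd p)) D2))"
    by (intro sum.cong refl) (simp add: comps_stack[OF _ _ S \<mu>] power_add mult_ac)
  finally show ?thesis .
qed

section \<open>The values of coloured circles\<close>

lemma varA_power: "varA ^ k = Fract ([:0, 1:] ^ k) 1"
  by (induction k) (simp_all add: varA_def One_fract_def)

lemma varA_power_eq_1_iff: "varA ^ k = 1 \<longleftrightarrow> k = 0"
proof
  assume "varA ^ k = 1"
  then have "[:0, 1 :: rat:] ^ k = 1" by (simp add: varA_power One_fract_def eq_fract)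
  then have "degree ([:0, 1 :: rat:] ^ k) = 0" by simp
  then show "k = 0" by (simp add: degree_linear_power)
qed simp

lemma varA_nonzero [simp]: "varA \<noteq> 0"
  by (simp add: varA_def Zero_fract_def eq_fract)

text \<open>Equality of a power of A with its inverse would make A a root of unity, which the degree
  excludes.\<close>

lemma varA_power_diff_nonzero: "k > 0 \<Longrightarrow> varA ^ k - inverse varA ^ k \<noteq> 0"
  using varA_power_eq_1_iff[of "k + k"] by (auto simp: power_add field_simps)

lemma Delta_nonzero [simp]: "Delta n \<noteq> 0"
  using varA_power_diff_nonzero[of "2 * (n + 1)"] varA_power_diff_nonzero[of 2]
  by (simp add: Delta_def del: mult_Suc_right)

lemma Delta_eq:
  "Delta n * (varA ^ 2 - inverse varA ^ 2) = (-1) ^ n * ((varA ^ 2) ^ Suc n - (inverse varA ^ 2) ^ Suc n)"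
  using varA_power_diff_nonzero[of 2] unfolding Delta_def power_mult by simp

lemma Delta_0 [simp]: "Delta 0 = 1"
  using varA_power_diff_nonzero[of 2] by (simp add: Delta_def)

lemma Delta_1: "Delta (Suc 0) = loop_value"
proof -
  have "Delta (Suc 0) * (varA ^ 2 - inverse varA ^ 2) = loop_value * (varA ^ 2 - inverse varA ^ 2)"
    unfolding Delta_eq loop_value_def by (simp add: algebra_simps power2_eq_square)
  then show ?thesis using varA_power_diff_nonzero[of 2] by simp
qed

lemma loop_value_nonzero [simp]: "loop_value \<noteq> 0"
  using Delta_nonzero[of "Suc 0"] by (simp add: Delta_1 del: Delta_nonzero)

text \<open>The Chebyshev recurrence, from the identity for u^n - w^n with u = A^2, w = A^(-2) and u
  w = 1. It combines the two terms of Wenzl's recursion into one quotient of circle values when a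
  strand is closed.\<close>

lemma Delta_Suc_Suc: "Delta (Suc (Suc n)) = loop_value * Delta (Suc n) - Delta n"
proof -
  define u w where "u = varA ^ 2" and "w = inverse varA ^ 2"
  have uw: "u * w = 1" by (simp add: u_def w_def power_inverse)
  have D: "Delta k * (u - w) = (-1) ^ k * (u ^ Suc k - w ^ Suc k)" for k
    using Delta_eq[of k] by (simp add: u_def w_def)
  have "(u + w) * (u ^ Suc (Suc n) - w ^ Suc (Suc n)) =
      u ^ Suc (Suc (Suc n)) - w ^ Suc (Suc (Suc n)) + (u * w) * (u ^ Suc n - w ^ Suc n)"
    by (simp add: algebra_simps)
  then have step: "(u + w) * (u ^ Suc (Suc n) - w ^ Suc (Suc n)) - (u ^ Suc n - w ^ Suc n) =
      u ^ Suc (Suc (Suc n)) - w ^ Suc (Suc (Suc n))" unfolding uw by simp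
  have lv: "loop_value = - (u + w)" by (simp add: loop_value_def u_def w_def)
  have "(loop_value * Delta (Suc n) - Delta n) * (u - w) =
      loop_value * (Delta (Suc n) * (u - w)) - Delta n * (u - w)"
    by (simp only: left_diff_distrib mult.assoc)
  also have "\<dots> = (-1) ^ n * ((u + w) * (u ^ Suc (Suc n) - w ^ Suc (Suc n)) - (u ^ Suc n - w ^ Suc n))"
    unfolding D lv by (simp add: algebra_simps)
  also have "\<dots> = Delta (Suc (Suc n)) * (u - w)" unfolding step D by simp
  finally have "(loop_value * Delta (Suc n) - Delta n) * (u - w) = Delta (Suc (Suc n)) * (u - w)" .
  moreover have "u - w \<noteq> 0" using varA_power_diff_nonzero[of 2] by (simp add: u_def w_def)
  ultimately show ?thesis by (metis mult_right_cancel)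
qed

section \<open>Wenzl's recursion in a context\<close>

text \<open>In \<open>(f \<otimes> 1) e (f \<otimes> 1)\<close> the identity strands of the hook \<open>e\<close> are shrunk to the points
  \<open>N, N + 1, \<dots>\<close>, and its two caps are shrunk into the adjacent outer points.\<close>

definition leg :: "nat \<Rightarrow> nat \<Rightarrow> (bool \<times> nat \<Rightarrow> nat) \<Rightarrow> bool \<Rightarrow> bool \<times> nat \<Rightarrow> nat" where
  "leg m N \<iota> t p = (if fst p = t then \<iota> p else if snd p < m then N + snd p else \<iota> (t, Suc m))"

text \<open>Two applications of \<open>skein_mult\<close> put three boxes in a column. The hook and
  the vertical strands of both factors f \<otimes> 1 are then explicit and can be shrunk. The hook
  bends the last inner end of each \<open>f\<close> back to the outer point \<open>Suc m\<close> of
  its own side, which is why \<open>leg\<close> sends that end there.\<close>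

lemma skein_Wenzl:
  assumes SN: "S \<subseteq> {..<N}" and RS: "R \<subseteq> S \<times> S" and \<iota>: "\<iota> ` box_points (Suc (Suc m)) \<subseteq> S"
  shows "skein (Suc (Suc m)) (jones_wenzl (Suc (Suc m))) S R \<iota> =
    skein (Suc m) (jones_wenzl (Suc m)) S (insert (\<iota> (False, Suc m), \<iota> (True, Suc m)) R) \<iota> -
    Delta m / Delta (Suc m) * (\<Sum>D1\<in>tl_diagrams (Suc m). \<Sum>D2\<in>tl_diagrams (Suc m).
      jones_wenzl (Suc m) D1 * jones_wenzl (Suc m) D2 * loop_value ^ comps (S \<union> {N..<N + m})
        (R \<union> glue (leg m N \<iota> False) D1 \<union> glue (leg m N \<iota> True) D2))"
proof -
  define M where "M = Suc (Suc m)"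
  define f where "f = jones_wenzl (Suc m)"
  define g where "g = tl_add_strand (Suc m) f"
  \<comment> \<open>Two disjoint fresh rows above \<open>S\<close>: \<open>\<mu>1\<close> lies
    between the lower factor and the hook, \<open>\<mu>2\<close> between the hook and the upper
    factor.\<close>
  define \<mu>1 where "\<mu>1 i = N + i" for i
  define \<mu>2 where "\<mu>2 i = N + M + i" for i
  define \<kappa>F where "\<kappa>F p = (if fst p then \<mu>2 (snd p) else \<iota> p)" for p
  define \<kappa>T where "\<kappa>T p = (if fst p then \<iota> p else \<mu>2 (snd p))" for p
  define \<kappa>a where "\<kappa>a p = (if fst p then \<mu>1 (snd p) else \<kappa>F p)" for p
  define \<kappa>b where "\<kappa>b p = (if fst p then \<kappa>F p else \<mu>1 (snd p))" for p
  define S2 where "S2 = S \<union> \<mu>2 ` {..<M}"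
  define ins where "ins D = insert {(False, Suc m), (True, Suc m)} D" for D :: tl_diagram
  define H where "H = hook_diagram m"
  have fS: "finite S" using SN finite_subset by blast
  have \<iota>S: "\<iota> p \<in> S" if "p \<in> box_points M" for p using \<iota> that by (auto simp: M_def)
  define Cc where "Cc D1 D2 = comps (S2 \<union> \<mu>1 ` {..<M}) (R \<union> glue \<kappa>T D2 \<union> glue \<kappa>a D1 \<union> glue \<kappa>b H)" for D1 D2
  have "skein M (tl_mult M (tl_mult M g (tl_hook m)) g) S R \<iota> =
      (\<Sum>D1\<in>tl_diagrams M. \<Sum>D2\<in>tl_diagrams M. tl_mult M g (tl_hook m) D1 * g D2 *
        loop_value ^ comps S2 (R \<union> glue \<kappa>F D1 \<union> glue \<kappa>T D2))"
    unfolding S2_def \<kappa>F_def \<kappa>T_def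
    by (rule skein_mult) (use fS RS \<iota> SN in \<open>auto simp: \<mu>2_def inj_on_def M_def\<close>)
  also have "\<dots> = (\<Sum>D2\<in>tl_diagrams M. g D2 * skein M (tl_mult M g (tl_hook m)) S2 (R \<union> glue \<kappa>T D2) \<kappa>F)"
    unfolding skein_def sum_distrib_left
    by (subst sum.swap) (intro sum.cong refl, simp add: Un_ac mult_ac)
  also have "\<dots> = (\<Sum>D2\<in>tl_diagrams M. g D2 * (\<Sum>D1\<in>tl_diagrams M. g D1 * loop_value ^ Cc D1 D2))"
  proof (intro sum.cong refl arg_cong2[where f = "(*)"])
    fix D2 assume D2: "D2 \<in> tl_diagrams M"
    have "skein M (tl_mult M g (tl_hook m)) S2 (R \<union> glue \<kappa>T D2) \<kappa>F =
        (\<Sum>D1\<in>tl_diagrams M. \<Sum>E\<in>tl_diagrams M. g D1 * tl_hook m E *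
          loop_value ^ comps (S2 \<union> \<mu>1 ` {..<M}) (R \<union> glue \<kappa>T D2 \<union> glue \<kappa>a D1 \<union> glue \<kappa>b E))"
      unfolding \<kappa>a_def \<kappa>b_def
    proof (rule skein_mult)
      show "finite S2" using fS by (simp add: S2_def)
      have "\<kappa>T ` box_points M \<subseteq> S2" "\<kappa>F ` box_points M \<subseteq> S2"
        using \<iota>S by (auto simp: S2_def \<kappa>T_def \<kappa>F_def box_points_def)
      moreover have "R \<subseteq> S2 \<times> S2" using RS by (auto simp: S2_def)
      ultimately show "R \<union> glue \<kappa>T D2 \<subseteq> S2 \<times> S2" "\<kappa>F ` box_points M \<subseteq> S2"
        using glue_sub[OF D2, of \<kappa>T S2] by simp_all
      show "inj_on \<mu>1 {..<M}" "\<mu>1 ` {..<M} \<inter> S2 = {}"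
        using SN by (auto simp: \<mu>1_def inj_on_def S2_def \<mu>2_def)
    qed
    also have "\<dots> = (\<Sum>D1\<in>tl_diagrams M. g D1 * loop_value ^ Cc D1 D2)"
    proof (intro sum.cong refl)
      fix D1
      have "(\<Sum>E\<in>tl_diagrams M. g D1 * tl_hook m E *
          loop_value ^ comps (S2 \<union> \<mu>1 ` {..<M}) (R \<union> glue \<kappa>T D2 \<union> glue \<kappa>a D1 \<union> glue \<kappa>b E)) =
        (\<Sum>E\<in>tl_diagrams M. if E = H then g D1 *
          loop_value ^ comps (S2 \<union> \<mu>1 ` {..<M}) (R \<union> glue \<kappa>T D2 \<union> glue \<kappa>a D1 \<union> glue \<kappa>b E) else 0)"
        by (intro sum.cong refl) (simp add: tl_hook_eq H_def)
      then show "(\<Sum>E\<in>tl_diagrams M. g D1 * tl_hook m E *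
          loop_value ^ comps (S2 \<union> \<mu>1 ` {..<M}) (R \<union> glue \<kappa>T D2 \<union> glue \<kappa>a D1 \<union> glue \<kappa>b E)) =
          g D1 * loop_value ^ Cc D1 D2"
        using hook_diagram_in[of m] by (simp add: Cc_def H_def M_def)
    qed
    finally show "skein M (tl_mult M g (tl_hook m)) S2 (R \<union> glue \<kappa>T D2) \<kappa>F =
        (\<Sum>D1\<in>tl_diagrams M. g D1 * loop_value ^ Cc D1 D2)" .
  qed
  also have "\<dots> = (\<Sum>D2\<in>tl_diagrams (Suc m). f D2 * (\<Sum>D1\<in>tl_diagrams (Suc m). f D1 * loop_value ^ Cc (ins D1) (ins D2)))"
    unfolding M_def g_def sum_add_strand ins_def ..
  also have "\<dots> = (\<Sum>D1\<in>tl_diagrams (Suc m). \<Sum>D2\<in>tl_diagrams (Suc m). f D1 * f D2 * loop_value ^ Cc (ins D1) (ins D2))"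
    unfolding sum_distrib_left by (subst sum.swap) (simp add: mult_ac)
  also have "\<dots> = (\<Sum>D1\<in>tl_diagrams (Suc m). \<Sum>D2\<in>tl_diagrams (Suc m).
      f D1 * f D2 * loop_value ^ comps (S \<union> {N..<N + m})
        (R \<union> glue (leg m N \<iota> False) D1 \<union> glue (leg m N \<iota> True) D2))"
  proof (intro sum.cong refl)
    fix D1 D2 assume D: "D1 \<in> tl_diagrams (Suc m)" "D2 \<in> tl_diagrams (Suc m)"
    define r where "r = R \<union> glue \<kappa>T (ins D2) \<union> glue \<kappa>a (ins D1) \<union> glue \<kappa>b H"
    define r' where "r' = R \<union> glue (leg m N \<iota> False) D1 \<union> glue (leg m N \<iota> True) D2"
    \<comment> \<open>The retraction: each through strand of the hook is shrunk to its lower end on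
      row \<open>\<mu>1\<close>, while the last two points of either fresh row go to the outer point
      to which the hook and the added vertical strand join them.\<close>
    define h where "h x = (if x < N then x else if x < N + M then (if x - N < m then x else \<iota> (False, Suc m))
      else (if x - N - M < m then x - M else \<iota> (True, Suc m)))" for x
    have hS: "h x = x" if "x \<in> S" for x using that SN by (auto simp: h_def)
    have h1: "h (\<mu>1 i) = (if i < m then N + i else \<iota> (False, Suc m))" if "i < M" for i
      using that by (simp add: h_def \<mu>1_def)
    have h2: "h (\<mu>2 i) = (if i < m then N + i else \<iota> (True, Suc m))" if "i < M" for i
      using that by (simp add: h_def \<mu>2_def)
    have sm: "(t, Suc m) \<in> box_points M" for t by (simp add: M_def)
    have e: "linked r (\<mu>1 m) (\<mu>1 (Suc m))" "linked r (\<mu>1 (Suc m)) (\<iota> (False, Suc m))"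
      "linked r (\<mu>2 m) (\<mu>2 (Suc m))" "linked r (\<mu>2 (Suc m)) (\<iota> (True, Suc m))"
    proof -
      have "(\<kappa>b (False, m), \<kappa>b (False, Suc m)) \<in> r" "(\<kappa>b (True, m), \<kappa>b (True, Suc m)) \<in> r"
        unfolding r_def H_def hook_diagram_def by (auto intro!: glueI)
      then show "linked r (\<mu>1 m) (\<mu>1 (Suc m))" "linked r (\<mu>2 m) (\<mu>2 (Suc m))"
        by (auto simp: \<kappa>b_def \<kappa>F_def intro: linked_base)
      have "(\<kappa>a (False, Suc m), \<kappa>a (True, Suc m)) \<in> r" "(\<kappa>T (False, Suc m), \<kappa>T (True, Suc m)) \<in> r"
        unfolding r_def ins_def by (auto intro!: glueI)
      then show "linked r (\<mu>1 (Suc m)) (\<iota> (False, Suc m))" "linked r (\<mu>2 (Suc m)) (\<iota> (True, Suc m))"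
        by (auto simp: \<kappa>a_def \<kappa>F_def \<kappa>T_def intro: linked_base linked_base')
    qed
    have e12: "linked r (\<mu>2 i) (\<mu>1 i)" if "i < m" for i
    proof -
      have "(\<kappa>b (True, i), \<kappa>b (False, i)) \<in> r"
        using tl_idI[OF that, of True] unfolding r_def H_def hook_diagram_def by (auto intro!: glueI)
      then show ?thesis by (auto simp: \<kappa>b_def \<kappa>F_def intro: linked_base)
    qed
    have m1: "linked r (\<mu>1 i) (h (\<mu>1 i))" if "i < M" for i
    proof -
      from that consider "i < m" | "i = m" | "i = Suc m" unfolding M_def by linarith
      then show ?thesis
        using linked_trans[OF e(1,2)] e(2) h1[OF that] by cases (auto simp: \<mu>1_def)
    qed
    have m2: "linked r (\<mu>2 i) (h (\<mu>2 i))" if "i < M" for i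
    proof -
      from that consider "i < m" | "i = m" | "i = Suc m" unfolding M_def by linarith
      then show ?thesis
        using linked_trans[OF e(3,4)] e(4) h2[OF that] e12[of i] by cases (auto simp: \<mu>1_def)
    qed
    have hT: "h (\<kappa>T p) = leg m N \<iota> True p" if "p \<in> box_points (Suc m)" for p
      using that hS \<iota>S[of p] h2 by (cases p) (auto simp: \<kappa>T_def leg_def M_def)
    have ha: "h (\<kappa>a p) = leg m N \<iota> False p" if "p \<in> box_points (Suc m)" for p
      using that hS \<iota>S[of p] h1 by (cases p) (auto simp: \<kappa>a_def \<kappa>F_def leg_def M_def)
    have X: "linked r x (h x)" if "x \<in> S2 \<union> \<mu>1 ` {..<M}" for x
      using that m1 m2 hS by (auto simp: S2_def)
    have \<kappa>X: "\<kappa>T p \<in> S2 \<union> \<mu>1 ` {..<M}" "\<kappa>a p \<in> S2 \<union> \<mu>1 ` {..<M}" if "p \<in> box_points M" for p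
      using that \<iota>S[of p] by (cases p; auto simp: \<kappa>T_def \<kappa>a_def \<kappa>F_def S2_def)+
    have bb: "p \<in> box_points M" if "p \<in> box_points (Suc m)" for p using that by (auto simp: box_points_def M_def)
    have "comps (S2 \<union> \<mu>1 ` {..<M}) r = comps (S \<union> {N..<N + m}) r'"
    proof (rule comps_section[where h = h and g = "\<lambda>x. x"])
      show "h ` (S2 \<union> \<mu>1 ` {..<M}) = S \<union> {N..<N + m}"
      proof
        show "h ` (S2 \<union> \<mu>1 ` {..<M}) \<subseteq> S \<union> {N..<N + m}"
          using hS h1 h2 \<iota>S[OF sm] by (auto simp: S2_def)
        have "x \<in> h ` (S2 \<union> \<mu>1 ` {..<M})" if "x \<in> {N..<N + m}" for x
          using that by (intro image_eqI[of _ _ x]) (auto simp: h_def \<mu>1_def M_def image_iff intro!: bexI[of _ "x - N"])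
        moreover have "x \<in> h ` (S2 \<union> \<mu>1 ` {..<M})" if "x \<in> S" for x
          using that hS by (intro image_eqI[of _ _ x]) (auto simp: S2_def)
        ultimately show "S \<union> {N..<N + m} \<subseteq> h ` (S2 \<union> \<mu>1 ` {..<M})" by blast
      qed
      show "linked r' (h x) (h y)" if "(x, y) \<in> r" for x y
      proof -
        from that consider "(x, y) \<in> R" | "(x, y) \<in> glue \<kappa>T (ins D2)" | "(x, y) \<in> glue \<kappa>a (ins D1)" | "(x, y) \<in> glue \<kappa>b H"
          unfolding r_def by blast
        then show ?thesis
        proof cases
          case 1
          then have "x \<in> S" "y \<in> S" using RS by auto
          then show ?thesis using 1 hS by (auto simp: r'_def intro: linked_base)
        next
          case 2
          then obtain p q where pq: "x = \<kappa>T p" "y = \<kappa>T q" "{p, q} \<in> ins D2" by (auto simp: glue_def)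
          show ?thesis
          proof (cases "{p, q} \<in> D2")
            case True
            then show ?thesis using pq hT tl_diagrams_in[OF D(2) True]
              by (auto simp: r'_def intro!: linked_base glueI)
          next
            case False
            then have "{p, q} = {(False, Suc m), (True, Suc m)}" using pq by (simp add: ins_def)
            then show ?thesis using pq h2[of "Suc m"] hS[OF \<iota>S[OF sm]]
              by (auto simp: doubleton_eq_iff \<kappa>T_def M_def)
          qed
        next
          case 3
          then obtain p q where pq: "x = \<kappa>a p" "y = \<kappa>a q" "{p, q} \<in> ins D1" by (auto simp: glue_def)
          show ?thesis
          proof (cases "{p, q} \<in> D1")
            case True
            then show ?thesis using pq ha tl_diagrams_in[OF D(1) True]
              by (auto simp: r'_def intro!: linked_base glueI)
          next
            case False
            then have "{p, q} = {(False, Suc m), (True, Suc m)}" using pq by (simp add: ins_def)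
            then show ?thesis using pq h1[of "Suc m"] hS[OF \<iota>S[OF sm]]
              by (auto simp: doubleton_eq_iff \<kappa>a_def \<kappa>F_def M_def)
          qed
        next
          case 4
          then obtain p q where pq: "x = \<kappa>b p" "y = \<kappa>b q" "{p, q} \<in> H" by (auto simp: glue_def)
          have "h (\<kappa>b p) = h (\<kappa>b q)"
            using pq(3) h1 h2 unfolding H_def hook_diagram_def tl_id_def
            by (auto simp: doubleton_eq_iff \<kappa>b_def \<kappa>F_def M_def)
          then show ?thesis using pq by simp
        qed
      qed
      show "linked r u v" if "(u, v) \<in> r'" for u v
      proof -
        from that consider "(u, v) \<in> R" | "(u, v) \<in> glue (leg m N \<iota> False) D1" | "(u, v) \<in> glue (leg m N \<iota> True) D2"
          unfolding r'_def by blast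
        then show ?thesis
        proof cases
          case 1
          then show ?thesis by (auto simp: r_def intro: linked_base)
        next
          case 2
          then obtain p q where pq: "u = leg m N \<iota> False p" "v = leg m N \<iota> False q" "{p, q} \<in> D1" by (auto simp: glue_def)
          then have b: "p \<in> box_points (Suc m)" "q \<in> box_points (Suc m)" using tl_diagrams_in[OF D(1)] by auto
          have "linked r (\<kappa>a p) (\<kappa>a q)" using pq(3) by (auto simp: r_def ins_def intro!: linked_base glueI)
          then show ?thesis using X[OF \<kappa>X(2)[OF bb[OF b(1)]]] X[OF \<kappa>X(2)[OF bb[OF b(2)]]] ha b pq linked_sym linked_trans by metis
        next
          case 3
          then obtain p q where pq: "u = leg m N \<iota> True p" "v = leg m N \<iota> True q" "{p, q} \<in> D2" by (auto simp: glue_def)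
          then have b: "p \<in> box_points (Suc m)" "q \<in> box_points (Suc m)" using tl_diagrams_in[OF D(2)] by auto
          have "linked r (\<kappa>T p) (\<kappa>T q)" using pq(3) by (auto simp: r_def ins_def intro!: linked_base glueI)
          then show ?thesis using X[OF \<kappa>X(1)[OF bb[OF b(1)]]] X[OF \<kappa>X(1)[OF bb[OF b(2)]]] hT b pq linked_sym linked_trans by metis
        qed
      qed
    qed (rule X)
    then show "f D1 * f D2 * loop_value ^ Cc (ins D1) (ins D2) = f D1 * f D2 * loop_value ^ comps (S \<union> {N..<N + m})
        (R \<union> glue (leg m N \<iota> False) D1 \<union> glue (leg m N \<iota> True) D2)"
      by (simp add: Cc_def r_def r'_def)
  qed
  finally have second: "skein M (tl_mult M (tl_mult M g (tl_hook m)) g) S R \<iota> = \<dots>" .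
  have jw: "jones_wenzl M = (\<lambda>D. g D - Delta m / Delta (Suc m) * tl_mult M (tl_mult M g (tl_hook m)) g D)"
    by (simp add: M_def g_def f_def Let_def)
  have "skein M (jones_wenzl M) S R \<iota> = skein M g S R \<iota> -
      Delta m / Delta (Suc m) * skein M (tl_mult M (tl_mult M g (tl_hook m)) g) S R \<iota>"
    unfolding skein_def jw sum_distrib_left sum_subtractf[symmetric] by (simp add: left_diff_distrib mult.assoc)
  also have "skein M g S R \<iota> = skein (Suc m) f S (insert (\<iota> (False, Suc m), \<iota> (True, Suc m)) R) \<iota>"
    unfolding M_def g_def by (rule skein_add_strand)
  finally show ?thesis unfolding second by (simp add: M_def f_def)
qed

section \<open>Planarity and face colourings\<close>

text \<open>These are the functions to the field with two elements that are constant on classes.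
  They form a vector space under symmetric difference whose dimension is the number of classes;
  cardinalities stand in for dimensions in what follows.\<close>

definition closed_sets :: "'a set \<Rightarrow> ('a \<times> 'a) set \<Rightarrow> 'a set set" where
  "closed_sets X r = {A. A \<subseteq> X \<and> (\<forall>x y. (x, y) \<in> r \<longrightarrow> (x \<in> A \<longleftrightarrow> y \<in> A))}"

lemma closed_sets_graph:
  "A \<in> closed_sets X {(d, f d) | d. d \<in> X} \<longleftrightarrow> A \<subseteq> X \<and> (\<forall>d\<in>X. d \<in> A \<longleftrightarrow> f d \<in> A)"
  unfolding closed_sets_def by blast

lemma graph_sub: "(\<And>d. d \<in> X \<Longrightarrow> f d \<in> X) \<Longrightarrow> {(d, f d) | d. d \<in> X} \<subseteq> X \<times> X"
  by blast

lemma finite_closed_sets: "finite X \<Longrightarrow> finite (closed_sets X r)"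
  by (rule finite_subset[of _ "Pow X"]) (auto simp: closed_sets_def)

lemma closed_sets_linked: "A \<in> closed_sets X r \<Longrightarrow> linked r x y \<Longrightarrow> x \<in> A \<longleftrightarrow> y \<in> A"
  by (erule linked_invariant) (auto simp: closed_sets_def)

lemma card_closed_sets:
  assumes fin: "finite X" and r: "r \<subseteq> X \<times> X"
  shows "card (closed_sets X r) = 2 ^ comps X r"
proof -
  let ?cl = "\<lambda>x. {y \<in> X. linked r x y}"
  have "bij_betw Union (Pow (conn_classes X r)) (closed_sets X r)"
  proof (rule bij_betwI[where g = "\<lambda>A. {C \<in> conn_classes X r. C \<subseteq> A}"])
    show "Union \<in> Pow (conn_classes X r) \<rightarrow> closed_sets X r"
    proof
      fix \<A> assume "\<A> \<in> Pow (conn_classes X r)"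
      then have \<A>: "\<A> \<subseteq> ?cl ` X" by (simp add: conn_classes_eq)
      have "y \<in> \<Union>\<A>" if xy: "x \<in> \<Union>\<A>" "linked r x y" "y \<in> X" for x y
      proof -
        obtain a where "?cl a \<in> \<A>" "linked r a x" using xy(1) \<A> by auto
        then show ?thesis using linked_trans[of r a x y] xy by blast
      qed
      moreover have "x \<in> X" "y \<in> X" "linked r x y" "linked r y x" if "(x, y) \<in> r" for x y
        using that r linked_base[of x y r] linked_base'[of x y r] by auto
      moreover have "\<Union>\<A> \<subseteq> X" using \<A> by auto
      ultimately show "\<Union>\<A> \<in> closed_sets X r"
        unfolding closed_sets_def by (intro CollectI conjI allI impI) metis+
    qed
    show "(\<lambda>A. {C \<in> conn_classes X r. C \<subseteq> A}) \<in> closed_sets X r \<rightarrow> Pow (conn_classes X r)" by auto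
    show "{C \<in> conn_classes X r. C \<subseteq> \<Union>\<A>} = \<A>" if "\<A> \<in> Pow (conn_classes X r)" for \<A>
    proof -
      have "C \<in> \<A>" if C: "C \<in> conn_classes X r" "C \<subseteq> \<Union>\<A>" for C
      proof -
        obtain a where a: "a \<in> X" "C = ?cl a" using C(1) by (auto simp: conn_classes_eq)
        then have "a \<in> \<Union>\<A>" using C(2) by auto
        then obtain b where b: "b \<in> X" "?cl b \<in> \<A>" "linked r b a"
          using \<open>\<A> \<in> Pow (conn_classes X r)\<close> by (auto simp: conn_classes_eq)
        then show ?thesis using a class_eq_iff[of b X a r] by simp
      qed
      then show ?thesis using that by blast
    qed
    show "\<Union> {C \<in> conn_classes X r. C \<subseteq> A} = A" if A: "A \<in> closed_sets X r" for A
    proof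
      show "A \<subseteq> \<Union> {C \<in> conn_classes X r. C \<subseteq> A}"
      proof
        fix x assume x: "x \<in> A"
        then have xX: "x \<in> X" using A by (auto simp: closed_sets_def)
        have "?cl x \<subseteq> A" using closed_sets_linked[OF A] x by blast
        then show "x \<in> \<Union> {C \<in> conn_classes X r. C \<subseteq> A}"
          using xX by (intro UnionI[of "?cl x"]) (auto simp: conn_classes_eq)
      qed
    qed auto
  qed
  then have "card (Pow (conn_classes X r)) = card (closed_sets X r)" by (rule bij_betw_same_card)
  then show ?thesis using finite_conn_classes[OF fin] by (simp add: card_Pow comps_def)
qed

lemma card_sym_diff_parity:
  assumes "finite A" "finite B"
  shows "even (card (sym_diff A B)) \<longleftrightarrow> (even (card A) \<longleftrightarrow> even (card B))"
proof -
  have "card (sym_diff A B) = card (A - B) + card (B - A)"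
    using assms by (intro card_Un_disjoint) auto
  moreover have "card A = card (A - B) + card (A \<inter> B)"
    using assms by (subst card_Un_disjoint[symmetric]) (auto intro: arg_cong[where f = card])
  moreover have "card B = card (B - A) + card (A \<inter> B)"
    using assms by (subst card_Un_disjoint[symmetric]) (auto intro: arg_cong[where f = card])
  ultimately show ?thesis by (simp, blast)
qed

lemma sym_diff_cancel: "sym_diff (sym_diff A B) B = A"
  by blast

text \<open>Orthogonality of the characters of an elementary abelian 2-group.\<close>

lemma sign_sum:
  assumes fin: "finite G" "\<And>A. A \<in> G \<Longrightarrow> finite A" and cl: "\<And>A B. A \<in> G \<Longrightarrow> B \<in> G \<Longrightarrow> sym_diff A B \<in> G"
  shows "(\<Sum>A\<in>G. (-1 :: int) ^ card (A \<inter> w)) = (if \<forall>A\<in>G. even (card (A \<inter> w)) then int (card G) else 0)"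
proof (cases "\<forall>A\<in>G. even (card (A \<inter> w))")
  case False
  then obtain B where B: "B \<in> G" "odd (card (B \<inter> w))" by blast
  have neg: "(-1 :: int) ^ card (sym_diff A B \<inter> w) = - ((-1) ^ card (A \<inter> w))" if "A \<in> G" for A
  proof -
    have "sym_diff A B \<inter> w = sym_diff (A \<inter> w) (B \<inter> w)" by blast
    then have "even (card (sym_diff A B \<inter> w)) \<longleftrightarrow> odd (card (A \<inter> w))"
      using card_sym_diff_parity[of "A \<inter> w" "B \<inter> w"] fin(2) that B by auto
    then show ?thesis by (simp add: minus_one_power_iff)
  qed
  \<comment> \<open>Translation by \<open>B\<close> permutes the group and flips every sign, so the
    sum equals its own negative.\<close>
  have "(\<Sum>A\<in>G. (-1 :: int) ^ card (A \<inter> w)) = (\<Sum>A\<in>G. (-1) ^ card (sym_diff A B \<inter> w))"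
    using B cl by (intro sum.reindex_bij_witness[where i = "\<lambda>A. sym_diff A B" and j = "\<lambda>A. sym_diff A B"])
      (simp_all only: sym_diff_cancel)
  also have "\<dots> = - (\<Sum>A\<in>G. (-1) ^ card (A \<inter> w))"
    using neg by (simp add: sum_negf)
  finally have "(\<Sum>A\<in>G. (-1 :: int) ^ card (A \<inter> w)) = 0" by simp
  then show ?thesis using False by (simp only: if_False)
qed simp

lemma closed_sets_sym_diff: "A \<in> closed_sets X r \<Longrightarrow> B \<in> closed_sets X r \<Longrightarrow> sym_diff A B \<in> closed_sets X r"
  unfolding closed_sets_def by blast

lemma other_end_simps [simp]: "other_end (other_end d) = d" "other_end d \<noteq> d"
  by (auto simp: other_end_def prod_eq_iff)

lemma other_end_in_darts [simp]: "other_end d \<in> darts N \<longleftrightarrow> d \<in> darts N"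
  by (auto simp: darts_def other_end_def mem_Times_iff)

text \<open>The first homology of a planar graph vanishes: by Euler's formula there are as many
  boundaries of sets of faces as there are cycles modulo 2.\<close>

lemma planar_face_colouring:
  assumes tri: "trivalent N" and pl: "planar N"
    and w: "w \<subseteq> darts N" "\<And>d. d \<in> darts N \<Longrightarrow> d \<in> w \<longleftrightarrow> other_end d \<in> w"
    and even: "\<And>y. y \<subseteq> darts N \<Longrightarrow> (\<And>d. d \<in> darts N \<Longrightarrow> rot N d \<in> y \<longleftrightarrow> d \<in> y) \<Longrightarrow> even (card (w \<inter> y))"
  obtains \<phi> where "\<And>d. d \<in> darts N \<Longrightarrow> rot N (other_end d) \<in> \<phi> \<longleftrightarrow> d \<in> \<phi>"
    and "\<And>d. d \<in> darts N \<Longrightarrow> rot N d \<in> \<phi> \<longleftrightarrow> (d \<in> \<phi> \<longleftrightarrow> d \<notin> w)"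
proof -
  define X where "X = darts N"
  define \<rho> where "\<rho> = rot N"
  define rv where "rv = {(d, \<rho> d) | d. d \<in> X}"
  define re where "re = {(d, other_end d) | d. d \<in> X}"
  define rf where "rf = {(d, \<rho> (other_end d)) | d. d \<in> X}"
  have fX: "finite X" using tri by (simp add: X_def darts_def trivalent_def)
  have \<rho>X: "\<rho> d \<in> X" if "d \<in> X" for d using tri that by (auto simp: \<rho>_def X_def trivalent_def)
  have \<rho>3: "\<rho> (\<rho> (\<rho> d)) = d" if "d \<in> X" for d using tri that by (auto simp: \<rho>_def X_def trivalent_def)
  have oX: "other_end d \<in> X \<longleftrightarrow> d \<in> X" for d by (simp add: X_def)
  have sub: "rv \<subseteq> X \<times> X" "re \<subseteq> X \<times> X" "rf \<subseteq> X \<times> X" "rv \<union> re \<subseteq> X \<times> X"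
    using \<rho>X oX graph_sub[of X \<rho>] graph_sub[of X other_end] graph_sub[of X "\<lambda>d. \<rho> (other_end d)"]
    unfolding rv_def re_def rf_def by blast+
  have cv: "A \<in> closed_sets X rv \<longleftrightarrow> A \<subseteq> X \<and> (\<forall>d\<in>X. d \<in> A \<longleftrightarrow> \<rho> d \<in> A)" for A
    unfolding rv_def by (rule closed_sets_graph)
  have ce: "A \<in> closed_sets X re \<longleftrightarrow> A \<subseteq> X \<and> (\<forall>d\<in>X. d \<in> A \<longleftrightarrow> other_end d \<in> A)" for A
    unfolding re_def by (rule closed_sets_graph)
  have cf: "A \<in> closed_sets X rf \<longleftrightarrow> A \<subseteq> X \<and> (\<forall>d\<in>X. d \<in> A \<longleftrightarrow> \<rho> (other_end d) \<in> A)" for A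
    unfolding rf_def by (rule closed_sets_graph)
  have cc: "A \<in> closed_sets X (rv \<union> re) \<longleftrightarrow> A \<in> closed_sets X rv \<and> A \<in> closed_sets X re" for A
    by (auto simp: closed_sets_def)
  \<comment> \<open>The cycle space modulo 2: sets of edges, seen as dart sets closed under
    \<open>other_end\<close>, that meet every vertex evenly.\<close>
  define Z where "Z = {z \<in> closed_sets X re. \<forall>y\<in>closed_sets X rv. even (card (y \<inter> z))}"
  \<comment> \<open>The boundary of a set of faces: \<open>\<rho> d\<close> lies on the same face as
    \<open>other_end d\<close>, so the condition compares the two sides of the edge of
    \<open>d\<close>.\<close>
  define \<psi> where "\<psi> \<phi> = {d \<in> X. (d \<in> \<phi>) \<noteq> (\<rho> d \<in> \<phi>)}" for \<phi>
  have finc: "finite (closed_sets X r)" "A \<in> closed_sets X r \<Longrightarrow> finite A" for r A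
    using finite_closed_sets[OF fX] fX by (auto simp: closed_sets_def intro: finite_subset)
  have card_e: "card (closed_sets X re) = 2 ^ card (edges N)"
  proof -
    have "closed_sets X re = (\<lambda>E'. E' \<times> UNIV) ` Pow (edges N)"
    proof
      show "closed_sets X re \<subseteq> (\<lambda>E'. E' \<times> UNIV) ` Pow (edges N)"
      proof
        fix A assume A: "A \<in> closed_sets X re"
        have "(e, b) \<in> A" if "(e, b') \<in> A" for e b b'
        proof -
          have "(e, b') \<in> X" using A that by (auto simp: ce)
          then have "(e, \<not> b') \<in> A" using A that by (auto simp: ce other_end_def)
          then show ?thesis using that by (cases "b = b'") auto
        qed
        then have "A = fst ` A \<times> UNIV" by force
        moreover have "A \<subseteq> X" using A by (simp add: ce)
        then have "fst ` A \<subseteq> edges N" unfolding X_def darts_def by auto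
        ultimately show "A \<in> (\<lambda>E'. E' \<times> UNIV) ` Pow (edges N)" by blast
      qed
      show "(\<lambda>E'. E' \<times> UNIV) ` Pow (edges N) \<subseteq> closed_sets X re"
      proof
        fix A assume "A \<in> (\<lambda>E'. E' \<times> (UNIV :: bool set)) ` Pow (edges N)"
        then obtain E' where E': "E' \<subseteq> edges N" "A = E' \<times> UNIV" by blast
        then have "A \<subseteq> X" by (auto simp: X_def darts_def)
        moreover have "d \<in> A \<longleftrightarrow> other_end d \<in> A" for d unfolding E' by (cases d) (simp add: other_end_def)
        ultimately show "A \<in> closed_sets X re" unfolding ce by blast
      qed
    qed
    moreover have "inj_on (\<lambda>E'. E' \<times> (UNIV :: bool set)) (Pow (edges N))"
      by (auto simp: inj_on_def)
    moreover have "finite (edges N)" using tri by (simp add: trivalent_def)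
    ultimately show ?thesis by (simp add: card_image card_Pow)
  qed
  have card_v: "card (closed_sets X rv) = 2 ^ card (vertices N)"
    and card_f: "card (closed_sets X rf) = 2 ^ card (faces N)"
    and card_c: "card (closed_sets X (rv \<union> re)) = 2 ^ card (components N)"
    using card_closed_sets[OF fX sub(1)] card_closed_sets[OF fX sub(3)] card_closed_sets[OF fX sub(4)]
    by (simp_all add: comps_def vertices_def faces_def components_def rv_def re_def rf_def X_def \<rho>_def)
  \<comment> \<open>The signs (-1)^card (y \<inter> z) are summed over unions y of vertices and edge
    sets z. One order of summation counts cycles, the other counts the unions of vertices orthogonal
    to every edge, which are unions of components. In dimensions this reads dim Z \<le> E - V +
    C.\<close>
  have le1: "card (closed_sets X rv) * card Z \<le> card (closed_sets X re) * card (closed_sets X (rv \<union> re))"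
  proof -
    let ?s = "\<lambda>z y. (-1 :: int) ^ card (z \<inter> y)"
    let ?O = "{y \<in> closed_sets X rv. \<forall>z\<in>closed_sets X re. even (card (z \<inter> y))}"
    have "int (card (closed_sets X rv)) * int (card Z) =
        (\<Sum>z\<in>closed_sets X re. if \<forall>y\<in>closed_sets X rv. even (card (y \<inter> z)) then int (card (closed_sets X rv)) else 0)"
      unfolding Z_def using finc(1) by (simp add: sum.inter_filter[symmetric])
    also have "\<dots> = (\<Sum>z\<in>closed_sets X re. \<Sum>y\<in>closed_sets X rv. ?s y z)"
      by (intro sum.cong refl sign_sum[symmetric] finc closed_sets_sym_diff)
    also have "\<dots> = (\<Sum>y\<in>closed_sets X rv. \<Sum>z\<in>closed_sets X re. ?s z y)"
      by (subst sum.swap) (simp add: Int_commute)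
    also have "\<dots> = (\<Sum>y\<in>closed_sets X rv. if \<forall>z\<in>closed_sets X re. even (card (z \<inter> y)) then int (card (closed_sets X re)) else 0)"
      by (intro sum.cong refl sign_sum finc closed_sets_sym_diff)
    also have "\<dots> = int (card (closed_sets X re)) * int (card ?O)"
      using finc(1) by (simp add: sum.inter_filter[symmetric])
    finally have "card (closed_sets X rv) * card Z = card (closed_sets X re) * card ?O"
      by (simp only: of_nat_mult[symmetric] of_nat_eq_iff)
    moreover have "?O \<subseteq> closed_sets X (rv \<union> re)"
    proof
      fix y assume y: "y \<in> ?O"
      have "d \<in> y \<longleftrightarrow> other_end d \<in> y" if d: "d \<in> X" for d
      proof -
        have "x = d" if "other_end x = other_end d" for x using that other_end_simps(1) by metis
        then have "{d, other_end d} \<in> closed_sets X re" using d oX unfolding ce by auto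
        then have "even (card ({d, other_end d} \<inter> y))" using y by blast
        then show ?thesis using other_end_simps(2)[of d] by (cases "d \<in> y"; cases "other_end d \<in> y") auto
      qed
      then show "y \<in> closed_sets X (rv \<union> re)" using y unfolding cc by (auto simp: ce cv)
    qed
    then have "card ?O \<le> card (closed_sets X (rv \<union> re))" using finc(1) by (intro card_mono)
    ultimately show ?thesis by simp
  qed
  \<comment> \<open>Two face sets with the same boundary differ by a union of components, so each
    fibre of \<open>\<psi>\<close> has at most 2^C elements and the space of boundaries has
    dimension at least F - C.\<close>
  have le2: "card (closed_sets X rf) \<le> card (\<psi> ` closed_sets X rf) * card (closed_sets X (rv \<union> re))"
  proof -
    let ?fib = "\<lambda>b. {\<phi> \<in> closed_sets X rf. \<psi> \<phi> = b}"
    have "card (?fib b) \<le> card (closed_sets X (rv \<union> re))" if b: "b \<in> \<psi> ` closed_sets X rf" for b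
    proof -
      obtain \<phi>0 where \<phi>0: "\<phi>0 \<in> closed_sets X rf" "\<psi> \<phi>0 = b" using b by auto
      have "sym_diff \<phi> \<phi>0 \<in> closed_sets X (rv \<union> re)" if \<phi>: "\<phi> \<in> ?fib b" for \<phi>
      proof -
        have s: "sym_diff \<phi> \<phi>0 \<in> closed_sets X rf" using \<phi> \<phi>0 by (intro closed_sets_sym_diff) auto
        have "\<psi> \<phi> = \<psi> \<phi>0" using \<phi> \<phi>0 by simp
        then have "(d \<in> \<phi>) \<noteq> (\<rho> d \<in> \<phi>) \<longleftrightarrow> (d \<in> \<phi>0) \<noteq> (\<rho> d \<in> \<phi>0)" if "d \<in> X" for d
          using that unfolding \<psi>_def by blast
        then have v: "d \<in> sym_diff \<phi> \<phi>0 \<longleftrightarrow> \<rho> d \<in> sym_diff \<phi> \<phi>0" if "d \<in> X" for d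
          using that by blast
        have "d \<in> sym_diff \<phi> \<phi>0 \<longleftrightarrow> other_end d \<in> sym_diff \<phi> \<phi>0" if d: "d \<in> X" for d
          using s v[of "other_end d"] d oX unfolding cf by blast
        moreover have "sym_diff \<phi> \<phi>0 \<subseteq> X" using s unfolding cf by (rule conjunct1)
        ultimately show ?thesis using v unfolding cc cv ce by simp
      qed
      moreover have "inj_on (\<lambda>\<phi>. sym_diff \<phi> \<phi>0) (?fib b)"
        by (rule inj_on_inverseI[where g = "\<lambda>\<phi>. sym_diff \<phi> \<phi>0"]) (rule sym_diff_cancel)
      ultimately show ?thesis using finc(1) by (intro card_inj_on_le) auto
    qed
    then have "(\<Sum>b\<in>\<psi> ` closed_sets X rf. card (?fib b)) \<le> card (\<psi> ` closed_sets X rf) * card (closed_sets X (rv \<union> re))"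
      using sum_bounded_above[of "\<psi> ` closed_sets X rf" "\<lambda>b. card (?fib b)"] by simp
    moreover have "card (\<Union>b\<in>\<psi> ` closed_sets X rf. ?fib b) \<le> (\<Sum>b\<in>\<psi> ` closed_sets X rf. card (?fib b))"
      using finc(1) by (intro card_UN_le) auto
    moreover have "(\<Union>b\<in>\<psi> ` closed_sets X rf. ?fib b) = closed_sets X rf" by auto
    ultimately show ?thesis by simp
  qed
  \<comment> \<open>Boundaries are cycles: on a union of vertices, the boundary is the symmetric
    difference of a set and its preimage under the rotation, and these have the same size.\<close>
  have \<psi>Z: "\<psi> \<phi> \<in> Z" if \<phi>: "\<phi> \<in> closed_sets X rf" for \<phi>
  proof -
    have "d \<in> \<psi> \<phi> \<longleftrightarrow> other_end d \<in> \<psi> \<phi>" if d: "d \<in> X" for d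
    proof -
      have "d \<in> \<phi> \<longleftrightarrow> \<rho> (other_end d) \<in> \<phi>" using \<phi> d by (auto simp: cf)
      moreover have "other_end d \<in> \<phi> \<longleftrightarrow> \<rho> d \<in> \<phi>" using \<phi> d oX[of d] unfolding cf by (metis other_end_simps(1))
      ultimately show ?thesis using d oX[of d] by (auto simp: \<psi>_def)
    qed
    moreover have "even (card (y \<inter> \<psi> \<phi>))" if y: "y \<in> closed_sets X rv" for y
    proof -
      have \<phi>X: "\<phi> \<subseteq> X" "y \<subseteq> X" using \<phi> y by (auto simp: cf cv)
      have eq: "y \<inter> \<psi> \<phi> = sym_diff (y \<inter> \<phi>) {d \<in> X. \<rho> d \<in> y \<inter> \<phi>}"
        using y \<phi>X unfolding cv \<psi>_def by blast
      have "bij_betw \<rho> {d \<in> X. \<rho> d \<in> y \<inter> \<phi>} (y \<inter> \<phi>)"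
      proof (rule bij_betwI[where g = "\<lambda>d. \<rho> (\<rho> d)"])
        show "(\<lambda>d. \<rho> (\<rho> d)) \<in> y \<inter> \<phi> \<rightarrow> {d \<in> X. \<rho> d \<in> y \<inter> \<phi>}"
        proof
          fix d assume d: "d \<in> y \<inter> \<phi>"
          then have "d \<in> X" using \<phi>X by blast
          then show "\<rho> (\<rho> d) \<in> {d \<in> X. \<rho> d \<in> y \<inter> \<phi>}" using d \<rho>X \<rho>3 by simp
        qed
        show "\<rho> (\<rho> (\<rho> d)) = d" if "d \<in> y \<inter> \<phi>" for d using that \<phi>X \<rho>3 by blast
      qed (use \<rho>3 in simp_all)
      then have "card {d \<in> X. \<rho> d \<in> y \<inter> \<phi>} = card (y \<inter> \<phi>)" by (rule bij_betw_same_card)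
      moreover have "finite (y \<inter> \<phi>)" using fX \<phi>X by (auto intro: finite_subset)
      ultimately show ?thesis unfolding eq using fX by (subst card_sym_diff_parity) auto
    qed
    moreover have "\<psi> \<phi> \<subseteq> X" by (auto simp: \<psi>_def)
    ultimately show ?thesis unfolding Z_def ce by blast
  qed
  \<comment> \<open>Euler's formula makes the lower bound F - C for boundaries coincide with the
    upper bound E - V + C for cycles.\<close>
  have "card Z \<le> card (\<psi> ` closed_sets X rf)"
  proof -
    let ?V = "card (vertices N)" and ?E = "card (edges N)" and ?F = "card (faces N)" and ?C = "card (components N)"
    let ?z = "card Z" and ?i = "card (\<psi> ` closed_sets X rf)"
    have e: "?V + ?F = ?E + 2 * ?C" using pl by (simp add: planar_def)
    have "2 ^ (?V + ?F) * ?z = 2 ^ ?F * (2 ^ ?V * ?z)" by (simp add: power_add)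
    also have "\<dots> \<le> (?i * 2 ^ ?C) * (2 ^ ?E * 2 ^ ?C)"
      using le1 le2 unfolding card_v card_e card_c card_f by (rule mult_le_mono[rotated])
    also have "\<dots> = 2 ^ (?V + ?F) * ?i" unfolding e by (simp add: power_add mult_2 power2_eq_square)
    finally show ?thesis by simp
  qed
  moreover have "\<psi> ` closed_sets X rf \<subseteq> Z" using \<psi>Z by auto
  moreover have "finite Z" using finc(1) by (simp add: Z_def)
  ultimately have im: "\<psi> ` closed_sets X rf = Z" by (intro card_seteq)
  have "w \<in> Z"
    unfolding Z_def
  proof (intro CollectI conjI ballI)
    show "w \<in> closed_sets X re" 
      unfolding ce unfolding X_def by (intro conjI ballI w)
    fix y assume "y \<in> closed_sets X rv"
    then have "even (card (w \<inter> y))" unfolding cv by (intro even) (auto simp: X_def \<rho>_def)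
    then show "even (card (y \<inter> w))" by (simp add: Int_commute)
  qed
  then obtain \<phi> where \<phi>: "\<phi> \<in> closed_sets X rf" "w = \<psi> \<phi>" using im by blast
  show ?thesis
  proof (rule that)
    fix d assume d: "d \<in> darts N"
    then show "rot N (other_end d) \<in> \<phi> \<longleftrightarrow> d \<in> \<phi>" using \<phi>(1) unfolding cf by (simp add: X_def \<rho>_def)
    show "rot N d \<in> \<phi> \<longleftrightarrow> (d \<in> \<phi> \<longleftrightarrow> d \<notin> w)" using \<phi>(2) d by (auto simp: \<psi>_def X_def \<rho>_def)
  qed
qed

section \<open>Jones--Wenzl idempotents kill caps\<close>

text \<open>If the outside class of \<open>z\<close> does not touch the box, membership in it cannot
  change along any strand of the inserted diagram.\<close>

lemma linked_glue_avoid: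
  assumes D: "D \<in> tl_diagrams n" and avoid: "\<forall>p\<in>box_points n. \<not> linked R (\<kappa> p) z"
    and l: "linked (R \<union> glue \<kappa> D) x y"
  shows "linked R x z \<longleftrightarrow> linked R y z"
  using l
proof (rule linked_invariant)
  fix a b assume "(a, b) \<in> R \<union> glue \<kappa> D"
  then show "linked R a z = linked R b z"
  proof
    assume "(a, b) \<in> R"
    then show ?thesis using linked_base[of a b R] linked_base'[of a b R] linked_trans[of R a b z] linked_trans[of R b a z] by blast
  next
    assume "(a, b) \<in> glue \<kappa> D"
    then obtain p q where "a = \<kappa> p" "b = \<kappa> q" "{p, q} \<in> D" by (auto simp: glue_def)
    then show ?thesis using avoid tl_diagrams_in[OF D] by blast
  qed
qed

text \<open>When the outside classes of both ends of the cap touch the box nowhere else, the cap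
  joins them into a component that no other strand of \<open>D\<close> enlarges. Thus a cap in one
  box presents an isolated cap to a neighbouring box.\<close>

lemma linked_glue_cap:
  assumes D: "D \<in> tl_diagrams n" and ab: "{a, b} \<in> D"
    and sep: "\<And>p. p \<in> box_points n \<Longrightarrow> linked R (\<kappa> p) (\<kappa> a) \<or> linked R (\<kappa> p) (\<kappa> b) \<Longrightarrow> p = a \<or> p = b"
    and l: "linked (R \<union> glue \<kappa> D) x (\<kappa> a)"
  shows "linked R x (\<kappa> a) \<or> linked R x (\<kappa> b)"
proof -
  let ?U = "\<lambda>x. linked R x (\<kappa> a) \<or> linked R x (\<kappa> b)"
  have U: "?U (\<kappa> q)" if "{p, q} \<in> D" "?U (\<kappa> p)" for p q
  proof -
    have "p = a \<or> p = b" using sep[of p] tl_diagrams_in[OF D that(1)] that(2) by blast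
    moreover have "{b, a} \<in> D" using ab by (simp add: insert_commute)
    ultimately have "q = b \<or> q = a"
      using perfect_matching_onD(4)[OF tl_diagramsD(1)[OF D]] that(1) ab by blast
    then show ?thesis by auto
  qed
  have "?U x = ?U (\<kappa> a)"
    using l
  proof (rule linked_invariant)
    fix u v assume "(u, v) \<in> R \<union> glue \<kappa> D"
    then show "?U u = ?U v"
    proof
      assume "(u, v) \<in> R"
      then have "linked R u v" "linked R v u" by (auto intro: linked_base linked_base')
      then have "linked R u w = linked R v w" for w
        using linked_trans[of R u v w] linked_trans[of R v u w] by blast
      then show ?thesis by simp
    next
      assume "(u, v) \<in> glue \<kappa> D"
      then obtain p q where pq: "u = \<kappa> p" "v = \<kappa> q" "{p, q} \<in> D" by (auto simp: glue_def)
      then have "{q, p} \<in> D" by (simp add: insert_commute)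
      then show ?thesis using U[of p q] U[of q p] pq by blast
    qed
  qed
  then show ?thesis by simp
qed

lemma skein_cong_linked: "linked R = linked R' \<Longrightarrow> skein n f S R \<iota> = skein n f S R' \<iota>"
  unfolding skein_def by (intro sum.cong refl) (metis comps_cong_linked linked_Un_cong)

text \<open>A point set of type \<^typ>\<open>nat\<close> leaves room for the extra points in Wenzl's recursion.\<close>

definition kills_caps :: "nat \<Rightarrow> tl_elem \<Rightarrow> bool" where
  "kills_caps n f \<longleftrightarrow> (\<forall>(S :: nat set) R \<iota> t i. finite S \<longrightarrow> R \<subseteq> S \<times> S \<longrightarrow> \<iota> ` box_points n \<subseteq> S \<longrightarrow>
     Suc i < n \<longrightarrow> linked R (\<iota> (t, i)) (\<iota> (t, Suc i)) \<longrightarrow>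
     (\<forall>p\<in>box_points n. linked R (\<iota> p) (\<iota> (t, i)) \<longrightarrow> p = (t, i) \<or> p = (t, Suc i)) \<longrightarrow>
     skein n f S R \<iota> = 0)"

lemma kills_capsD:
  fixes S :: "nat set"
  assumes "kills_caps n f" "finite S" "R \<subseteq> S \<times> S" "\<iota> ` box_points n \<subseteq> S"
     "Suc i < n" "linked R (\<iota> (t, i)) (\<iota> (t, Suc i))"
     "\<And>p. p \<in> box_points n \<Longrightarrow> linked R (\<iota> p) (\<iota> (t, i)) \<Longrightarrow> p = (t, i) \<or> p = (t, Suc i)"
  shows "skein n f S R \<iota> = 0"
  using assms(1)[unfolded kills_caps_def, rule_format, OF assms(2-6)] assms(7) by blast

text \<open>The partial trace of f^(n+1) is Delta (n+1) / Delta n times f^(n), read in a context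
  where the ends of the last strand are joined outside. On the right-hand side this closing arc is a
  component of its own and counts as an additional circle, which the factor
  \<open>loop_value\<close> on the left balances.\<close>

definition traces :: "nat \<Rightarrow> bool" where
  "traces n \<longleftrightarrow> (\<forall>(S :: nat set) R \<iota>. finite S \<longrightarrow> R \<subseteq> S \<times> S \<longrightarrow> \<iota> ` box_points (Suc n) \<subseteq> S \<longrightarrow>
     linked R (\<iota> (False, n)) (\<iota> (True, n)) \<longrightarrow>
     (\<forall>p\<in>box_points n. \<not> linked R (\<iota> p) (\<iota> (False, n))) \<longrightarrow>
     loop_value * skein (Suc n) (jones_wenzl (Suc n)) S R \<iota> =
       Delta (Suc n) / Delta n * skein n (jones_wenzl n) S R \<iota>)"

lemma tracesD:
  fixes S :: "nat set"
  assumes "traces n" "finite S" "R \<subseteq> S \<times> S" "\<iota> ` box_points (Suc n) \<subseteq> S"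
     "linked R (\<iota> (False, n)) (\<iota> (True, n))"
     "\<And>p. p \<in> box_points n \<Longrightarrow> \<not> linked R (\<iota> p) (\<iota> (False, n))"
  shows "loop_value * skein (Suc n) (jones_wenzl (Suc n)) S R \<iota> =
       Delta (Suc n) / Delta n * skein n (jones_wenzl n) S R \<iota>"
  using assms(1)[unfolded traces_def] assms(2-6) by simp

lemma sum_only_id:
  assumes "\<And>D. D \<in> tl_diagrams n \<Longrightarrow> D \<noteq> tl_id n \<Longrightarrow> G D = 0"
  shows "(\<Sum>D\<in>tl_diagrams n. jones_wenzl n D * G D) = G (tl_id n)"
proof -
  have "(\<Sum>D\<in>tl_diagrams n. jones_wenzl n D * G D) = (\<Sum>D\<in>{tl_id n}. jones_wenzl n D * G D)"
    by (rule sum.mono_neutral_right) (use assms tl_id_in in auto)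
  then show ?thesis by (simp add: jones_wenzl_id)
qed

section \<open>One step of Wenzl's recursion in a fixed context\<close>

locale wenzl_context =
  fixes S :: "nat set" and N m :: nat and R :: "(nat \<times> nat) set" and \<iota> :: "bool \<times> nat \<Rightarrow> nat"
  assumes SN: "S \<subseteq> {..<N}" and RS: "R \<subseteq> S \<times> S" and \<iota>S': "\<iota> ` box_points (Suc (Suc m)) \<subseteq> S"
begin

text \<open>The added points form the middle row between the two copies of \<open>f\<close>. They
  are fresh because \<open>N\<close> bounds \<open>S\<close>.\<close>

definition T where "T = S \<union> {N..<N + m}"

abbreviation "L \<equiv> leg m N \<iota>"
abbreviation "f \<equiv> jones_wenzl (Suc m)"

lemma fS: "finite S" and fT: "finite T"
  using SN finite_subset by (auto simp: T_def)

lemma \<iota>S: "i < Suc (Suc m) \<Longrightarrow> \<iota> (t, i) \<in> S"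
  using \<iota>S' by auto

lemma ST: "S \<subseteq> T" and RT: "R \<subseteq> T \<times> T"
  using RS by (auto simp: T_def)

lemma L_same [simp]: "L t (t, i) = \<iota> (t, i)"
  and L_mid [simp]: "i < m \<Longrightarrow> L t (\<not> t, i) = N + i" "i < m \<Longrightarrow> L (\<not> t) (t, i) = N + i"
  and L_last [simp]: "L t (\<not> t, m) = \<iota> (t, Suc m)" "L (\<not> t) (t, m) = \<iota> (\<not> t, Suc m)"
  by (simp_all add: leg_def)

lemma L_T: "p \<in> box_points (Suc m) \<Longrightarrow> L t p \<in> T"
  using \<iota>S by (cases p) (auto simp: leg_def T_def)

lemma L_T': "L t ` box_points (Suc m) \<subseteq> T"
  using L_T by blast

lemma glue_T: "D \<in> tl_diagrams (Suc m) \<Longrightarrow> R \<union> glue (L t) D \<subseteq> T \<times> T"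
  using RT glue_sub[OF _ L_T'] by simp

lemma linked_mid: "N \<le> x \<Longrightarrow> linked R x y \<longleftrightarrow> x = y" "N \<le> x \<Longrightarrow> linked R y x \<longleftrightarrow> x = y"
proof -
  assume x: "N \<le> x"
  have "x \<notin> Field R" using RS SN x by (fastforce simp: Field_def)
  then show "linked R x y \<longleftrightarrow> x = y" "linked R y x \<longleftrightarrow> x = y"
    using linked_isolated[of R x y] linked_sym[of R y x] by auto
qed

lemma \<iota>_lt: "i < Suc (Suc m) \<Longrightarrow> \<iota> (t, i) < N"
  using \<iota>S SN by blast

lemma leg_cases:
  assumes "p \<in> box_points (Suc m)"
  obtains (same) i where "p = (t, i)" "i \<le> m" "L t p = \<iota> (t, i)"
    | (mid) i where "p = (\<not> t, i)" "i < m" "L t p = N + i"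
    | (last) "p = (\<not> t, m)" "L t p = \<iota> (t, Suc m)"
proof -
  obtain u i where p: "p = (u, i)" "i < Suc m" using assms by (cases p) auto
  then have "i < m \<or> i = m" by linarith
  then consider "u = t" | "u = (\<not> t)" "i < m" | "u = (\<not> t)" "i = m" by blast
  then show ?thesis using that p by cases (auto simp: leg_def)
qed

text \<open>The correction term of the recursion after shrinking: the lower copy of \<open>f\<close>
  sits on leg \<open>False\<close>, the upper one on leg \<open>True\<close>.\<close>

definition double :: ratfun where
  "double = (\<Sum>D1\<in>tl_diagrams (Suc m). \<Sum>D2\<in>tl_diagrams (Suc m). f D1 * f D2 *
     loop_value ^ comps T (R \<union> glue (L False) D1 \<union> glue (L True) D2))"

text \<open>Either copy of \<open>f\<close> may be expanded first; the remaining copy, on leg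
  \<open>t\<close>, then sees a context that contains the chosen diagram of the other. The side is
  picked according to where the cap is.\<close>

lemma double_eq: "double = (\<Sum>D\<in>tl_diagrams (Suc m). f D * skein (Suc m) f T (R \<union> glue (L (\<not> t)) D) (L t))"
proof (cases t)
  case True
  then show ?thesis unfolding double_def skein_def sum_distrib_left by (simp add: mult.assoc)
next
  case False
  have "double = (\<Sum>D2\<in>tl_diagrams (Suc m). \<Sum>D1\<in>tl_diagrams (Suc m). f D1 * f D2 *
     loop_value ^ comps T (R \<union> glue (L False) D1 \<union> glue (L True) D2))"
    unfolding double_def by (rule sum.swap)
  also have "\<dots> = (\<Sum>D2\<in>tl_diagrams (Suc m). f D2 * skein (Suc m) f T (R \<union> glue (L True) D2) (L False))"
    unfolding skein_def sum_distrib_left by (intro sum.cong refl) (simp add: Un_ac mult_ac)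
  finally show ?thesis using False by simp
qed

lemma recursion:
  "skein (Suc (Suc m)) (jones_wenzl (Suc (Suc m))) S R \<iota> =
    skein (Suc m) f S (insert (\<iota> (False, Suc m), \<iota> (True, Suc m)) R) \<iota> - Delta m / Delta (Suc m) * double"
  unfolding double_def T_def by (rule skein_Wenzl[OF SN RS \<iota>S'])

text \<open>With the last strand closed, the correction term becomes two copies of \<open>f\<close>
  joined along all their strands. Each diagram of the lower copy except the identity presents a cap
  to the upper copy and is killed, so one copy of \<open>f\<close> remains. The closing arc has
  become part of a strand, which costs one component. The coefficients combine to
  \<open>loop_value\<close> - Delta m / Delta (m+1) = Delta (m+2) / Delta (m+1).\<close>

lemma trace_step:
  assumes K: "kills_caps (Suc m) f"
    and l: "linked R (\<iota> (False, Suc m)) (\<iota> (True, Suc m))"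
    and iso: "\<And>p. p \<in> box_points (Suc m) \<Longrightarrow> \<not> linked R (\<iota> p) (\<iota> (False, Suc m))"
  shows "loop_value * skein (Suc (Suc m)) (jones_wenzl (Suc (Suc m))) S R \<iota> =
    Delta (Suc (Suc m)) / Delta (Suc m) * skein (Suc m) f S R \<iota>"
proof -
  have iso': "\<not> linked R (\<iota> p) (\<iota> (u, Suc m))" "\<not> linked R (\<iota> (u, Suc m)) (\<iota> p)"
    if "p \<in> box_points (Suc m)" for p u
  proof -
    have "linked R (\<iota> (u, Suc m)) (\<iota> (False, Suc m))" using linked_sym[OF l] by (cases u) auto
    then show "\<not> linked R (\<iota> p) (\<iota> (u, Suc m))" "\<not> linked R (\<iota> (u, Suc m)) (\<iota> p)"
      using iso[OF that] linked_trans[of R "\<iota> p"] linked_sym[of R _ "\<iota> p"] by blast+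
  qed
  have iso_ball: "\<forall>p\<in>box_points (Suc m). \<not> linked R (\<iota> p) (\<iota> (False, Suc m))" using iso by blast
  have zero: "skein (Suc m) f T (R \<union> glue (L False) D) (L True) = 0"
    if D: "D \<in> tl_diagrams (Suc m)" "D \<noteq> tl_id (Suc m)" for D
  proof -
    obtain i where i: "Suc i < Suc m" "{(True, i), (True, Suc i)} \<in> D" using tl_cap[OF D] by blast
    have join: "linked R (L True (False, j)) (L False (True, j))" if "j \<le> m" for j
    proof (cases "j < m")
      case False
      then have "j = m" using that by simp
      then show ?thesis using l by (simp add: leg_def linked_sym)
    qed (simp add: leg_def)
    have sep: "p = (\<not> t, j)" if "p \<in> box_points (Suc m)" "linked R (L t p) (L False (True, j))" "j \<le> m" for p j t
      using that(1)
    proof (cases rule: leg_cases[where t = t])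
      case (same k)
      have "k < Suc m" using same by simp
      then show ?thesis
        using that same iso'[of "(t, k)" False] linked_mid(2)[of "N + j" "\<iota> (t, k)"] \<iota>_lt[of k t]
        by (cases "j < m") (auto simp: leg_def)
    next
      case (mid k)
      then show ?thesis using that linked_mid(1)[of "N + k"] \<iota>_lt[of "Suc m" False]
        by (cases "j < m") (auto simp: leg_def)
    next
      case last
      then show ?thesis using that linked_mid(2)[of "N + j"] \<iota>_lt[of "Suc m" t]
        by (cases "j < m") (auto simp: leg_def)
    qed
    show ?thesis
    proof (rule kills_capsD[OF K fT glue_T[OF D(1)] L_T' i(1), where t = False])
      let ?r = "R \<union> glue (L False) D"
      have mono: "linked R x y \<Longrightarrow> linked ?r x y" for x y by (rule linked_mono) auto
      have "linked ?r (L True (False, i)) (L False (True, i))" "linked ?r (L True (False, Suc i)) (L False (True, Suc i))"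
        using join[of i] join[of "Suc i"] i(1) mono by auto
      moreover have "linked ?r (L False (True, i)) (L False (True, Suc i))"
        using i(2) by (intro linked_base) (auto intro: glueI)
      ultimately show "linked ?r (L True (False, i)) (L True (False, Suc i))"
        by (rule linked_link)
      fix p assume p: "p \<in> box_points (Suc m)" "linked ?r (L True p) (L True (False, i))"
      have "linked ?r (L True p) (L False (True, i))"
        using linked_trans[OF p(2) mono[OF join[of i]]] i(1) by simp
      then have "linked R (L True p) (L False (True, i)) \<or> linked R (L True p) (L False (True, Suc i))"
        by (rule linked_glue_cap[OF D(1) i(2), rotated]) (use sep[where t = False] i(1) in fastforce)
      then show "p = (False, i) \<or> p = (False, Suc i)"
        using sep[OF p(1), of True] i(1) by auto
    qed
  qed
  have "double = skein (Suc m) f T (R \<union> glue (L False) (tl_id (Suc m))) (L True)"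
    using double_eq[of True] sum_only_id[of "Suc m", OF zero] by simp
  moreover have "loop_value * skein (Suc m) f T (R \<union> glue (L False) (tl_id (Suc m))) (L True) = skein (Suc m) f S R \<iota>"
    unfolding skein_def sum_distrib_left
  proof (intro sum.cong refl)
    fix D assume D: "D \<in> tl_diagrams (Suc m)"
    let ?r = "R \<union> glue (L False) (tl_id (Suc m)) \<union> glue (L True) D"
    \<comment> \<open>The identity in the lower copy joins the last lower end of \<open>f\<close> to
      the closing arc; after shrinking, this is the only new connection on \<open>S\<close>.\<close>
    let ?e = "(\<iota> (False, m), \<iota> (False, Suc m))"
    let ?r' = "insert ?e (R \<union> glue \<iota> D)"
    define h where "h x = (if x < N then x else \<iota> (False, x - N))" for x
    have hS: "h x = x" if "x \<in> S" for x using that SN by (auto simp: h_def)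
    have h\<iota>: "h (\<iota> (t, i)) = \<iota> (t, i)" if "i < Suc (Suc m)" for t i using \<iota>_lt[OF that] by (simp add: h_def)
    have mono: "linked R x y \<Longrightarrow> linked ?r x y" "linked R x y \<Longrightarrow> linked ?r' x y" for x y
      by (auto intro: linked_mono)
    have new: "linked ?r' (\<iota> (False, m)) (\<iota> (False, Suc m))" by (rule linked_base) simp
    have hT: "linked ?r' (h (L True p)) (\<iota> p)" if "p \<in> box_points (Suc m)" for p
      using that
    proof (cases rule: leg_cases[where t = True])
      case (same i)
      then show ?thesis using h\<iota>[of i True] by simp
    next
      case (mid i)
      then show ?thesis by (simp add: h_def)
    next
      case last
      then show ?thesis using h\<iota>[of "Suc m" True] linked_sym[OF linked_trans[OF new mono(2)[OF l]]] by simp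
    qed
    have id_edge: "linked ?r (L False (False, i)) (L False (True, i))" if "i \<le> m" for i
    proof -
      have "(L False (False, i), L False (\<not> False, i)) \<in> glue (L False) (tl_id (Suc m))"
        using that by (intro glueI tl_idI) simp
      then show ?thesis by (intro linked_base) simp
    qed
    have new_r: "linked ?r (\<iota> (False, m)) (\<iota> (True, Suc m))"
      using linked_trans[OF id_edge[of m], of "\<iota> (True, Suc m)"] mono(1)[OF l] by (simp add: leg_def)
    have T\<iota>: "linked ?r (L True p) (\<iota> p)" if "p \<in> box_points (Suc m)" for p
      using that
    proof (cases rule: leg_cases[where t = True])
      case (mid i)
      then show ?thesis using linked_sym[OF id_edge[of i]] by (simp add: leg_def)
    next
      case last
      then show ?thesis using linked_sym[OF new_r] by simp
    qed simp
    have "comps T ?r = comps S ?r'"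
    proof (rule comps_section[where h = h and g = "\<lambda>x. x"])
      show "h ` T = S"
      proof
        show "h ` T \<subseteq> S"
        proof (rule image_subsetI)
          fix x assume x: "x \<in> T"
          show "h x \<in> S"
          proof (cases "x \<in> S")
            case False
            then have "N \<le> x" "x - N < m" using x by (auto simp: T_def)
            then show ?thesis using \<iota>S[of "x - N"] by (simp add: h_def)
          qed (simp add: hS)
        qed
        show "S \<subseteq> h ` T" using hS ST by force
      qed
      show "linked ?r' (h x) (h y)" if "(x, y) \<in> ?r" for x y
      proof -
        from that consider "(x, y) \<in> R" | "(x, y) \<in> glue (L False) (tl_id (Suc m))" | "(x, y) \<in> glue (L True) D" by blast
        then show ?thesis
        proof cases
          case 1
          then have "x \<in> S" "y \<in> S" using RS by auto
          then show ?thesis using 1 hS by (auto intro: linked_base)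
        next
          case 2
          then obtain i where i: "i < Suc m" "x = L False (False, i) \<and> y = L False (True, i) \<or> x = L False (True, i) \<and> y = L False (False, i)"
            unfolding glue_tl_id by blast
          have "linked ?r' (h (L False (False, i))) (h (L False (True, i)))"
          proof (cases "i < m")
            case True
            then show ?thesis using h\<iota>[of i False] by (simp add: leg_def h_def)
          next
            case False
            then have "i = m" using i by simp
            then show ?thesis using h\<iota>[of m False] h\<iota>[of "Suc m" False] new
              by (simp add: leg_def)
          qed
          then show ?thesis using i(2) linked_sym by metis
        next
          case 3
          then obtain p q where pq: "x = L True p" "y = L True q" "{p, q} \<in> D" by (auto simp: glue_def)
          have "linked ?r' (\<iota> p) (\<iota> q)" using pq(3) by (intro linked_base) (auto intro: glueI)
          then show ?thesis unfolding pq(1,2) using tl_diagrams_in[OF D pq(3)] by (intro linked_link[OF hT hT]) auto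
        qed
      qed
      show "linked ?r u v" if "(u, v) \<in> ?r'" for u v
      proof -
        from that consider "(u, v) = ?e" | "(u, v) \<in> R" | "(u, v) \<in> glue \<iota> D" by blast
        then show ?thesis
        proof cases
          case 1
          then show ?thesis using id_edge[of m] by (simp add: leg_def)
        next
          case 3
          then obtain p q where pq: "u = \<iota> p" "v = \<iota> q" "{p, q} \<in> D" by (auto simp: glue_def)
          have "linked ?r (L True p) (L True q)" using pq(3) by (intro linked_base) (auto intro: glueI)
          then show ?thesis unfolding pq(1,2) using tl_diagrams_in[OF D pq(3)]
            by (intro linked_link[OF linked_sym[OF T\<iota>] linked_sym[OF T\<iota>]]) auto
        qed (auto intro: linked_base)
      qed
      show "linked ?r x (h x)" if "x \<in> T" for x
      proof (cases "x \<in> S")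
        case False
        then have x: "x - N < m" "x = N + (x - N)" using that by (auto simp: T_def)
        then show ?thesis using id_edge[of "x - N"] by (auto simp: leg_def h_def intro: linked_sym)
      qed (simp add: hS)
    qed
    moreover have "comps S (R \<union> glue \<iota> D) = Suc (comps S ?r')"
    proof (rule comps_insert_unlinked[OF fS])
      show "\<iota> (False, m) \<in> S" "\<iota> (False, Suc m) \<in> S" using \<iota>S by auto
      show "\<not> linked (R \<union> glue \<iota> D) (\<iota> (False, m)) (\<iota> (False, Suc m))"
        using linked_glue_avoid[OF D iso_ball, of "\<iota> (False, m)" "\<iota> (False, Suc m)"] iso[of "(False, m)"] by auto
    qed
    ultimately show "loop_value * (f D * loop_value ^ comps T ?r) = f D * loop_value ^ comps S (R \<union> glue \<iota> D)"
      by simp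
  qed
  ultimately have dbl: "loop_value * double = skein (Suc m) f S R \<iota>" by simp
  have first: "skein (Suc m) f S (insert (\<iota> (False, Suc m), \<iota> (True, Suc m)) R) \<iota> = skein (Suc m) f S R \<iota>"
    by (rule skein_cong_linked[OF linked_insert_absorb[OF l]])
  have "loop_value * skein (Suc (Suc m)) (jones_wenzl (Suc (Suc m))) S R \<iota> =
      loop_value * skein (Suc m) f S R \<iota> - Delta m / Delta (Suc m) * (loop_value * double)"
    unfolding recursion first by (simp add: algebra_simps)
  also have "\<dots> = (loop_value * Delta (Suc m) - Delta m) / Delta (Suc m) * skein (Suc m) f S R \<iota>"
    unfolding dbl by (simp add: field_simps)
  finally show ?thesis by (simp add: Delta_Suc_Suc del: jones_wenzl.simps)
qed

text \<open>For i < m the cap lies on strands of \<open>f\<close> and kills both terms of the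
  recursion. For i = m it joins the last strand of \<open>f\<close> to the added strand. Then the
  copy of \<open>f\<close> on side \<open>t\<close> in the correction term has its last strand
  closed, and the partial trace replaces it by Delta (m+1) / Delta m times f^(m). The other copy of
  \<open>f\<close> kills all of f^(m) except the identity, and the result is Delta (m+1) / Delta m
  times the first term, so the recursion coefficient makes the two terms cancel.\<close>

lemma cap_step:
  assumes K: "kills_caps (Suc m) f" and Tr: "traces m" and i: "Suc i < Suc (Suc m)"
    and l: "linked R (\<iota> (t, i)) (\<iota> (t, Suc i))"
    and iso: "\<And>p. p \<in> box_points (Suc (Suc m)) \<Longrightarrow> linked R (\<iota> p) (\<iota> (t, i)) \<Longrightarrow> p = (t, i) \<or> p = (t, Suc i)"
  shows "skein (Suc (Suc m)) (jones_wenzl (Suc (Suc m))) S R \<iota> = 0"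
proof -
  have far: "\<forall>p\<in>box_points (Suc m). \<not> linked R (L (\<not> t) p) (\<iota> (t, i))"
  proof
    fix p assume "p \<in> box_points (Suc m)"
    then show "\<not> linked R (L (\<not> t) p) (\<iota> (t, i))"
    proof (cases rule: leg_cases[where t = "\<not> t"])
      case (same k)
      then show ?thesis using iso[of "(\<not> t, k)"] by auto
    next
      case (mid k)
      then show ?thesis using linked_mid(1)[of "N + k" "\<iota> (t, i)"] \<iota>_lt[of i t] i by auto
    next
      case last
      then show ?thesis using iso[of "(\<not> t, Suc m)"] by auto
    qed
  qed
  have mono: "linked R x y \<Longrightarrow> linked (R \<union> s) x y" for x y s by (rule linked_mono) auto
  show ?thesis
  proof (cases "i < m")
    case True
    have "skein (Suc m) f S (insert (\<iota> (False, Suc m), \<iota> (True, Suc m)) R) \<iota> = 0"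
    proof (rule kills_capsD[OF K fS, where t = t])
      show "insert (\<iota> (False, Suc m), \<iota> (True, Suc m)) R \<subseteq> S \<times> S" using RS \<iota>S by auto
      show "\<iota> ` box_points (Suc m) \<subseteq> S" using \<iota>S by (auto simp: box_points_def)
      show "Suc i < Suc m" using True by simp
      show "linked (insert (\<iota> (False, Suc m), \<iota> (True, Suc m)) R) (\<iota> (t, i)) (\<iota> (t, Suc i))"
        using l by (simp add: linked_insert)
      fix p assume p: "p \<in> box_points (Suc m)" "linked (insert (\<iota> (False, Suc m), \<iota> (True, Suc m)) R) (\<iota> p) (\<iota> (t, i))"
      have "\<not> linked R (\<iota> (u, Suc m)) (\<iota> (t, i))" for u using iso[of "(u, Suc m)"] True by auto
      then have "linked R (\<iota> p) (\<iota> (t, i))" using p(2) by (simp add: linked_insert)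
      moreover have "p \<in> box_points (Suc (Suc m))" using p(1) by (auto simp: box_points_def)
      ultimately show "p = (t, i) \<or> p = (t, Suc i)" by (intro iso)
    qed
    moreover have "skein (Suc m) f T (R \<union> glue (L (\<not> t)) D) (L t) = 0" if D: "D \<in> tl_diagrams (Suc m)" for D
    proof (rule kills_capsD[OF K fT glue_T[OF D] L_T', where t = t])
      show "Suc i < Suc m" using True by simp
      show "linked (R \<union> glue (L (\<not> t)) D) (L t (t, i)) (L t (t, Suc i))" using mono[OF l] by simp
      fix p assume p: "p \<in> box_points (Suc m)" "linked (R \<union> glue (L (\<not> t)) D) (L t p) (L t (t, i))"
      have "linked R (L t p) (\<iota> (t, i))"
        using linked_glue_avoid[OF D far, of "L t p" "\<iota> (t, i)"] p(2) by simp
      with p(1) show "p = (t, i) \<or> p = (t, Suc i)"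
      proof (cases rule: leg_cases[where t = t])
        case (same k)
        then show ?thesis using iso[of "(t, k)"] \<open>linked R (L t p) (\<iota> (t, i))\<close> by auto
      next
        case (mid k)
        then show ?thesis using linked_mid(1)[of "N + k" "\<iota> (t, i)"] \<iota>_lt[of i t] i \<open>linked R (L t p) (\<iota> (t, i))\<close> by auto
      next
        case last
        then show ?thesis using iso[of "(t, Suc m)"] \<open>linked R (L t p) (\<iota> (t, i))\<close> True by auto
      qed
    qed
    then have "double = 0" unfolding double_eq[of t] by simp
    ultimately show ?thesis unfolding recursion by simp
  next
    case False
    then have im: "i = m" using i by simp
    have lt: "linked R (\<iota> (t, m)) (\<iota> (t, Suc m))" using l im by simp
    have iso': "\<not> linked R (\<iota> p) (\<iota> (t, m))" if "p \<in> box_points (Suc m)" "p \<noteq> (t, m)" for p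
      using iso[of p] that im by (auto simp: box_points_def)
    have iso2: "\<not> linked R (\<iota> (\<not> t, Suc m)) (\<iota> (t, m))" using iso[of "(\<not> t, Suc m)"] im by auto
    let ?g = "jones_wenzl m"
    have tr: "loop_value * skein (Suc m) f T (R \<union> glue (L (\<not> t)) D) (L t) =
        Delta (Suc m) / Delta m * skein m ?g T (R \<union> glue (L (\<not> t)) D) (L t)"
      if D: "D \<in> tl_diagrams (Suc m)" for D
    proof (rule tracesD[OF Tr fT glue_T[OF D] L_T'])
      have "linked R (L t (t, m)) (L t (\<not> t, m))" using lt by simp
      then have LL: "linked R (L t (u, m)) (L t (u', m))" for u u'
        by (cases "u = t"; cases "u' = t") (auto intro: linked_sym)
      then show "linked (R \<union> glue (L (\<not> t)) D) (L t (False, m)) (L t (True, m))" by (intro mono)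
      show "\<not> linked (R \<union> glue (L (\<not> t)) D) (L t p) (L t (False, m))" if p: "p \<in> box_points m" for p
      proof
        assume "linked (R \<union> glue (L (\<not> t)) D) (L t p) (L t (False, m))"
        then have "linked R (L t p) (\<iota> (t, i)) \<longleftrightarrow> linked R (L t (False, m)) (\<iota> (t, i))"
          by (rule linked_glue_avoid[OF D far])
        then have a: "linked R (L t p) (\<iota> (t, m))" using LL[of False t] im by simp
        have p': "p \<in> box_points (Suc m)" "p \<noteq> (t, m)" "p \<noteq> (\<not> t, m)" using p by (auto simp: box_points_def)
        from p'(1) show False
        proof (cases rule: leg_cases[where t = t])
          case (same k)
          then show ?thesis using a iso'[OF p'(1,2)] by simp
        next
          case (mid k)
          then show ?thesis using a linked_mid(1)[of "N + k" "\<iota> (t, m)"] \<iota>_lt[of m t] by auto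
        qed (use p' in simp)
      qed
    qed
    \<comment> \<open>Interchanging the sums expands f^(m) first and leaves the other copy of
      \<open>f\<close> as the box that sees the caps.\<close>
    have swap: "(\<Sum>D\<in>tl_diagrams (Suc m). f D * skein m ?g T (R \<union> glue (L (\<not> t)) D) (L t)) =
        (\<Sum>D\<in>tl_diagrams m. ?g D * skein (Suc m) f T (R \<union> glue (L t) D) (L (\<not> t)))"
      unfolding skein_def sum_distrib_left by (subst sum.swap) (intro sum.cong refl, simp add: Un_ac mult_ac)
    have zero: "skein (Suc m) f T (R \<union> glue (L t) D) (L (\<not> t)) = 0"
      if D: "D \<in> tl_diagrams m" "D \<noteq> tl_id m" for D
    proof -
      obtain k where k: "Suc k < m" "{(\<not> t, k), (\<not> t, Suc k)} \<in> D" using tl_cap[OF D] by blast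
      have L': "L t ` box_points m \<subseteq> T" by (intro image_subsetI L_T) (auto simp: box_points_def)
      have sep: "p = (\<not> t, k) \<or> p = (\<not> t, Suc k)"
        if p: "p \<in> box_points m" "linked R (L t p) (L t (\<not> t, k)) \<or> linked R (L t p) (L t (\<not> t, Suc k))" for p
      proof -
        have e: "L t p = N + k \<or> L t p = N + Suc k" using p(2) k(1) linked_mid(2)[of "N + k"] linked_mid(2)[of "N + Suc k"] by auto
        have "p \<in> box_points (Suc m)" using p(1) by (auto simp: box_points_def)
        then show ?thesis
        proof (cases rule: leg_cases[where t = t])
          case (same j)
          then show ?thesis using e \<iota>_lt[of j t] by auto
        qed (use e p(1) in auto)
      qed
      show ?thesis
      proof (rule kills_capsD[OF K fT, where t = t and i = k])
        show "R \<union> glue (L t) D \<subseteq> T \<times> T" using RT glue_sub[OF D(1) L'] by simp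
        show "L (\<not> t) ` box_points (Suc m) \<subseteq> T" by (rule L_T')
        show "Suc k < Suc m" using k by simp
        have "linked (R \<union> glue (L t) D) (L t (\<not> t, k)) (L t (\<not> t, Suc k))"
          using k(2) by (intro linked_base) (auto intro: glueI)
        then show "linked (R \<union> glue (L t) D) (L (\<not> t) (t, k)) (L (\<not> t) (t, Suc k))" using k(1) by simp
        fix p assume p: "p \<in> box_points (Suc m)" "linked (R \<union> glue (L t) D) (L (\<not> t) p) (L (\<not> t) (t, k))"
        then have "linked (R \<union> glue (L t) D) (L (\<not> t) p) (L t (\<not> t, k))" using k(1) by simp
        then have "linked R (L (\<not> t) p) (L t (\<not> t, k)) \<or> linked R (L (\<not> t) p) (L t (\<not> t, Suc k))"
          by (rule linked_glue_cap[OF D(1) k(2) sep, rotated -1])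
        then have e: "L (\<not> t) p = N + k \<or> L (\<not> t) p = N + Suc k"
          using k(1) linked_mid(2)[of "N + k"] linked_mid(2)[of "N + Suc k"] by auto
        from p(1) show "p = (t, k) \<or> p = (t, Suc k)"
        proof (cases rule: leg_cases[where t = "\<not> t"])
          case (same j)
          then show ?thesis using e \<iota>_lt[of j "\<not> t"] by auto
        next
          case (mid j)
          then show ?thesis using e by auto
        next
          case last
          then show ?thesis using e \<iota>_lt[of "Suc m" "\<not> t"] by auto
        qed
      qed
    qed
    have id: "skein (Suc m) f T (R \<union> glue (L t) (tl_id m)) (L (\<not> t)) =
        loop_value * skein (Suc m) f S (insert (\<iota> (False, Suc m), \<iota> (True, Suc m)) R) \<iota>"
      unfolding skein_def sum_distrib_left
    proof (intro sum.cong refl)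
      fix D assume D: "D \<in> tl_diagrams (Suc m)"
      let ?r = "R \<union> glue (L t) (tl_id m) \<union> glue (L (\<not> t)) D"
      \<comment> \<open>After the identity of f^(m) is shrunk, the remaining copy of
        \<open>f\<close> sits on the outer points, except that its last end on row \<open>t\<close>
        is bent by the hook to \<open>\<iota> (\<not> t, Suc m)\<close>. The cap has become a
        separate circle, which accounts for the factor \<open>loop_value\<close>.\<close>
      define \<nu> where "\<nu> p = (if p = (t, m) then \<iota> (\<not> t, Suc m) else \<iota> p)" for p
      let ?r' = "R \<union> glue \<nu> D"
      define h where "h x = (if x < N then x else \<iota> (t, x - N))" for x
      have hS: "h x = x" if "x \<in> S" for x using that SN by (auto simp: h_def)
      have h\<iota>: "h (\<iota> (u, j)) = \<iota> (u, j)" if "j < Suc (Suc m)" for u j using \<iota>_lt[OF that] by (simp add: h_def)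
      have hL: "h (L (\<not> t) p) = \<nu> p" if "p \<in> box_points (Suc m)" for p
        using that
      proof (cases rule: leg_cases[where t = "\<not> t"])
        case (same j)
        then show ?thesis using h\<iota>[of j "\<not> t"] by (auto simp: \<nu>_def)
      next
        case (mid j)
        then show ?thesis by (auto simp: \<nu>_def h_def)
      next
        case last
        then show ?thesis using h\<iota>[of "Suc m" "\<not> t"] by (auto simp: \<nu>_def)
      qed
      have id_edge: "linked ?r (\<iota> (t, j)) (N + j)" if "j < m" for j
      proof -
        have "(L t (t, j), L t (\<not> t, j)) \<in> glue (L t) (tl_id m)" using that by (intro glueI tl_idI)
        then show ?thesis using that by (intro linked_base) simp
      qed
      have X: "linked ?r x (h x)" if "x \<in> T" for x
      proof (cases "x \<in> S")
        case False
        then have x: "x - N < m" "x = N + (x - N)" using that by (auto simp: T_def)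
        then show ?thesis using id_edge[of "x - N"] by (auto simp: h_def intro: linked_sym)
      qed (simp add: hS)
      have "comps T ?r = comps S ?r'"
      proof (rule comps_section[where h = h and g = "\<lambda>x. x", OF _ _ _ X])
        show "h ` T = S"
        proof
          show "h ` T \<subseteq> S"
        proof (rule image_subsetI)
          fix x assume x: "x \<in> T"
          show "h x \<in> S"
          proof (cases "x \<in> S")
            case False
            then have "N \<le> x" "x - N < m" using x by (auto simp: T_def)
            then show ?thesis using \<iota>S[of "x - N"] by (simp add: h_def)
          qed (simp add: hS)
        qed
          show "S \<subseteq> h ` T" using hS ST by force
        qed
        show "linked ?r' (h x) (h y)" if "(x, y) \<in> ?r" for x y
        proof -
          from that consider "(x, y) \<in> R" | "(x, y) \<in> glue (L t) (tl_id m)" | "(x, y) \<in> glue (L (\<not> t)) D" by blast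
          then show ?thesis
          proof cases
            case 1
            then have "x \<in> S" "y \<in> S" using RS by auto
            then show ?thesis using 1 hS by (auto intro: linked_base)
          next
            case 2
            then obtain j where j: "j < m" "x = L t (False, j) \<and> y = L t (True, j) \<or> x = L t (True, j) \<and> y = L t (False, j)"
              unfolding glue_tl_id by blast
            have "h (L t (u, j)) = \<iota> (t, j)" for u
              using j(1) h\<iota>[of j t] by (cases "u = t") (auto simp: h_def)
            then show ?thesis using j(2) by auto
          next
            case 3
            then obtain p q where pq: "x = L (\<not> t) p" "y = L (\<not> t) q" "{p, q} \<in> D" by (auto simp: glue_def)
            then show ?thesis using hL tl_diagrams_in[OF D pq(3)] by (auto intro!: linked_base glueI)
          qed
        qed
        show "linked ?r u v" if "(u, v) \<in> ?r'" for u v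
        proof -
          from that consider "(u, v) \<in> R" | "(u, v) \<in> glue \<nu> D" by blast
          then show ?thesis
          proof cases
            case 2
            then obtain p q where pq: "u = \<nu> p" "v = \<nu> q" "{p, q} \<in> D" by (auto simp: glue_def)
            have "linked ?r (L (\<not> t) p) (L (\<not> t) q)" using pq(3) by (intro linked_base) (auto intro: glueI)
            then have "linked ?r (h (L (\<not> t) p)) (h (L (\<not> t) q))" using tl_diagrams_in[OF D pq(3)]
              by (intro linked_link[OF linked_sym[OF X[OF L_T]] linked_sym[OF X[OF L_T]]]) auto
            then show ?thesis using hL tl_diagrams_in[OF D pq(3)] pq by simp
          qed (auto intro: linked_base)
        qed
      qed
      moreover have "comps S ?r' = Suc (comps S (insert (\<iota> (t, Suc m), \<iota> (\<not> t, Suc m)) ?r'))"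
      proof (rule comps_insert_unlinked[OF fS])
        show "\<iota> (t, Suc m) \<in> S" "\<iota> (\<not> t, Suc m) \<in> S" using \<iota>S by auto
        have av: "\<forall>p\<in>box_points (Suc m). \<not> linked R (\<nu> p) (\<iota> (t, m))"
          using iso' iso2 by (auto simp: \<nu>_def)
        show "\<not> linked ?r' (\<iota> (t, Suc m)) (\<iota> (\<not> t, Suc m))"
          using linked_glue_avoid[OF D av, of "\<iota> (t, Suc m)" "\<iota> (\<not> t, Suc m)"] iso2 linked_sym[OF lt] by auto
      qed
      moreover have "comps S (insert (\<iota> (t, Suc m), \<iota> (\<not> t, Suc m)) ?r') =
          comps S (insert (\<iota> (False, Suc m), \<iota> (True, Suc m)) R \<union> glue \<iota> D)"
      proof (rule comps_cong_linked, rule linked_cong)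
        let ?a = "insert (\<iota> (t, Suc m), \<iota> (\<not> t, Suc m)) ?r'"
        let ?b = "insert (\<iota> (False, Suc m), \<iota> (True, Suc m)) R \<union> glue \<iota> D"
        have ba: "linked ?b (\<iota> (t, Suc m)) (\<iota> (\<not> t, Suc m))"
          by (cases t) (auto intro: linked_base linked_base')
        have "linked ?b (\<iota> (t, m)) (\<iota> (t, Suc m))" using lt by (rule linked_mono) auto
        from linked_sym[OF linked_trans[OF this ba]]
        have b: "linked ?b (\<nu> p) (\<iota> p)" for p
          by (auto simp: \<nu>_def)
        have aa: "linked ?a (\<iota> (t, Suc m)) (\<iota> (\<not> t, Suc m))" by (rule linked_base) simp
        have "linked ?a (\<iota> (t, m)) (\<iota> (t, Suc m))" using lt by (rule linked_mono) auto
        from linked_sym[OF linked_trans[OF this aa]]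
        have a: "linked ?a (\<nu> p) (\<iota> p)" for p
          by (auto simp: \<nu>_def)
        show "linked ?b x y" if "(x, y) \<in> ?a" for x y
        proof -
          from that consider "x = \<iota> (t, Suc m)" "y = \<iota> (\<not> t, Suc m)" | "(x, y) \<in> R" | "(x, y) \<in> glue \<nu> D" by blast
          then show ?thesis
          proof cases
            case 3
            then obtain p q where pq: "x = \<nu> p" "y = \<nu> q" "{p, q} \<in> D" by (auto simp: glue_def)
            have "linked ?b (\<iota> p) (\<iota> q)" using pq(3) by (intro linked_base) (auto intro: glueI)
            then show ?thesis unfolding pq(1,2) by (rule linked_link[OF b b])
          qed (use ba in \<open>auto intro: linked_base\<close>)
        qed
        show "linked ?a x y" if "(x, y) \<in> ?b" for x y
        proof -
          from that consider "x = \<iota> (False, Suc m)" "y = \<iota> (True, Suc m)" | "(x, y) \<in> R" | "(x, y) \<in> glue \<iota> D" by blast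
          then show ?thesis
          proof cases
            case 1
            then show ?thesis using aa by (cases t) (auto intro: linked_sym)
          next
            case 3
            then obtain p q where pq: "x = \<iota> p" "y = \<iota> q" "{p, q} \<in> D" by (auto simp: glue_def)
            have "linked ?a (\<nu> p) (\<nu> q)" using pq(3) by (intro linked_base) (auto intro: glueI)
            then show ?thesis unfolding pq(1,2) by (rule linked_link[OF linked_sym[OF a] linked_sym[OF a]])
          qed (auto intro: linked_base)
        qed
      qed
      ultimately show "f D * loop_value ^ comps T ?r = loop_value * (f D *
          loop_value ^ comps S (insert (\<iota> (False, Suc m), \<iota> (True, Suc m)) R \<union> glue \<iota> D))"
        by simp
    qed
    have "loop_value * double = (\<Sum>D\<in>tl_diagrams (Suc m). f D * (loop_value * skein (Suc m) f T (R \<union> glue (L (\<not> t)) D) (L t)))"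
      unfolding double_eq[of t] sum_distrib_left by (simp add: mult_ac)
    also have "\<dots> = Delta (Suc m) / Delta m * (\<Sum>D\<in>tl_diagrams (Suc m). f D * skein m ?g T (R \<union> glue (L (\<not> t)) D) (L t))"
      unfolding sum_distrib_left by (intro sum.cong refl) (simp add: tr mult_ac)
    also have "\<dots> = Delta (Suc m) / Delta m * (loop_value * skein (Suc m) f S (insert (\<iota> (False, Suc m), \<iota> (True, Suc m)) R) \<iota>)"
      unfolding swap using sum_only_id[of m, OF zero] id by simp
    also have "\<dots> = loop_value * (Delta (Suc m) / Delta m * skein (Suc m) f S (insert (\<iota> (False, Suc m), \<iota> (True, Suc m)) R) \<iota>)"
      by (simp only: mult.left_commute)
    finally have "double = Delta (Suc m) / Delta m * skein (Suc m) f S (insert (\<iota> (False, Suc m), \<iota> (True, Suc m)) R) \<iota>"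
      unfolding mult_cancel_left using loop_value_nonzero by blast
    then show ?thesis unfolding recursion by simp
  qed
qed

end

text \<open>The indices are offset to fit the dependencies: killing caps on m + 2 strands uses the
  same on m + 1 strands and the partial trace from m + 1 to m strands, while the partial trace from
  m + 2 to m + 1 strands uses cap killing on m + 1. At the start a single strand admits no cap, and
  Delta 1 is the value of a circle.\<close>

lemma jones_wenzl_step: "kills_caps (Suc m) (jones_wenzl (Suc m)) \<and> traces m"
proof (induction m)
  case 0
  have "traces 0"
    unfolding traces_def
  proof (intro allI impI)
    fix S :: "nat set" and R :: "(nat \<times> nat) set" and \<iota> :: "bool \<times> nat \<Rightarrow> nat"
    assume l: "linked R (\<iota> (False, 0)) (\<iota> (True, 0))"
    have "skein (Suc 0) (jones_wenzl (Suc 0)) S R \<iota> = skein 0 (jones_wenzl 0) S R \<iota>"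
      unfolding jones_wenzl.simps(2) skein_add_strand
      by (rule skein_cong_linked[OF linked_insert_absorb[OF l]])
    then show "loop_value * skein (Suc 0) (jones_wenzl (Suc 0)) S R \<iota> = Delta (Suc 0) / Delta 0 * skein 0 (jones_wenzl 0) S R \<iota>"
      by (simp add: Delta_1)
  qed
  then show ?case by (simp add: kills_caps_def)
next
  case (Suc m)
  have ctx: "\<exists>N. wenzl_context S N m R \<iota>"
    if "finite S" "R \<subseteq> S \<times> S" "\<iota> ` box_points (Suc (Suc m)) \<subseteq> S" for S R \<iota>
  proof -
    obtain N where "\<forall>x\<in>S. x < N" using \<open>finite S\<close> by (metis finite_nat_set_iff_bounded)
    then show ?thesis using that by (intro exI[of _ N]) (auto simp: wenzl_context_def)
  qed
  have "traces (Suc m)"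
    unfolding traces_def
  proof (intro allI impI)
    fix S :: "nat set" and R :: "(nat \<times> nat) set" and \<iota> :: "bool \<times> nat \<Rightarrow> nat"
    assume *: "finite S" "R \<subseteq> S \<times> S" "\<iota> ` box_points (Suc (Suc m)) \<subseteq> S"
      "linked R (\<iota> (False, Suc m)) (\<iota> (True, Suc m))"
      "\<forall>p\<in>box_points (Suc m). \<not> linked R (\<iota> p) (\<iota> (False, Suc m))"
    obtain N where "wenzl_context S N m R \<iota>" using ctx[OF *(1-3)] by blast
    then show "loop_value * skein (Suc (Suc m)) (jones_wenzl (Suc (Suc m))) S R \<iota> =
        Delta (Suc (Suc m)) / Delta (Suc m) * skein (Suc m) (jones_wenzl (Suc m)) S R \<iota>"
      by (rule wenzl_context.trace_step) (use Suc * in auto)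
  qed
  moreover have "kills_caps (Suc (Suc m)) (jones_wenzl (Suc (Suc m)))"
    unfolding kills_caps_def
  proof (intro allI impI)
    fix S :: "nat set" and R :: "(nat \<times> nat) set" and \<iota> :: "bool \<times> nat \<Rightarrow> nat" and t i
    assume *: "finite S" "R \<subseteq> S \<times> S" "\<iota> ` box_points (Suc (Suc m)) \<subseteq> S" "Suc i < Suc (Suc m)"
      "linked R (\<iota> (t, i)) (\<iota> (t, Suc i))"
      "\<forall>p\<in>box_points (Suc (Suc m)). linked R (\<iota> p) (\<iota> (t, i)) \<longrightarrow> p = (t, i) \<or> p = (t, Suc i)"
    obtain N where N: "wenzl_context S N m R \<iota>" using ctx[OF *(1-3)] by blast
    show "skein (Suc (Suc m)) (jones_wenzl (Suc (Suc m))) S R \<iota> = 0"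
      using wenzl_context.cap_step[OF N conjunct1[OF Suc] conjunct2[OF Suc] *(4,5)] *(6) by blast
  qed
  ultimately show ?case by simp
qed

section \<open>Transfer to arbitrary finite point sets, and the full trace\<close>

lemma skein_relabel:
  assumes "inj_on h S" "R \<subseteq> S \<times> S" "\<iota> ` box_points n \<subseteq> S"
  shows "skein n f (h ` S) (map_prod h h ` R) (h \<circ> \<iota>) = skein n f S R \<iota>"
  unfolding skein_def
proof (intro sum.cong refl)
  fix D assume D: "D \<in> tl_diagrams n"
  have "glue (h \<circ> \<iota>) D = map_prod h h ` glue \<iota> D"
    unfolding glue_def image_Collect_ex2 by simp
  then have "comps (h ` S) (map_prod h h ` R \<union> glue (h \<circ> \<iota>) D) = comps S (R \<union> glue \<iota> D)"
    using comps_relabel[OF assms(1), of "R \<union> glue \<iota> D"] assms(2) glue_sub[OF D assms(3)] by (simp add: image_Un)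
  then show "f D * loop_value ^ comps (h ` S) (map_prod h h ` R \<union> glue (h \<circ> \<iota>) D) = f D * loop_value ^ comps S (R \<union> glue \<iota> D)"
    by simp
qed

lemma linked_relabel:
  assumes h: "inj_on h S" and R: "R \<subseteq> S \<times> S" and xy: "x \<in> S" "y \<in> S"
  shows "linked (map_prod h h ` R) (h x) (h y) \<longleftrightarrow> linked R x y"
proof (rule linked_collapse[OF R _ _ _ xy, symmetric])
  show "linked (map_prod h h ` R) (h x) (h y)" if "(x, y) \<in> R" for x y
    using that by (intro linked_base) (auto intro: rev_image_eqI)
  show "\<exists>x\<in>S. \<exists>y\<in>S. h x = u \<and> h y = v \<and> linked R x y" if "(u, v) \<in> map_prod h h ` R" for u v
    using that R by (auto intro!: linked_base)
  show "linked R x y" if "x \<in> S" "y \<in> S" "h x = h y" for x y using h that by (auto simp: inj_on_def)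
qed

lemma skein_jones_wenzl_cap:
  assumes S: "finite S" "R \<subseteq> S \<times> S" "\<iota> ` box_points n \<subseteq> S" and i: "Suc i < n"
    and l: "linked R (\<iota> (t, i)) (\<iota> (t, Suc i))"
    and iso: "\<And>p. p \<in> box_points n \<Longrightarrow> linked R (\<iota> p) (\<iota> (t, i)) \<Longrightarrow> p = (t, i) \<or> p = (t, Suc i)"
  shows "skein n (jones_wenzl n) S R \<iota> = 0"
proof -
  obtain h :: "'a \<Rightarrow> nat" where h: "inj_on h S" using finite_imp_inj_to_nat_seg[OF S(1)] by blast
  have lr: "linked (map_prod h h ` R) ((h \<circ> \<iota>) p) ((h \<circ> \<iota>) q) \<longleftrightarrow> linked R (\<iota> p) (\<iota> q)"
    if "p \<in> box_points n" "q \<in> box_points n" for p q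
    using linked_relabel[OF h S(2)] S(3) that by auto
  have "kills_caps n (jones_wenzl n)" using i jones_wenzl_step[of "n - 1"] by simp
  then have "skein n (jones_wenzl n) (h ` S) (map_prod h h ` R) (h \<circ> \<iota>) = 0"
  proof (rule kills_capsD)
    show "linked (map_prod h h ` R) ((h \<circ> \<iota>) (t, i)) ((h \<circ> \<iota>) (t, Suc i))" using i l by (subst lr) auto
    show "p = (t, i) \<or> p = (t, Suc i)" if "p \<in> box_points n" "linked (map_prod h h ` R) ((h \<circ> \<iota>) p) ((h \<circ> \<iota>) (t, i))" for p
      using iso[OF that(1)] lr[of p "(t, i)"] that i by auto
  qed (use S i in auto)
  then show ?thesis using skein_relabel[OF h S(2,3)] by simp
qed

text \<open>Closing the strands one at a time telescopes the quotients Delta (k+1) / Delta k to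
  Delta n, as Delta 0 = 1. Each closing arc is a separate class of \<open>R\<close>, whence the
  \<open>n\<close> compensating factors \<open>loop_value\<close>.\<close>

lemma skein_jones_wenzl_trace_nat:
  fixes S :: "nat set"
  assumes S: "finite S" "R \<subseteq> S \<times> S" "\<iota> ` box_points n \<subseteq> S"
    and l: "\<And>i. i < n \<Longrightarrow> linked R (\<iota> (False, i)) (\<iota> (True, i))"
    and iso: "\<And>i j. i < n \<Longrightarrow> j < n \<Longrightarrow> linked R (\<iota> (False, i)) (\<iota> (False, j)) \<Longrightarrow> i = j"
  shows "loop_value ^ n * skein n (jones_wenzl n) S R \<iota> = Delta n * loop_value ^ comps S R"
  using S(3) l iso
proof (induction n)
  case 0
  then show ?case by (simp add: skein_def glue_def)
next
  case (Suc n)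
  have sub: "\<iota> ` box_points n \<subseteq> S" using Suc.prems(1) by (auto simp: box_points_def)
  have "loop_value * skein (Suc n) (jones_wenzl (Suc n)) S R \<iota> = Delta (Suc n) / Delta n * skein n (jones_wenzl n) S R \<iota>"
  proof (rule tracesD[OF conjunct2[OF jones_wenzl_step] S(1,2) Suc.prems(1)])
    show "linked R (\<iota> (False, n)) (\<iota> (True, n))" using Suc.prems(2) by simp
    fix p assume "p \<in> box_points n"
    then obtain u i where p: "p = (u, i)" "i < n" by (cases p) auto
    have "linked R (\<iota> p) (\<iota> (False, i))" using Suc.prems(2)[of i] p by (cases u) (auto intro: linked_sym)
    then show "\<not> linked R (\<iota> p) (\<iota> (False, n))"
      using Suc.prems(3)[of i n] p linked_trans[OF linked_sym, of R "\<iota> p" "\<iota> (False, i)" "\<iota> (False, n)"] by auto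
  qed
  then have "loop_value ^ Suc n * skein (Suc n) (jones_wenzl (Suc n)) S R \<iota> =
      Delta (Suc n) / Delta n * (loop_value ^ n * skein n (jones_wenzl n) S R \<iota>)"
    by (simp only: power_Suc2 mult.assoc mult.left_commute)
  also have "loop_value ^ n * skein n (jones_wenzl n) S R \<iota> = Delta n * loop_value ^ comps S R"
    using Suc.prems(2,3) by (intro Suc.IH sub) auto
  finally show ?case by simp
qed

lemma skein_jones_wenzl_trace:
  assumes S: "finite S" "R \<subseteq> S \<times> S" "\<iota> ` box_points n \<subseteq> S"
    and l: "\<And>i. i < n \<Longrightarrow> linked R (\<iota> (False, i)) (\<iota> (True, i))"
    and iso: "\<And>i j. i < n \<Longrightarrow> j < n \<Longrightarrow> linked R (\<iota> (False, i)) (\<iota> (False, j)) \<Longrightarrow> i = j"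
  shows "loop_value ^ n * skein n (jones_wenzl n) S R \<iota> = Delta n * loop_value ^ comps S R"
proof -
  obtain h :: "'a \<Rightarrow> nat" where h: "inj_on h S" using finite_imp_inj_to_nat_seg[OF S(1)] by blast
  have lr: "linked (map_prod h h ` R) ((h \<circ> \<iota>) (u, i)) ((h \<circ> \<iota>) (v, j)) \<longleftrightarrow> linked R (\<iota> (u, i)) (\<iota> (v, j))"
    if "i < n" "j < n" for u v i j
  proof -
    have "\<iota> (u, i) \<in> S" "\<iota> (v, j) \<in> S" using S(3) that by auto
    then show ?thesis using linked_relabel[OF h S(2)] by simp
  qed
  have "loop_value ^ n * skein n (jones_wenzl n) (h ` S) (map_prod h h ` R) (h \<circ> \<iota>) =
      Delta n * loop_value ^ comps (h ` S) (map_prod h h ` R)"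
    by (rule skein_jones_wenzl_trace_nat) (use S l iso lr in auto)
  then show ?thesis using skein_relabel[OF h S(2,3)] comps_relabel[OF h S(2)] by simp
qed

section \<open>A planar network with one edge cut\<close>

lemma perfect_matching_UN:
  assumes pm: "\<And>i. i \<in> I \<Longrightarrow> perfect_matching_on (S i) (M i)"
    and disj: "\<And>i j x. i \<in> I \<Longrightarrow> j \<in> I \<Longrightarrow> x \<in> S i \<Longrightarrow> x \<in> S j \<Longrightarrow> i = j"
  shows "perfect_matching_on (\<Union>i\<in>I. S i) (\<Union>i\<in>I. M i)"
proof (rule perfect_matching_onI)
  show "s \<subseteq> (\<Union>i\<in>I. S i) \<and> card s = 2" if "s \<in> (\<Union>i\<in>I. M i)" for s
    using that perfect_matching_onD(1,2)[OF pm] by blast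
  show "\<exists>s\<in>\<Union>i\<in>I. M i. x \<in> s" if x: "x \<in> (\<Union>i\<in>I. S i)" for x
  proof -
    obtain i where i: "i \<in> I" "x \<in> S i" using x by blast
    then obtain y where "{x, y} \<in> M i" using perfect_matching_onD(3)[OF pm] by blast
    then show ?thesis using i by (intro bexI[of _ "{x, y}"]) auto
  qed
  show "s = t" if st: "s \<in> (\<Union>i\<in>I. M i)" "t \<in> (\<Union>i\<in>I. M i)" "x \<in> s" "x \<in> t" for s t x
  proof -
    obtain i j where ij: "i \<in> I" "s \<in> M i" "j \<in> I" "t \<in> M j" using st by blast
    then have "x \<in> S i" "x \<in> S j" using perfect_matching_onD(1)[OF pm] st by blast+
    then have "i = j" using disj ij by blast
    then show ?thesis using perfect_matching_onD(5)[OF pm[OF ij(1)], of s t x] ij st by simp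
  qed
qed

text \<open>Admissibility makes the truncated subtractions and the halvings exact: the strands from
  the box of colour \<open>a\<close> to its two neighbours use up all \<open>a\<close>
  points.\<close>

lemma admissible_half:
  assumes "admissible_triple a b c"
  shows "(a + b - c) div 2 + (c + a - b) div 2 = a"
proof -
  have le: "c \<le> a + b" "b \<le> c + a" and ev: "even (a + b + c)"
    using assms unfolding admissible_triple_def by auto
  obtain k where "a + b + c = 2 * k" using ev by (elim evenE)
  then have "a + b - c = 2 * (k - c)" "c + a - b = 2 * (k - b)" "(k - c) + (k - b) = a"
    using le by auto
  then show ?thesis by simp
qed

definition cut_strands :: "('e, 'z) network_scheme \<Rightarrow> 'e \<Rightarrow> ('e \<Rightarrow> tl_diagram) \<Rightarrow> (('e \<times> bool) \<times> nat) set set" where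
  "cut_strands N e s = vertex_strands N \<union> (\<Union>e'\<in>edges N - {e}. (`) (box_to_edge N e') ` s e')"

locale cut_network =
  fixes N :: "('e, 'z) network_scheme" and e :: 'e and s :: "'e \<Rightarrow> tl_diagram"
  assumes adm: "admissible_spin_network N" and eN: "e \<in> edges N"
    and state: "\<And>e'. e' \<in> edges N - {e} \<Longrightarrow> s e' \<in> tl_diagrams (colour N e')"
begin

abbreviation "R \<equiv> strand_rel (cut_strands N e s)"
abbreviation "\<beta> \<equiv> box_to_edge N"
abbreviation "m \<equiv> dcol N"
abbreviation "\<rho> \<equiv> rot N"

lemma tri: "trivalent N" and pl: "planar N"
  using adm by (simp_all add: admissible_spin_network_def)

lemma fE: "finite (edges N)"
  using tri by (simp add: trivalent_def)

lemma fX: "finite (darts N)"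
  using fE by (simp add: darts_def)

lemma \<rho>_darts [simp]: "d \<in> darts N \<Longrightarrow> \<rho> d \<in> darts N"
  and \<rho>_ne: "d \<in> darts N \<Longrightarrow> \<rho> d \<noteq> d"
  and \<rho>3 [simp]: "d \<in> darts N \<Longrightarrow> \<rho> (\<rho> (\<rho> d)) = d"
  using tri unfolding trivalent_def by blast+

lemma fP: "finite (points N)"
  unfolding points_def using fX by (intro finite_SigmaI) auto

lemma in_points: "(d, k) \<in> points N \<longleftrightarrow> d \<in> darts N \<and> k < m d"
  by (simp add: points_def)

definition l where "l d = (m d + m (\<rho> d) - m (\<rho> (\<rho> d))) div 2"

text \<open>\<open>l d\<close> strands run from \<open>d\<close> to the next end and
  \<open>l (\<rho> (\<rho> d))\<close> come from the previous one. So the points of \<open>d\<close>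
  split into an initial segment shared with the previous end and a final segment shared with the
  next.\<close>

lemma l_sum:
  assumes "d \<in> darts N"
  shows "l d + l (\<rho> (\<rho> d)) = m d"
proof -
  have "admissible_triple (m d) (m (\<rho> d)) (m (\<rho> (\<rho> d)))"
    using adm assms by (simp add: admissible_spin_network_def)
  then show ?thesis using admissible_half assms unfolding l_def by simp
qed

lemma l_le: "d \<in> darts N \<Longrightarrow> l d \<le> m d" "d \<in> darts N \<Longrightarrow> l d \<le> m (\<rho> d)"
  using l_sum[of d] l_sum[of "\<rho> d"] by simp_all

lemma vertex_strands_eq: "vertex_strands N = {{(d, m d - 1 - k), (\<rho> d, k)} | d k. d \<in> darts N \<and> k < l d}"
  by (simp add: vertex_strands_def l_def)

lemma vertex_strandI: "d \<in> darts N \<Longrightarrow> k < l d \<Longrightarrow> {(d, m d - 1 - k), (\<rho> d, k)} \<in> vertex_strands N"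
  unfolding vertex_strands_eq by blast

lemma vertex_matching: "perfect_matching_on (points N) (vertex_strands N)"
proof (rule perfect_matching_onI)
  show "t \<subseteq> points N \<and> card t = 2" if t: "t \<in> vertex_strands N" for t
  proof -
    obtain d k where dk: "t = {(d, m d - 1 - k), (\<rho> d, k)}" "d \<in> darts N" "k < l d"
      using t unfolding vertex_strands_eq by blast
    then show ?thesis using l_le[OF dk(2)] \<rho>_ne[OF dk(2)] by (auto simp: in_points)
  qed
  show "\<exists>t\<in>vertex_strands N. x \<in> t" if x: "x \<in> points N" for x
  proof -
    obtain d k where dk: "x = (d, k)" "d \<in> darts N" "k < m d" using x by (cases x) (auto simp: in_points)
    show ?thesis
    proof (cases "k < l (\<rho> (\<rho> d))")
      case True
      let ?d = "\<rho> (\<rho> d)"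
      have "{(?d, m ?d - 1 - k), (\<rho> ?d, k)} \<in> vertex_strands N"
        using True dk by (intro vertex_strandI) auto
      then show ?thesis using dk by (intro bexI) auto
    next
      case False
      then have "m d - 1 - k < l d" using l_sum[OF dk(2)] dk(3) by linarith
      then have "{(d, m d - 1 - (m d - 1 - k)), (\<rho> d, m d - 1 - k)} \<in> vertex_strands N"
        using dk(2) by (intro vertex_strandI)
      then show ?thesis using dk by (intro bexI) auto
    qed
  qed
  \<comment> \<open>Comparing \<open>j\<close> with the split point
    \<open>l (\<rho> (\<rho> d))\<close> tells which neighbour the strand through
    \<open>(d, j)\<close> leads to and determines its other end; uniqueness follows.\<close>
  have norm: "t = (if j < l (\<rho> (\<rho> d)) then {(\<rho> (\<rho> d), m (\<rho> (\<rho> d)) - 1 - j), (d, j)} else {(d, j), (\<rho> d, m d - 1 - j)})"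
    if t: "t \<in> vertex_strands N" "(d, j) \<in> t" for t d j
  proof -
    obtain d' k where dk: "t = {(d', m d' - 1 - k), (\<rho> d', k)}" "d' \<in> darts N" "k < l d'"
      using t unfolding vertex_strands_eq by blast
    then consider "d = d'" "j = m d - 1 - k" | "d = \<rho> d'" "j = k" using t(2) by auto
    then show ?thesis
    proof cases
      case 1
      then have "\<not> j < l (\<rho> (\<rho> d))" "m d - 1 - j = k" using l_sum[of d] dk by auto
      then show ?thesis using 1 dk by simp
    next
      case 2
      then show ?thesis using dk by simp
    qed
  qed
  show "t = u" if "t \<in> vertex_strands N" "u \<in> vertex_strands N" "x \<in> t" "x \<in> u" for t u x
    using norm[of t "fst x" "snd x"] norm[of u "fst x" "snd x"] that by simp
qed

lemma inj_\<beta>: "inj_on (\<beta> e') (box_points (colour N e'))"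
  by (auto simp: inj_on_def box_to_edge_def box_points_def split: if_splits)

lemma \<beta>_image: "\<beta> e' ` box_points (colour N e') = ({e'} \<times> UNIV) \<times> {..<colour N e'}"
proof
  show "\<beta> e' ` box_points (colour N e') \<subseteq> ({e'} \<times> UNIV) \<times> {..<colour N e'}"
    by (auto simp: box_to_edge_def box_points_def)
  show "({e'} \<times> UNIV) \<times> {..<colour N e'} \<subseteq> \<beta> e' ` box_points (colour N e')"
  proof
    fix x :: "('e \<times> bool) \<times> nat" assume "x \<in> ({e'} \<times> UNIV) \<times> {..<colour N e'}"
    then obtain t k where x: "x = ((e', t), k)" "k < colour N e'" by auto
    then have "x = \<beta> e' (t, if t then colour N e' - 1 - k else k)" by (simp add: box_to_edge_def)
    then show "x \<in> \<beta> e' ` box_points (colour N e')" using x by (intro image_eqI) auto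
  qed
qed

lemma \<beta>_points: "e' \<in> edges N \<Longrightarrow> p \<in> box_points (colour N e') \<Longrightarrow> \<beta> e' p \<in> points N"
  by (auto simp: box_to_edge_def points_def darts_def dcol_def box_points_def)

lemma edge_matching:
  "e' \<in> edges N - {e} \<Longrightarrow> perfect_matching_on (\<beta> e' ` box_points (colour N e')) ((`) (\<beta> e') ` s e')"
  by (intro perfect_matching_image tl_diagramsD(1) state inj_\<beta>)

lemma edges_matching:
  "perfect_matching_on (\<Union>e'\<in>edges N - {e}. \<beta> e' ` box_points (colour N e'))
     (\<Union>e'\<in>edges N - {e}. (`) (\<beta> e') ` s e')"
proof (rule perfect_matching_UN)
  show "i = j" if "x \<in> \<beta> i ` box_points (colour N i)" "x \<in> \<beta> j ` box_points (colour N j)" for i j x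
    using that unfolding \<beta>_image by auto
qed (rule edge_matching)

lemma points_split: "points N = \<beta> e ` box_points (colour N e) \<union> (\<Union>e'\<in>edges N - {e}. \<beta> e' ` box_points (colour N e'))"
  unfolding \<beta>_image points_def darts_def dcol_def using eN by fastforce

lemma points_cut: "points N - (\<Union>e'\<in>edges N - {e}. \<beta> e' ` box_points (colour N e')) \<union>
    ((\<Union>e'\<in>edges N - {e}. \<beta> e' ` box_points (colour N e')) - points N) = \<beta> e ` box_points (colour N e)"
proof -
  have "\<beta> e ` box_points (colour N e) \<inter> (\<Union>e'\<in>edges N - {e}. \<beta> e' ` box_points (colour N e')) = {}"
    unfolding \<beta>_image by auto
  moreover have "A = B \<union> U \<Longrightarrow> B \<inter> U = {} \<Longrightarrow> A - U \<union> (U - A) = B" for A B U :: "(('e \<times> bool) \<times> nat) set"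
    by auto
  ultimately show ?thesis using points_split by simp
qed

lemma R_sub: "R \<subseteq> points N \<times> points N"
proof (rule strand_rel_sub)
  show "\<Union> (cut_strands N e s) \<subseteq> points N"
    unfolding cut_strands_def using perfect_matching_onD(1)[OF vertex_matching] perfect_matching_onD(1)[OF edges_matching]
      points_split by blast
qed

text \<open>Vertex strands cover every point, edge strands all but the points at the ends of
  \<open>e\<close>. The points covered only once are therefore those of the cut box, and
  \<open>two_matchings_card\<close> applies.\<close>

lemma two: "x \<in> box_points (colour N e) \<Longrightarrow> card {y \<in> box_points (colour N e). linked R (\<beta> e x) (\<beta> e y)} = 2"
proof -
  assume x: "x \<in> box_points (colour N e)"
  have fin: "finite (\<Union>e'\<in>edges N - {e}. \<beta> e' ` box_points (colour N e'))" using fE by auto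
  have "card {y \<in> \<beta> e ` box_points (colour N e). linked R (\<beta> e x) y} = 2"
    using two_matchings_card[OF vertex_matching edges_matching fP fin, of "\<beta> e x"] x
    unfolding points_cut cut_strands_def by blast
  moreover have "{y \<in> \<beta> e ` box_points (colour N e). linked R (\<beta> e x) y} =
      \<beta> e ` {y \<in> box_points (colour N e). linked R (\<beta> e x) (\<beta> e y)}" by auto
  moreover have "inj_on (\<beta> e) {y \<in> box_points (colour N e). linked R (\<beta> e x) (\<beta> e y)}"
    by (rule inj_on_subset[OF inj_\<beta>]) auto
  ultimately show ?thesis by (simp add: card_image)
qed

end

text \<open>\<open>\<Gamma>\<close> is a strand of the cut network. Its mod 2 homology class is a boundary by planarity, so the
  complementary regions of \<open>\<Gamma>\<close> can be coloured with two colours.\<close>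

locale cut_network_strand = cut_network N e s for N :: "('e, 'z) network_scheme" and e s +
  fixes \<Gamma> :: "(('e \<times> bool) \<times> nat) set"
  assumes \<Gamma>_closed: "\<And>a b. {a, b} \<in> cut_strands N e s \<Longrightarrow> a \<in> \<Gamma> \<Longrightarrow> b \<in> \<Gamma>"
    and \<Gamma>_even: "even (card {p \<in> box_points (colour N e). \<beta> e p \<in> \<Gamma>})"
begin

definition row where "row d k = card {j. j < k \<and> (d, j) \<in> \<Gamma>}"

text \<open>The homology class of \<open>\<Gamma>\<close> modulo 2, as the set of edges along which
  it runs an odd number of times.\<close>

definition w where "w = {d \<in> darts N. odd (row d (m d))}"

lemma closed_iff: "{a, b} \<in> cut_strands N e s \<Longrightarrow> a \<in> \<Gamma> \<longleftrightarrow> b \<in> \<Gamma>"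
  using \<Gamma>_closed[of a b] \<Gamma>_closed[of b a] by (auto simp: insert_commute)

lemma vertex_closed: "d \<in> darts N \<Longrightarrow> k < l d \<Longrightarrow> (d, m d - 1 - k) \<in> \<Gamma> \<longleftrightarrow> (\<rho> d, k) \<in> \<Gamma>"
  by (rule closed_iff) (auto simp: cut_strands_def vertex_strands_eq)

text \<open>The last \<open>k\<close> points at \<open>d\<close> are joined in reverse order to the
  first \<open>k\<close> points at \<open>\<rho> d\<close>, so \<open>\<Gamma>\<close> meets both
  groups equally often.\<close>

lemma row_tail:
  assumes d: "d \<in> darts N" and k: "k \<le> l d"
  shows "row d (m d) = row d (m d - k) + row (\<rho> d) k"
proof -
  have "{j. j < m d \<and> (d, j) \<in> \<Gamma>} = {j. j < m d - k \<and> (d, j) \<in> \<Gamma>} \<union> (\<lambda>j. m d - 1 - j) ` {j. j < k \<and> (\<rho> d, j) \<in> \<Gamma>}"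
  proof (intro equalityI subsetI)
    fix j assume j: "j \<in> {j. j < m d \<and> (d, j) \<in> \<Gamma>}"
    show "j \<in> {j. j < m d - k \<and> (d, j) \<in> \<Gamma>} \<union> (\<lambda>j. m d - 1 - j) ` {j. j < k \<and> (\<rho> d, j) \<in> \<Gamma>}"
    proof (cases "j < m d - k")
      case False
      then have "m d - 1 - j < k" using j by auto
      moreover have "m d - 1 - (m d - 1 - j) = j" using j by auto
      ultimately have "(\<rho> d, m d - 1 - j) \<in> \<Gamma>" using vertex_closed[OF d, of "m d - 1 - j"] j k by auto
      then show ?thesis using \<open>m d - 1 - j < k\<close> \<open>m d - 1 - (m d - 1 - j) = j\<close>
        by (intro UnI2 image_eqI[of _ _ "m d - 1 - j"]) auto
    qed (use j in auto)
  next
    fix j assume "j \<in> {j. j < m d - k \<and> (d, j) \<in> \<Gamma>} \<union> (\<lambda>j. m d - 1 - j) ` {j. j < k \<and> (\<rho> d, j) \<in> \<Gamma>}"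
    then show "j \<in> {j. j < m d \<and> (d, j) \<in> \<Gamma>}"
      using vertex_closed[OF d] k l_le(1)[OF d] by fastforce
  qed
  moreover have "card ((\<lambda>j. m d - 1 - j) ` {j. j < k \<and> (\<rho> d, j) \<in> \<Gamma>}) = card {j. j < k \<and> (\<rho> d, j) \<in> \<Gamma>}"
    using k l_le(1)[OF d] by (intro card_image) (auto simp: inj_on_def)
  moreover have "card ({j. j < m d - k \<and> (d, j) \<in> \<Gamma>} \<union> (\<lambda>j. m d - 1 - j) ` {j. j < k \<and> (\<rho> d, j) \<in> \<Gamma>}) =
      card {j. j < m d - k \<and> (d, j) \<in> \<Gamma>} + card ((\<lambda>j. m d - 1 - j) ` {j. j < k \<and> (\<rho> d, j) \<in> \<Gamma>})"
    using k l_le(1)[OF d] by (intro card_Un_disjoint) auto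
  ultimately show ?thesis unfolding row_def by simp
qed

lemma box_card:
  assumes "A \<subseteq> box_points c"
  shows "card A = card {k. (False, k) \<in> A} + card {k. (True, k) \<in> A}"
proof -
  have A: "A = Pair False ` {k. (False, k) \<in> A} \<union> Pair True ` {k. (True, k) \<in> A}"
  proof (intro equalityI subsetI)
    fix x assume "x \<in> A"
    then show "x \<in> Pair False ` {k. (False, k) \<in> A} \<union> Pair True ` {k. (True, k) \<in> A}"
      by (cases x; cases "fst x") auto
  qed auto
  have "finite {k. (t, k) \<in> A}" for t
    by (rule finite_subset[of _ "{..<c}"]) (use assms in \<open>auto simp: box_points_def\<close>)
  then have "card (Pair False ` {k. (False, k) \<in> A} \<union> Pair True ` {k. (True, k) \<in> A}) =
      card (Pair False ` {k. (False, k) \<in> A}) + card (Pair True ` {k. (True, k) \<in> A})"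
    by (intro card_Un_disjoint) auto
  then show ?thesis using A by (simp add: card_image inj_on_def)
qed

lemma row_reverse:
  assumes "k \<le> c"
  shows "card {i. c - k \<le> i \<and> i < c \<and> (d, c - 1 - i) \<in> \<Gamma>} = row d k"
  unfolding row_def using assms
  by (intro bij_betw_same_card[of "\<lambda>i. c - 1 - i"] bij_betwI[where g = "\<lambda>i. c - 1 - i"]) auto

lemma edge_even:
  assumes "e' \<in> edges N"
  shows "even (card {p \<in> box_points (colour N e'). \<beta> e' p \<in> \<Gamma>})"
proof (cases "e' = e")
  case False
  then have e': "e' \<in> edges N - {e}" using assms by simp
  have "even (card (\<beta> e' ` box_points (colour N e') \<inter> \<Gamma>))"
  proof (rule even_card_closed[OF edge_matching[OF e']])
    show "b \<in> \<Gamma>" if "{a, b} \<in> (`) (\<beta> e') ` s e'" "a \<in> \<Gamma>" for a b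
      using that e' by (intro \<Gamma>_closed[of a b]) (auto simp: cut_strands_def)
  qed simp
  moreover have "\<beta> e' ` box_points (colour N e') \<inter> \<Gamma> = \<beta> e' ` {p \<in> box_points (colour N e'). \<beta> e' p \<in> \<Gamma>}" by auto
  moreover have "inj_on (\<beta> e') {p \<in> box_points (colour N e'). \<beta> e' p \<in> \<Gamma>}"
    by (rule inj_on_subset[OF inj_\<beta>]) auto
  ultimately show ?thesis by (simp add: card_image)
qed (use \<Gamma>_even in simp)

lemma edge_card: "card {p \<in> box_points (colour N e'). \<beta> e' p \<in> \<Gamma>} =
    row (e', False) (colour N e') + row (e', True) (colour N e')"
proof -
  have "card {k. (False, k) \<in> {p \<in> box_points (colour N e'). \<beta> e' p \<in> \<Gamma>}} = row (e', False) (colour N e')"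
    unfolding row_def by (auto simp: box_to_edge_def)
  moreover have "card {k. (True, k) \<in> {p \<in> box_points (colour N e'). \<beta> e' p \<in> \<Gamma>}} = row (e', True) (colour N e')"
    using row_reverse[of "colour N e'" "colour N e'" "(e', True)"] by (auto simp: box_to_edge_def)
  ultimately show ?thesis by (subst box_card[of _ "colour N e'"]) auto
qed

text \<open>\<open>\<Gamma>\<close> meets each box an even number of times, so its parities at the
  two ends of an edge agree and \<open>w\<close> consists of whole edges.\<close>

lemma w_edge: "e' \<in> edges N \<Longrightarrow> (e', t) \<in> w \<longleftrightarrow> odd (row (e', False) (colour N e'))"
  using edge_even[of e'] unfolding edge_card by (cases t) (auto simp: w_def darts_def dcol_def)

text \<open>The cycle condition. Modulo 2, the count at \<open>d\<close> is the number of strands of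
  \<open>\<Gamma>\<close> that turn from \<open>d\<close> to the next end plus the number that
  arrive from the previous end, so each corner of a vertex is counted twice.\<close>

lemma w_vertex:
  assumes y: "y \<subseteq> darts N" "\<And>d. d \<in> darts N \<Longrightarrow> \<rho> d \<in> y \<longleftrightarrow> d \<in> y"
  shows "even (card (w \<inter> y))"
proof -
  define \<Lambda> where "\<Lambda> = {d \<in> darts N. odd (row (\<rho> d) (l d))}"
  have w\<Lambda>: "d \<in> w \<longleftrightarrow> (d \<in> \<Lambda>) \<noteq> (\<rho> (\<rho> d) \<in> \<Lambda>)" if d: "d \<in> darts N" for d
  proof -
    have "m d - l d = l (\<rho> (\<rho> d))" using l_sum[OF d] by simp
    then show ?thesis using row_tail[OF d order_refl] d by (auto simp: w_def \<Lambda>_def)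
  qed
  let ?B = "{d \<in> darts N. \<rho> (\<rho> d) \<in> \<Lambda> \<inter> y}"
  have yy: "\<rho> (\<rho> d) \<in> y \<longleftrightarrow> d \<in> y" if "d \<in> darts N" for d using y(2) that by simp
  have eq: "w \<inter> y = sym_diff (\<Lambda> \<inter> y) ?B"
  proof (rule set_eqI)
    fix d
    show "d \<in> w \<inter> y \<longleftrightarrow> d \<in> sym_diff (\<Lambda> \<inter> y) ?B"
    proof (cases "d \<in> darts N")
      case True
      then show ?thesis using w\<Lambda>[OF True] yy[OF True] by blast
    qed (use y(1) in auto)
  qed
  have "bij_betw \<rho> (\<Lambda> \<inter> y) ?B"
  proof (rule bij_betwI[where g = "\<lambda>d. \<rho> (\<rho> d)"])
    show "\<rho> \<in> \<Lambda> \<inter> y \<rightarrow> ?B"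
    proof
      fix d assume d: "d \<in> \<Lambda> \<inter> y"
      then have "d \<in> darts N" by (auto simp: \<Lambda>_def)
      then show "\<rho> d \<in> ?B" using d by simp
    qed
    show "\<rho> (\<rho> (\<rho> d)) = d" if "d \<in> \<Lambda> \<inter> y" for d using that by (auto simp: \<Lambda>_def)
  qed auto
  then have "card (\<Lambda> \<inter> y) = card ?B" by (rule bij_betw_same_card)
  moreover have "finite (\<Lambda> \<inter> y)" "finite ?B" using fX by (auto simp: \<Lambda>_def)
  ultimately show ?thesis unfolding eq by (subst card_sym_diff_parity) auto
qed

text \<open>The face colouring gives the colour of the region just before the first point at each
  end, and each point of \<open>\<Gamma>\<close> passed counterclockwise flips it. The two
  properties of the face colouring express consistency along edges and around vertices. On the
  boundary of the cut box, equality of colours is equality of the parities required by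
  \<open>induced_diagram\<close>.\<close>

lemma region_colouring:
  obtains \<chi> :: "('e \<times> bool) \<times> nat \<Rightarrow> bool"
  where "\<And>a b. {a, b} \<in> cut_strands N e s \<Longrightarrow> a \<notin> \<Gamma> \<Longrightarrow> \<chi> a = \<chi> b"
    and "\<And>u v. u \<in> box_points (colour N e) \<Longrightarrow> v \<in> box_points (colour N e) \<Longrightarrow> \<beta> e u \<notin> \<Gamma> \<Longrightarrow> \<beta> e v \<notin> \<Gamma> \<Longrightarrow>
      \<chi> (\<beta> e u) = \<chi> (\<beta> e v) \<Longrightarrow>
      even (card {r \<in> box_points (colour N e) \<inter> {p. \<beta> e p \<in> \<Gamma>}. box_pos (colour N e) r < box_pos (colour N e) u}) \<longleftrightarrow>
      even (card {r \<in> box_points (colour N e) \<inter> {p. \<beta> e p \<in> \<Gamma>}. box_pos (colour N e) r < box_pos (colour N e) v})"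
proof -
  have w_sub: "w \<subseteq> darts N" by (auto simp: w_def)
  have w_other: "d \<in> w \<longleftrightarrow> other_end d \<in> w" if "d \<in> darts N" for d
    using that w_edge[of "fst d" "snd d"] w_edge[of "fst d" "\<not> snd d"] by (simp add: other_end_def darts_def mem_Times_iff)
  show thesis
  proof (rule planar_face_colouring[OF tri pl w_sub w_other w_vertex])
    fix \<phi>
    assume \<phi>: "\<And>d. d \<in> darts N \<Longrightarrow> \<rho> (other_end d) \<in> \<phi> \<longleftrightarrow> d \<in> \<phi>"
      "\<And>d. d \<in> darts N \<Longrightarrow> \<rho> d \<in> \<phi> \<longleftrightarrow> (d \<in> \<phi> \<longleftrightarrow> d \<notin> w)"
    define \<chi> where "\<chi> = (\<lambda>(d, k). (d \<in> \<phi>) = even (row d k))"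
    have box: "\<chi> (\<beta> e' p) = (((e', False) \<in> \<phi>) =
        even (card {r \<in> box_points (colour N e') \<inter> {p. \<beta> e' p \<in> \<Gamma>}. box_pos (colour N e') r < box_pos (colour N e') p}))"
      if e': "e' \<in> edges N" and p: "p \<in> box_points (colour N e')" "\<beta> e' p \<notin> \<Gamma>" for e' p
    proof -
      let ?c = "colour N e'"
      let ?A = "{r \<in> box_points ?c \<inter> {p. \<beta> e' p \<in> \<Gamma>}. box_pos ?c r < box_pos ?c p}"
      obtain t i where ti: "p = (t, i)" "i < ?c" using p(1) by (cases p) auto
      have "?A \<subseteq> box_points ?c" by auto
      note A = box_card[OF this]
      show ?thesis
      proof (cases t)
        case False
        have "{k. (False, k) \<in> ?A} = {j. j < i \<and> ((e', False), j) \<in> \<Gamma>}"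
          using ti False by (auto simp: box_to_edge_def)
        moreover have "{k. (True, k) \<in> ?A} = {}" using ti False by auto
        ultimately have "card ?A = row (e', False) i" using A by (simp add: row_def)
        then show ?thesis using ti False by (simp add: \<chi>_def box_to_edge_def)
      next
        case True
        have "{k. (False, k) \<in> ?A} = {j. j < ?c \<and> ((e', False), j) \<in> \<Gamma>}"
          using ti True by (auto simp: box_to_edge_def)
        moreover have "{k. (True, k) \<in> ?A} = {k. ?c - (?c - 1 - i) \<le> k \<and> k < ?c \<and> ((e', True), ?c - 1 - k) \<in> \<Gamma>}"
          using ti True by (auto simp: box_to_edge_def)
        ultimately have "card ?A = row (e', False) ?c + row (e', True) (?c - 1 - i)"
          using A row_reverse[of "?c - 1 - i" ?c "(e', True)"] by (simp add: row_def)
        moreover have d: "(e', True) \<in> darts N" "(e', False) \<in> darts N" using e' by (auto simp: darts_def)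
        \<comment> \<open>The numberings at the two ends run in opposite directions, so the region
          before the first point at the end \<open>True\<close> is the region after the last point
          at the end \<open>False\<close>.\<close>
        have "(e', True) \<in> \<phi> \<longleftrightarrow> ((e', False) \<in> \<phi>) = even (row (e', False) ?c)"
          using \<phi>(1)[OF d(1)] \<phi>(2)[OF d(2)] w_edge[OF e', of False] by (simp add: other_end_def)
        ultimately show ?thesis using ti True by (auto simp: \<chi>_def box_to_edge_def)
      qed
    qed
    have strand: "\<chi> a = \<chi> b" if ab: "{a, b} \<in> cut_strands N e s" "a \<notin> \<Gamma>" for a b
    proof -
      from ab(1) consider "{a, b} \<in> vertex_strands N" | e' where "e' \<in> edges N - {e}" "{a, b} \<in> (`) (\<beta> e') ` s e'"
        unfolding cut_strands_def by blast
      then show ?thesis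
      proof cases
        case 1
        then obtain d k where dk: "{a, b} = {(d, m d - 1 - k), (\<rho> d, k)}" "d \<in> darts N" "k < l d"
          unfolding vertex_strands_eq by blast
        have nb: "b \<notin> \<Gamma>" using closed_iff[OF ab(1)] ab(2) by simp
        then have n: "(d, m d - 1 - k) \<notin> \<Gamma>" "(\<rho> d, k) \<notin> \<Gamma>" using dk(1) ab(2) by (auto simp: doubleton_eq_iff)
        have "Suc (m d - 1 - k) = m d - k" using dk(3) l_le(1)[OF dk(2)] by linarith
        \<comment> \<open>The end of the strand is not on \<open>\<Gamma>\<close>, so passing it
          leaves the count unchanged; this bridges the off-by-one between the position of that end
          and \<open>row_tail\<close>.\<close>
        moreover have "row d (Suc j) = row d j" if "(d, j) \<notin> \<Gamma>" for j
          unfolding row_def using that by (intro arg_cong[where f = card]) (auto simp: less_Suc_eq)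
        ultimately have "row d (m d - k) = row d (m d - 1 - k)" using n(1) by metis
        then have "row d (m d) = row d (m d - 1 - k) + row (\<rho> d) k" using row_tail[OF dk(2), of k] dk(3) by simp
        then have "\<chi> (d, m d - 1 - k) = \<chi> (\<rho> d, k)"
          using \<phi>(2)[OF dk(2)] dk(2) by (auto simp: \<chi>_def w_def)
        then show ?thesis using dk(1) by (auto simp: doubleton_eq_iff)
      next
        case 2
        then have e': "e' \<in> edges N" by simp
        let ?\<Gamma>' = "{p. \<beta> e' p \<in> \<Gamma>}"
        obtain t where t: "t \<in> s e'" "{a, b} = \<beta> e' ` t" using 2 by auto
        have D: "s e' \<in> tl_diagrams (colour N e')" by (rule state[OF 2(1)])
        obtain p' q' where pq': "t = {p', q'}" using perfect_matching_onD(2)[OF tl_diagramsD(1)[OF D] t(1)] by (auto simp: card_2_iff)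
        then have "a = \<beta> e' p' \<and> b = \<beta> e' q' \<or> a = \<beta> e' q' \<and> b = \<beta> e' p'"
          using t(2) by (simp add: doubleton_eq_iff)
        moreover have "t = {q', p'}" using pq' by (simp add: insert_commute)
        ultimately obtain p q where pq: "t = {p, q}" "a = \<beta> e' p" "b = \<beta> e' q"
          using pq' by metis
        have bp: "p \<in> box_points (colour N e')" "q \<in> box_points (colour N e')" using tl_diagrams_in[OF D] t pq by auto
        have cl: "v \<in> ?\<Gamma>'" if "{u, v} \<in> s e'" "u \<in> ?\<Gamma>'" for u v
        proof -
          have "\<beta> e' ` {u, v} \<in> cut_strands N e s" unfolding cut_strands_def using that(1) 2(1) by blast
          then show ?thesis using closed_iff[of "\<beta> e' u" "\<beta> e' v"] that(2) by simp
        qed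
        have "even (card {r \<in> box_points (colour N e') \<inter> ?\<Gamma>'. box_pos (colour N e') r < box_pos (colour N e') p}) \<longleftrightarrow>
            even (card {r \<in> box_points (colour N e') \<inter> ?\<Gamma>'. box_pos (colour N e') r < box_pos (colour N e') q})"
        proof (rule tl_parity[OF D])
          show "v \<in> ?\<Gamma>'" if "{u, v} \<in> s e'" "u \<in> ?\<Gamma>'" for u v by (rule cl[OF that])
        qed (use t pq ab(2) in auto)
        moreover have "b \<notin> \<Gamma>" using closed_iff[OF ab(1)] ab(2) by simp
        ultimately show ?thesis
          using box[OF e' bp(1)] box[OF e' bp(2)] pq ab(2) by simp
      qed
    qed
    show ?thesis
    proof (rule that[of \<chi>])
      show "\<chi> a = \<chi> b" if "{a, b} \<in> cut_strands N e s" "a \<notin> \<Gamma>" for a b by (rule strand[OF that])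
      fix u v assume *: "u \<in> box_points (colour N e)" "v \<in> box_points (colour N e)" "\<beta> e u \<notin> \<Gamma>" "\<beta> e v \<notin> \<Gamma>"
        "\<chi> (\<beta> e u) = \<chi> (\<beta> e v)"
      show "even (card {r \<in> box_points (colour N e) \<inter> {p. \<beta> e p \<in> \<Gamma>}. box_pos (colour N e) r < box_pos (colour N e) u}) \<longleftrightarrow>
        even (card {r \<in> box_points (colour N e) \<inter> {p. \<beta> e p \<in> \<Gamma>}. box_pos (colour N e) r < box_pos (colour N e) v})"
        using *(5) unfolding box[OF eN *(1,3)] box[OF eN *(2,4)] by blast
    qed
  qed
qed

end

text \<open>\<open>K\<close> is the diagram that the outside of a cut edge presents to its box.
  Circles that do not reach the box remain in \<open>P\<close> and \<open>R\<close> and are counted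
  there.\<close>

definition matched :: "nat \<Rightarrow> 'a set \<Rightarrow> ('a \<times> 'a) set \<Rightarrow> (bool \<times> nat \<Rightarrow> 'a) \<Rightarrow> tl_diagram \<Rightarrow> bool" where
  "matched c P R \<beta> K \<longleftrightarrow> K \<in> tl_diagrams c \<and> finite P \<and> R \<subseteq> P \<times> P \<and> \<beta> ` box_points c \<subseteq> P \<and>
     (\<forall>x\<in>box_points c. \<forall>y\<in>box_points c. linked R (\<beta> x) (\<beta> y) \<longleftrightarrow> x = y \<or> {x, y} \<in> K)"

context cut_network
begin

text \<open>Let \<open>\<Gamma>\<close> be the strand through \<open>x\<close>. Any other strand
  stays off \<open>\<Gamma>\<close>, hence keeps its region colour from one end to the other, and
  this is the parity condition of \<open>induced_diagram\<close>.\<close>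

lemma cut_matched: "\<exists>K. matched (colour N e) (points N) R (\<beta> e) K"
proof -
  let ?c = "colour N e"
  let ?Q = "\<lambda>x y. linked R (\<beta> e x) (\<beta> e y)"
  let ?K = "{{x, y} | x y. x \<in> box_points ?c \<and> y \<in> box_points ?c \<and> x \<noteq> y \<and> ?Q x y}"
  have "?K \<in> tl_diagrams ?c"
  proof (rule induced_diagram)
    show "card {y \<in> box_points ?c. ?Q x y} = 2" if "x \<in> box_points ?c" for x by (rule two[OF that])
    fix x u v
    assume x: "x \<in> box_points ?c" and u: "u \<in> box_points ?c" and v: "v \<in> box_points ?c"
      and uv: "?Q u v" and xu: "\<not> ?Q x u"
    define \<Gamma> where "\<Gamma> = {y. linked R (\<beta> e x) y}"
    interpret cut_network_strand N e s \<Gamma>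
    proof
      show "b \<in> \<Gamma>" if "{a, b} \<in> cut_strands N e s" "a \<in> \<Gamma>" for a b
        using that linked_base[of a b R] linked_trans[of R "\<beta> e x" a b] by (simp add: \<Gamma>_def)
      show "even (card {p \<in> box_points ?c. \<beta> e p \<in> \<Gamma>})" using two[OF x] by (simp add: \<Gamma>_def)
    qed
    show "even (card {r \<in> box_points ?c \<inter> {y. ?Q x y}. box_pos ?c r < box_pos ?c u}) \<longleftrightarrow>
        even (card {r \<in> box_points ?c \<inter> {y. ?Q x y}. box_pos ?c r < box_pos ?c v})"
    proof (rule region_colouring)
      fix \<chi> :: "('e \<times> bool) \<times> nat \<Rightarrow> bool"
      assume \<chi>: "\<And>a b. {a, b} \<in> cut_strands N e s \<Longrightarrow> a \<notin> \<Gamma> \<Longrightarrow> \<chi> a = \<chi> b"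
        "\<And>u v. u \<in> box_points ?c \<Longrightarrow> v \<in> box_points ?c \<Longrightarrow> \<beta> e u \<notin> \<Gamma> \<Longrightarrow> \<beta> e v \<notin> \<Gamma> \<Longrightarrow> \<chi> (\<beta> e u) = \<chi> (\<beta> e v) \<Longrightarrow>
          even (card {r \<in> box_points ?c \<inter> {p. \<beta> e p \<in> \<Gamma>}. box_pos ?c r < box_pos ?c u}) \<longleftrightarrow>
          even (card {r \<in> box_points ?c \<inter> {p. \<beta> e p \<in> \<Gamma>}. box_pos ?c r < box_pos ?c v})"
      from uv have "\<chi> (\<beta> e v) = \<chi> (\<beta> e u) \<and> \<beta> e v \<notin> \<Gamma>"
      proof (induction rule: linked_induct)
        case refl
        then show ?case using xu by (simp add: \<Gamma>_def)
      next
        case (step y z)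
        then have yz: "{y, z} \<in> cut_strands N e s" by (auto simp: insert_commute)
        then show ?case using \<chi>(1)[OF yz] closed_iff[OF yz] step.IH by simp
      qed
      then have "even (card {r \<in> box_points ?c \<inter> {p. \<beta> e p \<in> \<Gamma>}. box_pos ?c r < box_pos ?c u}) \<longleftrightarrow>
          even (card {r \<in> box_points ?c \<inter> {p. \<beta> e p \<in> \<Gamma>}. box_pos ?c r < box_pos ?c v})"
        using \<chi>(2)[OF u v] xu by (simp add: \<Gamma>_def)
      then show "even (card {r \<in> box_points ?c \<inter> {y. ?Q x y}. box_pos ?c r < box_pos ?c u}) \<longleftrightarrow>
          even (card {r \<in> box_points ?c \<inter> {y. ?Q x y}. box_pos ?c r < box_pos ?c v})"
        by (simp add: \<Gamma>_def)
    qed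
  qed (rule linked_refl, erule linked_sym, erule (1) linked_trans)
  moreover have "{x, y} \<in> ?K \<longleftrightarrow> x \<noteq> y \<and> ?Q x y" if xy: "x \<in> box_points ?c" "y \<in> box_points ?c" for x y
  proof
    assume "{x, y} \<in> ?K"
    then obtain x' y' where "{x, y} = {x', y'}" "x' \<noteq> y'" "?Q x' y'" by blast
    then show "x \<noteq> y \<and> ?Q x y" using linked_sym by (fastforce simp: doubleton_eq_iff)
  qed (use xy in blast)
  ultimately have "matched ?c (points N) R (\<beta> e) ?K"
    unfolding matched_def using fP R_sub \<beta>_points[OF eN] by auto
  then show ?thesis by blast
qed

end

section \<open>Expansion into Laurent series and tails\<close>

abbreviation fls_of_poly :: "rat poly \<Rightarrow> rat fls" where
  "fls_of_poly p \<equiv> fps_to_fls (fps_of_poly p)"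

text \<open>\<open>expand\<close> is defined through the normalised fraction; cross-multiplication
  shows that every representative gives the same Laurent series.\<close>

lemma expand_Fract:
  assumes "b \<noteq> 0"
  shows "expand (Fract a b) = fls_of_poly a / fls_of_poly b"
proof -
  let ?q = "quot_of_fract (Fract a b)"
  have n: "snd ?q \<noteq> 0" by simp
  have "Fract (fst ?q) (snd ?q) = Fract a b"
    using quot_to_fract_quot_of_fract[of "Fract a b"] by (simp only: quot_to_fract_def case_prod_beta)
  then have "fst ?q * b = a * snd ?q" by (rule iffD1[OF eq_fract(1)[OF n assms]])
  then have "fls_of_poly (fst ?q) * fls_of_poly b = fls_of_poly a * fls_of_poly (snd ?q)"
    by (simp add: fls_times_fps_to_fls[symmetric] fps_of_poly_mult[symmetric] del: fps_of_poly_mult)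
  then show ?thesis using n assms unfolding expand_def by (simp add: frac_eq_eq)
qed

lemma expand_mult: "expand (x * y) = expand x * expand y"
proof (cases x, cases y)
  fix a b c d :: "rat poly" assume "x = Fract a b" "b \<noteq> 0" "y = Fract c d" "d \<noteq> 0"
  then show ?thesis by (simp add: expand_Fract fps_of_poly_mult fls_times_fps_to_fls)
qed

lemma expand_poly: "expand (Fract p 1) = fls_of_poly p"
  by (simp add: expand_Fract)

lemma q_series_mult: "q_series (S * T) = q_series S * q_series T"
  by (simp add: q_series_def fps_compose_mult_distrib fls_times_fps_to_fls)

lemma q_series_1 [simp]: "q_series 1 = 1"
  by (simp add: q_series_def)

lemma q_series_1_minus_X_power: "q_series (1 - fps_X ^ k) = 1 - fls_X ^ (4 * k)"
proof -
  have "fps_compose (fps_X ^ k) (fps_X ^ 4 :: rat fps) = fps_X ^ (4 * k)"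
    by (simp add: fps_compose_power[symmetric] power_mult)
  then show ?thesis
    by (simp add: q_series_def fps_compose_sub_distrib fps_to_fls_power)
qed

lemma int_q_series_mult: "int_q_series (S * T) = int_q_series S * int_q_series T"
  unfolding int_q_series_def q_series_mult[symmetric]
  by (rule arg_cong[where f = q_series]) (auto simp: fps_eq_iff fps_mult_nth)

lemma int_q_series_1_minus_X: "int_q_series (1 - fps_X) = q_series (1 - fps_X)"
  unfolding int_q_series_def
  by (rule arg_cong[where f = q_series]) (auto simp: fps_eq_iff)

text \<open>The closed form with q^(c+1), cleared of denominators: apart from \<open>Delta c\<close>
  all factors are polynomials in A, so that expansion into Laurent series can proceed factor by
  factor.\<close>

lemma Delta_poly: "Delta c * varA ^ (2 * c) * (1 - varA ^ 4) = (-1) ^ c * (1 - varA ^ (4 * Suc c))"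
proof -
  define u w where "u = varA ^ 2" and "w = inverse varA ^ 2"
  have uw: "u * w = 1" by (simp add: u_def w_def power_inverse)
  have "4 * Suc c = 2 * Suc c + 2 * Suc c" "(4 :: nat) = 2 + 2" by simp_all
  then have p: "varA ^ (2 * c) = u ^ c" "varA ^ 4 = u * u" "varA ^ (4 * Suc c) = u ^ Suc c * u ^ Suc c"
    unfolding u_def by (simp_all only: power_mult power_add)
  have "Delta c * u ^ c * (u * u - 1) = Delta c * (u - w) * u ^ Suc c"
    using uw by (simp add: algebra_simps)
  also have "\<dots> = (-1) ^ c * (u ^ Suc c - w ^ Suc c) * u ^ Suc c"
    using Delta_eq[of c] by (simp add: u_def w_def)
  also have "\<dots> = (-1) ^ c * (u ^ Suc c * u ^ Suc c - (u * w) ^ Suc c)"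
    unfolding power_mult_distrib by (simp only: left_diff_distrib right_diff_distrib mult_ac)
  finally have "- (Delta c * u ^ c * (u * u - 1)) = - ((-1) ^ c * (u ^ Suc c * u ^ Suc c - 1))"
    unfolding uw by simp
  then show ?thesis unfolding p by (simp only: mult_minus_right[symmetric] minus_diff_eq)
qed

lemma expand_Delta:
  "expand (Delta c) * fls_X ^ (2 * c) * q_series (1 - fps_X) = (-1) ^ c * q_series (1 - fps_X ^ Suc c)"
proof -
  have m: "1 - varA ^ k = Fract (1 - [:0, 1:] ^ k) 1" for k
    by (simp add: varA_power One_fract_def)
  have s: "(-1) ^ c * (1 - varA ^ (4 * Suc c)) = Fract ((-1) ^ c * (1 - [:0, 1:] ^ (4 * Suc c))) 1"
    unfolding m by (simp add: minus_one_power_iff del: mult_Suc_right power_Suc)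
  have "expand (Delta c) * (expand (Fract ([:0, 1:] ^ (2 * c)) 1) * expand (Fract (1 - [:0, 1:] ^ 4) 1)) =
      expand (Fract ((-1) ^ c * (1 - [:0, 1:] ^ (4 * Suc c))) 1)"
    using arg_cong[OF Delta_poly[of c], of expand] unfolding s m[of 4]
    by (simp only: expand_mult varA_power mult.assoc)
  moreover have X: "fls_of_poly ([:0, 1:] ^ k) = fls_X ^ k" for k
    by (simp add: fps_of_poly_power fps_of_poly_fps_X fps_to_fls_power)
  moreover have "fls_of_poly (1 - [:0, 1:] ^ k) = 1 - fls_X ^ k" for k
    using X[of k] by (simp add: fps_of_poly_diff del: fps_of_poly_power)
  moreover have "fls_of_poly ((-1) ^ c * (1 - [:0, 1:] ^ (4 * Suc c))) = (-1) ^ c * (1 - fls_X ^ (4 * Suc c))"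
  proof (cases "even c")
    case True
    then show ?thesis using \<open>\<And>k. fls_of_poly (1 - [:0, 1:] ^ k) = 1 - fls_X ^ k\<close>[of "4 * Suc c"] by simp
  next
    case False
    have "fls_of_poly (- p) = - fls_of_poly p" for p by (simp add: fps_of_poly_uminus)
    then show ?thesis using False \<open>\<And>k. fls_of_poly (1 - [:0, 1:] ^ k) = 1 - fls_X ^ k\<close>[of "4 * Suc c"]
      by (simp del: mult_Suc_right power_Suc minus_diff_eq)
  qed
  moreover have "q_series (1 - fps_X) = 1 - fls_X ^ 4"
    using q_series_1_minus_X_power[of 1] by simp
  ultimately show ?thesis
    unfolding q_series_1_minus_X_power expand_poly by (simp only: mult.assoc)
qed

lemma fps_mult_agree:
  fixes A B C D :: "'a :: comm_ring_1 fps"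
  assumes "\<And>j. j < n \<Longrightarrow> fps_nth A j = \<epsilon> * fps_nth B j" "\<And>j. j < n \<Longrightarrow> fps_nth C j = \<delta> * fps_nth D j" "j < n"
  shows "fps_nth (A * C) j = (\<epsilon> * \<delta>) * fps_nth (B * D) j"
  unfolding fps_mult_nth sum_distrib_left using assms by (intro sum.cong refl) (simp add: mult_ac)

text \<open>Solving for \<open>E\<close> means dividing by \<open>Delta c\<close>, which contributes
  (1 - q) / (1 - q^(c+1)) up to sign and a power of A. The geometric series 1 / (1 - q^(c+1)) has no
  term in degrees 1 to c and is invisible in the first \<open>n\<close> coefficients.\<close>

lemma agree_connected_sum:
  assumes E: "E * Delta c = P1 * P2" and cn: "n \<le> c"
    and T1: "agree_upto n (int_q_series T1) (expand P1)" and T2: "agree_upto n (int_q_series T2) (expand P2)"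
  shows "agree_upto n (expand E) (int_q_series ((1 - fps_X) * T1 * T2))"
proof -
  obtain S1 U1 \<epsilon>1 where 1: "normalised (int_q_series T1) S1" "normalised (expand P1) U1" "\<epsilon>1 \<in> {1, -1}"
    "\<And>j. j < n \<Longrightarrow> fps_nth S1 j = \<epsilon>1 * fps_nth U1 j" using T1 unfolding agree_upto_def by blast
  obtain S2 U2 \<epsilon>2 where 2: "normalised (int_q_series T2) S2" "normalised (expand P2) U2" "\<epsilon>2 \<in> {1, -1}"
    "\<And>j. j < n \<Longrightarrow> fps_nth S2 j = \<epsilon>2 * fps_nth U2 j" using T2 unfolding agree_upto_def by blast
  obtain k1 k2 l1 l2 where k: "fls_X_intpow k1 * int_q_series T1 = q_series S1" "fls_X_intpow k2 * int_q_series T2 = q_series S2"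
    and l: "fls_X_intpow l1 * expand P1 = q_series U1" "fls_X_intpow l2 * expand P2 = q_series U2"
    using 1(1,2) 2(1,2) unfolding normalised_def by blast
  define g :: "int \<Rightarrow> rat fls" where "g k = fls_X_intpow k" for k
  have gadd: "g (a + b) = g a * g b" for a b
    by (simp only: g_def fls_X_intpow_times_fls_X_intpow)
  have g0: "g a \<noteq> 0" for a unfolding g_def by (rule fls_X_intpow_nonzero)
  note k = k[folded g_def] and l = l[folded g_def]
  define W :: "rat fps" where "W = 1 - fps_X ^ Suc c"
  define V where "V = inverse W"
  have W0: "fps_nth W 0 = 1" by (simp add: W_def)
  have WV: "W * V = 1" unfolding V_def using W0 by (intro inverse_mult_eq_1') simp
  have V0: "fps_nth V 0 = 1" by (simp add: V_def W0)
  have Vj: "fps_nth V j = 1 * fps_nth 1 j" if "j < n" for j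
  proof -
    have "V = 1 + fps_X ^ Suc c * V" using WV by (simp add: W_def algebra_simps)
    then have "fps_nth V j = fps_nth 1 j + fps_nth (fps_X ^ Suc c * V) j" by (metis fps_add_nth)
    then show ?thesis using that cn by (simp only: fps_X_power_mult_nth) simp
  qed
  define s :: rat where "s = (-1) ^ c"
  \<comment> \<open>The normalised series of \<open>E\<close>, assembled from the sign of
    \<open>Delta c\<close>, the factor 1 - q, the geometric series \<open>V\<close> and the
    normalised series of both factors. The shift realising it is l1 + l2 - 2 c, where 2 c undoes the
    power of A in \<open>expand_Delta\<close>.\<close>
  define S where "S = fps_const s * (1 - fps_X) * V * (U1 * U2)"
  define T where "T = (1 - fps_X) * (S1 * S2)"
  have s: "s * s = 1" "s \<in> {1, -1}" by (auto simp: s_def power_mult_distrib[symmetric] minus_one_power_iff)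
  have qs: "q_series (fps_const s) = (-1) ^ c"
    by (auto simp: q_series_def s_def minus_one_power_iff fps_const_neg[symmetric] simp del: fps_const_neg)
  have "normalised (expand E) S"
    unfolding normalised_def
  proof
    show "S = 0 \<or> fps_nth S 0 \<noteq> 0"
    proof (cases "U1 = 0 \<or> U2 = 0")
      case False
      then have "fps_nth U1 0 \<noteq> 0" "fps_nth U2 0 \<noteq> 0" using 1(2) 2(2) unfolding normalised_def by auto
      then show ?thesis using V0 s by (auto simp: S_def)
    qed (auto simp: S_def)
    let ?D = "expand (Delta c)" and ?q = "q_series (1 - fps_X)"
    have "fls_X ^ (2 * c) = g (2 * int c)"
      using fls_X_intpow_power[of 1 "2 * c", where 'a = rat] by (simp add: g_def fls_X_conv_shift_1)
    then have ED: "?D * g (2 * int c) * ?q = q_series (fps_const s) * q_series W"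
      using expand_Delta[of c] unfolding W_def qs by simp
    have "expand E * ?D = expand P1 * expand P2" using E by (simp add: expand_mult[symmetric])
    then have "g (l1 + l2 + 2 * int c) * (expand E * ?D) * ?q =
        g (2 * int c) * ((g l1 * expand P1) * (g l2 * expand P2)) * ?q"
      by (simp only: gadd mult_ac)
    then have "g (l1 + l2) * expand E * (?D * g (2 * int c) * ?q) = (q_series U1 * q_series U2 * ?q) * g (2 * int c)"
      unfolding l by (simp only: gadd mult_ac)
    then have "g (l1 + l2) * expand E * (q_series (fps_const s) * q_series W) * q_series (fps_const s * V) =
        q_series U1 * q_series U2 * ?q * g (2 * int c) * q_series (fps_const s * V)" unfolding ED by (rule arg_cong)
    moreover have "q_series (fps_const s) * q_series W * q_series (fps_const s * V) = 1"
    proof -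
      have "fps_const s * W * (fps_const s * V) = fps_const (s * s) * (W * V)"
        by (simp add: mult_ac flip: fps_const_mult)
      then show ?thesis unfolding q_series_mult[symmetric] WV s by simp
    qed
    ultimately have *: "g (l1 + l2) * expand E = q_series U1 * q_series U2 * ?q * g (2 * int c) * q_series (fps_const s * V)"
      by (metis mult.assoc mult.right_neutral)
    have "g (2 * int c) * g (- (2 * int c)) = 1" unfolding gadd[symmetric] by (simp add: g_def)
    moreover have "g (l1 + l2 + - (2 * int c)) * expand E =
        (q_series U1 * q_series U2 * ?q * q_series (fps_const s * V)) * (g (2 * int c) * g (- (2 * int c)))"
      unfolding gadd[of "l1 + l2"] using arg_cong[OF *, of "\<lambda>x. x * g (- (2 * int c))"] by (simp only: mult_ac)
    ultimately have "g (l1 + l2 + - (2 * int c)) * expand E = q_series U1 * q_series U2 * ?q * q_series (fps_const s * V)"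
      by simp
    also have "\<dots> = q_series S" unfolding q_series_mult[symmetric] S_def by (simp add: mult_ac)
    finally show "\<exists>k. fls_X_intpow k * expand E = q_series S" unfolding g_def by blast
  qed
  moreover have "normalised (int_q_series ((1 - fps_X) * T1 * T2)) T"
    unfolding normalised_def
  proof
    show "T = 0 \<or> fps_nth T 0 \<noteq> 0"
    proof (cases "S1 = 0 \<or> S2 = 0")
      case False
      then have "fps_nth S1 0 \<noteq> 0" "fps_nth S2 0 \<noteq> 0" using 1(1) 2(1) unfolding normalised_def by auto
      then show ?thesis by (auto simp: T_def)
    qed (auto simp: T_def)
    have "g (k1 + k2) * int_q_series ((1 - fps_X) * T1 * T2) =
        q_series (1 - fps_X) * ((g k1 * int_q_series T1) * (g k2 * int_q_series T2))"
      by (simp add: int_q_series_mult int_q_series_1_minus_X gadd mult_ac)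
    also have "\<dots> = q_series T" unfolding k T_def by (simp only: q_series_mult)
    finally show "\<exists>k. fls_X_intpow k * int_q_series ((1 - fps_X) * T1 * T2) = q_series T" unfolding g_def by blast
  qed
  moreover have "fps_nth S j = (s * (\<epsilon>1 * \<epsilon>2)) * fps_nth T j" if j: "j < n" for j
  proof -
    have e: "\<epsilon>1 * \<epsilon>1 = 1" "\<epsilon>2 * \<epsilon>2 = 1" using 1(3) 2(3) by auto
    have U: "fps_nth U1 j = \<epsilon>1 * fps_nth S1 j" "fps_nth U2 j = \<epsilon>2 * fps_nth S2 j" if "j < n" for j
      using 1(4)[OF that] 2(4)[OF that] e by (simp_all add: mult.assoc[symmetric])
    have "fps_nth (U1 * U2) j = (\<epsilon>1 * \<epsilon>2) * fps_nth (S1 * S2) j" if "j < n" for j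
      using U that by (intro fps_mult_agree) auto
    moreover have "fps_nth ((1 - fps_X) * V) j = 1 * 1 * fps_nth ((1 - fps_X) * 1) j" if "j < n" for j
      using Vj that by (intro fps_mult_agree) auto
    ultimately have "fps_nth ((1 - fps_X) * V * (U1 * U2)) j = 1 * (\<epsilon>1 * \<epsilon>2) * fps_nth ((1 - fps_X) * (S1 * S2)) j"
      by (intro fps_mult_agree[OF _ _ j]) auto
    then show ?thesis by (simp add: S_def T_def mult.assoc)
  qed
  moreover have "s * (\<epsilon>1 * \<epsilon>2) \<in> {1, -1}" using s(2) 1(3) 2(3) by auto
  ultimately show ?thesis unfolding agree_upto_def by blast
qed

section \<open>Closing up a cut network\<close>

lemma matchedD:
  assumes "matched c P R \<beta> K"
  shows "K \<in> tl_diagrams c" "finite P" "R \<subseteq> P \<times> P" "\<beta> ` box_points c \<subseteq> P"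
    "x \<in> box_points c \<Longrightarrow> y \<in> box_points c \<Longrightarrow> linked R (\<beta> x) (\<beta> y) \<longleftrightarrow> x = y \<or> {x, y} \<in> K"
  using assms unfolding matched_def by blast+

lemma matched_cap:
  assumes M: "matched c P R \<beta> K" and xy: "{x, y} \<in> K" and p: "p \<in> box_points c"
  shows "linked R (\<beta> p) (\<beta> x) \<longleftrightarrow> p = x \<or> p = y"
proof -
  have b: "x \<in> box_points c" "y \<in> box_points c" using tl_diagrams_in[OF matchedD(1)[OF M] xy] by auto
  have "{x, p} \<in> K \<longleftrightarrow> p = y"
    using perfect_matching_onD(4)[OF tl_diagramsD(1)[OF matchedD(1)[OF M]] xy] xy by blast
  then show ?thesis using matchedD(5)[OF M p b(1)] by (simp add: insert_commute)
qed

lemma matched_id: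
  assumes M: "matched c P R \<beta> (tl_id c)" and "i < c" "j < c"
  shows "linked R (\<beta> (t, i)) (\<beta> (u, j)) \<longleftrightarrow> i = j"
proof -
  have "{(u, j), (\<not> u, j)} \<in> tl_id c" using assms by (intro tl_idI)
  then show ?thesis using matched_cap[OF M, of "(u, j)" "(\<not> u, j)" "(t, i)"] assms by auto
qed

text \<open>An outside other than the identity has a cap on its bottom row, which the idempotent
  kills; the identity outside closes the box completely. In the latter case the \<open>c\<close>
  closing strands are classes of \<open>R\<close>, and \<open>loop_value ^ c\<close> on the left
  avoids subtracting them in the exponent.\<close>

lemma skein_matched:
  assumes M: "matched c P R \<beta> K"
  shows "loop_value ^ c * skein c (jones_wenzl c) P R \<beta> =
    (if K = tl_id c then Delta c * loop_value ^ comps P R else 0)"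
proof (cases "K = tl_id c")
  case True
  then show ?thesis
    using skein_jones_wenzl_trace[OF matchedD(2,3,4)[OF M]] matched_id[of c P R \<beta>] M by simp
next
  case False
  then obtain i where i: "Suc i < c" "{(False, i), (False, Suc i)} \<in> K"
    using tl_cap[OF matchedD(1)[OF M]] by blast
  have "skein c (jones_wenzl c) P R \<beta> = 0"
  proof (rule skein_jones_wenzl_cap[OF matchedD(2,3,4)[OF M] i(1)])
    show "linked R (\<beta> (False, i)) (\<beta> (False, Suc i))"
      using i matchedD(5)[OF M, of "(False, i)" "(False, Suc i)"] by simp
    show "p = (False, i) \<or> p = (False, Suc i)" if "p \<in> box_points c" "linked R (\<beta> p) (\<beta> (False, i))" for p
      using that matched_cap[OF M i(2)] by blast
  qed
  then show ?thesis using False by simp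
qed

definition sum_rel :: "('a \<times> 'a) set \<Rightarrow> ('b \<times> 'b) set \<Rightarrow> (('a + 'b) \<times> ('a + 'b)) set" where
  "sum_rel R1 R2 = map_prod Inl Inl ` R1 \<union> map_prod Inr Inr ` R2"

text \<open>This models two outsides once one of the boxes between them has been replaced by the
  identity: its strands are the bridges.\<close>

definition bridged :: "('a \<times> 'a) set \<Rightarrow> ('b \<times> 'b) set \<Rightarrow> (nat \<Rightarrow> 'a) \<Rightarrow> (nat \<Rightarrow> 'b) \<Rightarrow> nat \<Rightarrow> (('a + 'b) \<times> ('a + 'b)) set" where
  "bridged R1 R2 u v n = sum_rel R1 R2 \<union> (\<lambda>i. (Inl (u i), Inr (v i))) ` {..<n}"

text \<open>Each class on either side carries at most one bridge, so a path that crosses over can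
  return only by the bridge it came on, and one crossing suffices.\<close>

lemma linked_bridged:
  assumes u: "\<And>i j. i < n \<Longrightarrow> j < n \<Longrightarrow> linked R1 (u i) (u j) \<Longrightarrow> i = j"
    and v: "\<And>i j. i < n \<Longrightarrow> j < n \<Longrightarrow> linked R2 (v i) (v j) \<Longrightarrow> i = j"
  shows "linked (bridged R1 R2 u v n) (Inl p) (Inl q) \<longleftrightarrow> linked R1 p q"
    and "linked (bridged R1 R2 u v n) (Inr p') (Inr q') \<longleftrightarrow> linked R2 p' q'"
    and "linked (bridged R1 R2 u v n) (Inl p) (Inr q') \<longleftrightarrow> (\<exists>i<n. linked R1 p (u i) \<and> linked R2 (v i) q')"
proof -
  let ?r = "bridged R1 R2 u v n"
  have edges: "linked R1 a b \<Longrightarrow> linked ?r (Inl a) (Inl b)" "linked R2 c d \<Longrightarrow> linked ?r (Inr c) (Inr d)" for a b c d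
    by (rule linked_mono_gen[rotated], assumption, rule linked_base,
        auto simp: bridged_def sum_rel_def intro: rev_image_eqI)+
  have bridge: "i < n \<Longrightarrow> linked ?r (Inl (u i)) (Inr (v i))" for i
    by (rule linked_base) (auto simp: bridged_def)
  \<comment> \<open>A candidate for the generated equivalence relation; membership of pairs on
    different sides is witnessed by a bridge, which is unique.\<close>
  define \<Lambda> where "\<Lambda> x y = (case x of Inl a \<Rightarrow> (case y of Inl b \<Rightarrow> linked R1 a b | Inr b \<Rightarrow> \<exists>i<n. linked R1 a (u i) \<and> linked R2 (v i) b)
    | Inr a \<Rightarrow> (case y of Inl b \<Rightarrow> \<exists>i<n. linked R1 b (u i) \<and> linked R2 (v i) a | Inr b \<Rightarrow> linked R2 a b))" for x y
  have inv: "\<Lambda> x y" if "linked ?r x y" for x y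
    using that
  proof (induction rule: linked_induct)
    case refl
    show ?case by (cases x) (auto simp: \<Lambda>_def)
  next
    case (step y z)
    from step.hyps(2) consider a b where "y = Inl a" "z = Inl b" "(a, b) \<in> R1 \<or> (b, a) \<in> R1"
      | a b where "y = Inr a" "z = Inr b" "(a, b) \<in> R2 \<or> (b, a) \<in> R2"
      | i where "i < n" "y = Inl (u i)" "z = Inr (v i)" | i where "i < n" "z = Inl (u i)" "y = Inr (v i)"
      unfolding bridged_def sum_rel_def by auto
    then show ?case
    proof cases
      case 1
      then have ab: "linked R1 a b" using linked_base linked_base' by metis
      then show ?thesis using step.IH 1 linked_trans[of R1 _ a b] linked_trans[of R1 b a] linked_sym[OF ab]
        by (cases x) (auto simp: \<Lambda>_def)
    next
      case 2
      then have ab: "linked R2 a b" using linked_base linked_base' by metis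
      then show ?thesis using step.IH 2 linked_trans[of R2 _ a b]
        by (cases x) (auto simp: \<Lambda>_def)
    next
      case 3
      show ?thesis
      proof (cases x)
        case (Inl a)
        then show ?thesis using step.IH 3 by (auto simp: \<Lambda>_def)
      next
        case (Inr a)
        then obtain j where j: "j < n" "linked R1 (u i) (u j)" "linked R2 (v j) a"
          using step.IH 3 by (auto simp: \<Lambda>_def)
        then have "i = j" using u 3 by blast
        then show ?thesis using j 3 Inr linked_sym by (auto simp: \<Lambda>_def)
      qed
    next
      case 4
      show ?thesis
      proof (cases x)
        case (Inl a)
        then obtain j where j: "j < n" "linked R1 a (u j)" "linked R2 (v j) (v i)"
          using step.IH 4 by (auto simp: \<Lambda>_def)
        then have "j = i" using v 4 by blast
        then show ?thesis using j 4 Inl by (auto simp: \<Lambda>_def)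
      next
        case (Inr a)
        then show ?thesis using step.IH 4 linked_sym[of R2 a "v i"] by (auto simp: \<Lambda>_def intro!: exI[of _ i])
      qed
    qed
  qed
  show "linked ?r (Inl p) (Inl q) \<longleftrightarrow> linked R1 p q" using inv[of "Inl p" "Inl q"] edges by (auto simp: \<Lambda>_def)
  show "linked ?r (Inr p') (Inr q') \<longleftrightarrow> linked R2 p' q'" using inv[of "Inr p'" "Inr q'"] edges by (auto simp: \<Lambda>_def)
  show "linked ?r (Inl p) (Inr q') \<longleftrightarrow> (\<exists>i<n. linked R1 p (u i) \<and> linked R2 (v i) q')"
  proof
    assume "\<exists>i<n. linked R1 p (u i) \<and> linked R2 (v i) q'"
    then obtain i where i: "i < n" "linked R1 p (u i)" "linked R2 (v i) q'" by blast
    show "linked ?r (Inl p) (Inr q')"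
      by (rule linked_trans[OF edges(1)[OF i(2)] linked_trans[OF bridge[OF i(1)] edges(2)[OF i(3)]]])
  qed (use inv[of "Inl p" "Inr q'"] in \<open>simp add: \<Lambda>_def\<close>)
qed

lemma bridged_0: "bridged R1 R2 u v 0 = sum_rel R1 R2"
  by (simp add: bridged_def)

lemma linked_sum_rel:
  "linked (sum_rel R1 R2) (Inl p) (Inl q) \<longleftrightarrow> linked R1 p q"
  "linked (sum_rel R1 R2) (Inr p') (Inr q') \<longleftrightarrow> linked R2 p' q'"
  "\<not> linked (sum_rel R1 R2) (Inl p) (Inr q')" "\<not> linked (sum_rel R1 R2) (Inr q') (Inl p)"
proof -
  note * = linked_bridged[where n = 0 and ?R1.0 = R1 and ?R2.0 = R2, unfolded bridged_0, simplified]
  show "linked (sum_rel R1 R2) (Inl p) (Inl q) \<longleftrightarrow> linked R1 p q"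
    "linked (sum_rel R1 R2) (Inr p') (Inr q') \<longleftrightarrow> linked R2 p' q'"
    "\<not> linked (sum_rel R1 R2) (Inl p) (Inr q')" "\<not> linked (sum_rel R1 R2) (Inr q') (Inl p)"
    using * linked_sym[of "sum_rel R1 R2" "Inr q'" "Inl p"] by blast+
qed

lemma sum_rel_sub: "R1 \<subseteq> P1 \<times> P1 \<Longrightarrow> R2 \<subseteq> P2 \<times> P2 \<Longrightarrow> sum_rel R1 R2 \<subseteq> (P1 <+> P2) \<times> (P1 <+> P2)"
  by (auto simp: sum_rel_def)

lemma comps_sum_rel:
  fixes P1 :: "'a set" and P2 :: "'b set"
  assumes "finite P1" "finite P2"
  shows "comps (P1 <+> P2) (sum_rel R1 R2) = comps P1 R1 + comps P2 R2"
proof -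
  let ?r = "sum_rel R1 R2"
  have l: "{y \<in> P1 <+> P2. linked ?r (Inl x) y} = Inl ` {y \<in> P1. linked R1 x y}" for x
  proof -
    have "z \<in> {y \<in> P1 <+> P2. linked ?r (Inl x) y} \<longleftrightarrow> z \<in> Inl ` {y \<in> P1. linked R1 x y}" for z
      by (cases z) (auto simp: linked_sum_rel)
    then show ?thesis by blast
  qed
  have r: "{y \<in> P1 <+> P2. linked ?r (Inr x) y} = Inr ` {y \<in> P2. linked R2 x y}" for x
  proof -
    have "z \<in> {y \<in> P1 <+> P2. linked ?r (Inr x) y} \<longleftrightarrow> z \<in> Inr ` {y \<in> P2. linked R2 x y}" for z
      by (cases z) (auto simp: linked_sum_rel)
    then show ?thesis by blast
  qed
  have "conn_classes (P1 <+> P2) ?r = (`) Inl ` conn_classes P1 R1 \<union> (`) Inr ` conn_classes P2 R2"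
    unfolding conn_classes_eq Plus_def image_Un image_image l[unfolded Plus_def] r[unfolded Plus_def] ..
  moreover have "(`) Inl ` conn_classes P1 R1 \<inter> (`) Inr ` conn_classes P2 R2 = {}"
    unfolding conn_classes_eq by auto
  moreover have "card ((`) (Inl :: 'a \<Rightarrow> 'a + 'b) ` conn_classes P1 R1) = card (conn_classes P1 R1)"
    "card ((`) (Inr :: 'b \<Rightarrow> 'a + 'b) ` conn_classes P2 R2) = card (conn_classes P2 R2)"
    by (rule card_image, rule inj_on_image, simp)+
  ultimately show ?thesis
    using assms by (simp add: comps_def card_Un_disjoint finite_conn_classes)
qed

text \<open>Every bridge joins two classes not linked by the earlier ones and so lowers the number
  of components by one.\<close>

lemma comps_bridged:
  assumes fin: "finite P1" "finite P2" and uv: "\<And>i. i < n \<Longrightarrow> u i \<in> P1 \<and> v i \<in> P2"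
    and u: "\<And>i j. i < n \<Longrightarrow> j < n \<Longrightarrow> linked R1 (u i) (u j) \<Longrightarrow> i = j"
    and v: "\<And>i j. i < n \<Longrightarrow> j < n \<Longrightarrow> linked R2 (v i) (v j) \<Longrightarrow> i = j"
  shows "comps (P1 <+> P2) (bridged R1 R2 u v n) + n = comps P1 R1 + comps P2 R2"
  using uv u v
proof (induction n)
  case 0
  then show ?case using comps_sum_rel[OF fin] by (simp add: bridged_0)
next
  case (Suc n)
  have "comps (P1 <+> P2) (bridged R1 R2 u v n) =
      Suc (comps (P1 <+> P2) (insert (Inl (u n), Inr (v n)) (bridged R1 R2 u v n)))"
  proof (rule comps_insert_unlinked)
    show "\<not> linked (bridged R1 R2 u v n) (Inl (u n)) (Inr (v n))"
    proof
      assume "linked (bridged R1 R2 u v n) (Inl (u n)) (Inr (v n))"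
      then have "\<exists>i<n. linked R1 (u n) (u i) \<and> linked R2 (v i) (v n)"
        by (subst (asm) linked_bridged(3)) (use Suc.prems in auto)
      then obtain i where "i < n" "linked R1 (u n) (u i)" by blast
      then show False using Suc.prems(2)[of n i] by simp
    qed
  qed (use fin Suc.prems(1) in auto)
  moreover have "insert (Inl (u n), Inr (v n)) (bridged R1 R2 u v n) = bridged R1 R2 u v (Suc n)"
    by (auto simp: bridged_def lessThan_Suc)
  moreover have "comps (P1 <+> P2) (bridged R1 R2 u v n) + n = comps P1 R1 + comps P2 R2"
    using Suc.prems by (intro Suc.IH) auto
  ultimately show ?case by simp
qed

text \<open>Two boxes connect the outsides \<open>K1\<close> and \<open>K2\<close>. A cap of
  \<open>K1\<close> or \<open>K2\<close> faces the first box and kills it, and both sides vanish. If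
  both outsides are identities, a cap in a diagram of the second box is carried by the strands of
  \<open>K1\<close> to the first box and kills it. Only the identity of the second box survives and
  turns the first box into a full trace. Both sides are then the square of \<open>Delta c\<close>
  times equally many circles, since the second box merges \<open>c\<close> pairs of
  components.\<close>

lemma skein_sum_matched:
  fixes \<beta>1 :: "bool \<times> nat \<Rightarrow> 'a" and \<beta>2 :: "bool \<times> nat \<Rightarrow> 'b"
  assumes M1: "matched c P1 R1 \<beta>1 K1" and M2: "matched c P2 R2 \<beta>2 K2"
    and \<iota>1: "\<And>i. i < c \<Longrightarrow> \<iota>1 (False, i) = Inl (\<beta>1 (False, i))"
      "\<And>i. i < c \<Longrightarrow> \<iota>1 (True, i) = Inr (\<beta>2 (b, if b then i else c - 1 - i))"
    and \<iota>2: "\<And>i. i < c \<Longrightarrow> \<iota>2 (b, i) = Inl (\<beta>1 (True, if b then i else c - 1 - i))"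
      "\<And>i. i < c \<Longrightarrow> \<iota>2 (\<not> b, i) = Inr (\<beta>2 (\<not> b, i))"
  shows "Delta c * (\<Sum>D1\<in>tl_diagrams c. \<Sum>D2\<in>tl_diagrams c. jones_wenzl c D1 * jones_wenzl c D2 *
      loop_value ^ comps (P1 <+> P2) (sum_rel R1 R2 \<union> glue \<iota>1 D1 \<union> glue \<iota>2 D2)) =
    skein c (jones_wenzl c) P1 R1 \<beta>1 * skein c (jones_wenzl c) P2 R2 \<beta>2"
proof -
  let ?f = "jones_wenzl c" and ?P = "P1 <+> P2" and ?R = "sum_rel R1 R2"
  \<comment> \<open>If \<open>b\<close> is \<open>False\<close>, the top of the first box takes the
    place of the bottom of the old box on the second edge; this half turn reverses the
    numbering.\<close>
  define \<rho> where "\<rho> i = (if b then i else c - 1 - i)" for i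
  note \<iota>1' = \<iota>1(1) \<iota>1(2)[folded \<rho>_def] and \<iota>2' = \<iota>2(1)[folded \<rho>_def] \<iota>2(2)
  have \<rho>: "i < c \<Longrightarrow> \<rho> i < c" "i < c \<Longrightarrow> \<rho> (\<rho> i) = i" for i by (auto simp: \<rho>_def)
  have \<rho>_inj: "i < c \<Longrightarrow> j < c \<Longrightarrow> \<rho> i = \<rho> j \<longleftrightarrow> i = j" for i j by (auto simp: \<rho>_def)
  define double where "double = (\<Sum>D1\<in>tl_diagrams c. \<Sum>D2\<in>tl_diagrams c. ?f D1 * ?f D2 *
      loop_value ^ comps ?P (?R \<union> glue \<iota>1 D1 \<union> glue \<iota>2 D2))"
  have double_eq: "double = (\<Sum>D2\<in>tl_diagrams c. ?f D2 * skein c ?f ?P (?R \<union> glue \<iota>2 D2) \<iota>1)"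
    unfolding double_def skein_def sum_distrib_left
    by (subst sum.swap) (intro sum.cong refl, simp add: Un_ac mult_ac)
  note m1 = matchedD[OF M1] and m2 = matchedD[OF M2]
  have fP: "finite ?P" using m1(2) m2(2) by simp
  have \<beta>P: "i < c \<Longrightarrow> \<beta>1 (t, i) \<in> P1" "i < c \<Longrightarrow> \<beta>2 (t, i) \<in> P2" for t i using m1(4) m2(4) by auto
  have \<iota>1P: "\<iota>1 ` box_points c \<subseteq> ?P"
  proof (rule image_subsetI)
    fix p assume "p \<in> box_points c"
    then obtain t i where "p = (t, i)" "i < c" by (cases p) auto
    then show "\<iota>1 p \<in> ?P" using \<iota>1' \<beta>P \<rho>(1) by (cases t) auto
  qed
  have \<iota>2P: "\<iota>2 ` box_points c \<subseteq> ?P"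
  proof (rule image_subsetI)
    fix p assume "p \<in> box_points c"
    then obtain t i where ti: "p = (t, i)" "i < c" by (cases p) auto
    then consider "t = b" | "t = (\<not> b)" by blast
    then show "\<iota>2 p \<in> ?P" using ti \<iota>2' \<beta>P \<rho>(1) by cases auto
  qed
  have RP: "?R \<union> glue \<iota>2 D \<subseteq> ?P \<times> ?P" if "D \<in> tl_diagrams c" for D
    using sum_rel_sub[OF m1(3) m2(3)] glue_sub[OF that \<iota>2P] by simp
  have mono: "linked ?R x y \<Longrightarrow> linked (?R \<union> glue \<iota>2 D) x y" for x y D by (rule linked_mono) auto
  have box1: "\<exists>i<c. p = (False, i) \<and> \<iota>1 p = Inl (\<beta>1 (False, i)) \<or> p = (True, i) \<and> \<iota>1 p = Inr (\<beta>2 (b, \<rho> i))"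
    if "p \<in> box_points c" for p using that \<iota>1' by (cases p; cases "fst p") auto
  have box2: "\<exists>i<c. p = (b, i) \<and> \<iota>2 p = Inl (\<beta>1 (True, \<rho> i)) \<or> p = (\<not> b, i) \<and> \<iota>2 p = Inr (\<beta>2 (\<not> b, i))"
    if p: "p \<in> box_points c" for p
  proof -
    obtain t i where ti: "p = (t, i)" "i < c" using p by (cases p) auto
    then consider "t = b" | "t = (\<not> b)" by blast
    then show ?thesis using ti \<iota>2' by cases auto
  qed
  consider "K1 \<noteq> tl_id c" | "K1 = tl_id c" "K2 \<noteq> tl_id c" | "K1 = tl_id c" "K2 = tl_id c" by blast
  then have "Delta c * double = skein c ?f P1 R1 \<beta>1 * skein c ?f P2 R2 \<beta>2"
  proof cases
    case 1
    obtain i where i: "Suc i < c" "{(False, i), (False, Suc i)} \<in> K1" using tl_cap[OF m1(1) 1] by blast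
    have cap: "linked R1 (\<beta>1 p) (\<beta>1 (False, i)) \<longleftrightarrow> p = (False, i) \<or> p = (False, Suc i)" if "p \<in> box_points c" for p
      by (rule matched_cap[OF M1 i(2) that])
    have far: "\<forall>p\<in>box_points c. \<not> linked ?R (\<iota>2 p) (\<iota>1 (False, i))"
    proof
      fix p assume "p \<in> box_points c"
      then show "\<not> linked ?R (\<iota>2 p) (\<iota>1 (False, i))"
        using box2[of p] \<iota>1'(1)[of i] i(1) cap[of "(True, _)"] \<rho>(1) by (auto simp: linked_sum_rel)
    qed
    have "skein c ?f ?P (?R \<union> glue \<iota>2 D) \<iota>1 = 0" if D: "D \<in> tl_diagrams c" for D
    proof (rule skein_jones_wenzl_cap[OF fP RP[OF D] \<iota>1P i(1)])
      have "linked R1 (\<beta>1 (False, i)) (\<beta>1 (False, Suc i))" using cap[of "(False, Suc i)"] i(1) linked_sym by auto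
      then show "linked (?R \<union> glue \<iota>2 D) (\<iota>1 (False, i)) (\<iota>1 (False, Suc i))"
        using i(1) \<iota>1'(1) by (intro mono) (simp add: linked_sum_rel)
      fix p assume p: "p \<in> box_points c" "linked (?R \<union> glue \<iota>2 D) (\<iota>1 p) (\<iota>1 (False, i))"
      have "linked ?R (\<iota>1 p) (\<iota>1 (False, i))" using linked_glue_avoid[OF D far p(2)] by simp
      then show "p = (False, i) \<or> p = (False, Suc i)"
        using box1[OF p(1)] \<iota>1'(1)[of i] i(1) cap[of "(False, _)"] by (auto simp: linked_sum_rel)
    qed
    then have "double = 0" unfolding double_eq by simp
    moreover have "skein c ?f P1 R1 \<beta>1 = 0" using skein_matched[OF M1] 1 by simp
    ultimately show ?thesis by simp
  next
    case 2
    obtain i where i: "Suc i < c" "{(b, i), (b, Suc i)} \<in> K2" using tl_cap[OF m2(1) 2(2)] by blast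
    \<comment> \<open>Under the reversal the neighbours i and i + 1 become c - 1 - i and c - 2 - i;
      the smaller one is c - 1 - Suc i.\<close>
    define j where "j = (if b then i else c - 1 - Suc i)"
    have j: "Suc j < c" "{(b, \<rho> j), (b, \<rho> (Suc j))} \<in> K2"
    proof -
      show "Suc j < c" using i(1) by (auto simp: j_def)
      have "{\<rho> j, \<rho> (Suc j)} = {i, Suc i}" using i(1) by (auto simp: \<rho>_def j_def)
      then have "{(b, \<rho> j), (b, \<rho> (Suc j))} = {(b, i), (b, Suc i)}" by (auto simp: doubleton_eq_iff)
      then show "{(b, \<rho> j), (b, \<rho> (Suc j))} \<in> K2" using i(2) by simp
    qed
    have cap: "linked R2 (\<beta>2 p) (\<beta>2 (b, \<rho> j)) \<longleftrightarrow> p = (b, \<rho> j) \<or> p = (b, \<rho> (Suc j))" if "p \<in> box_points c" for p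
      by (rule matched_cap[OF M2 j(2) that])
    have far: "\<forall>p\<in>box_points c. \<not> linked ?R (\<iota>2 p) (\<iota>1 (True, j))"
    proof
      fix p assume "p \<in> box_points c"
      then show "\<not> linked ?R (\<iota>2 p) (\<iota>1 (True, j))"
        using box2[of p] \<iota>1'(2)[of j] j(1) cap[of "(\<not> b, _)"] by (auto simp: linked_sum_rel)
    qed
    have "skein c ?f ?P (?R \<union> glue \<iota>2 D) \<iota>1 = 0" if D: "D \<in> tl_diagrams c" for D
    proof (rule skein_jones_wenzl_cap[OF fP RP[OF D] \<iota>1P j(1)])
      have "linked R2 (\<beta>2 (b, \<rho> j)) (\<beta>2 (b, \<rho> (Suc j)))"
        using cap[of "(b, \<rho> (Suc j))"] j(1) \<rho>(1) linked_sym by auto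
      then show "linked (?R \<union> glue \<iota>2 D) (\<iota>1 (True, j)) (\<iota>1 (True, Suc j))"
        using j(1) \<iota>1'(2) by (intro mono) (simp add: linked_sum_rel)
      fix p assume p: "p \<in> box_points c" "linked (?R \<union> glue \<iota>2 D) (\<iota>1 p) (\<iota>1 (True, j))"
      have l: "linked ?R (\<iota>1 p) (\<iota>1 (True, j))" using linked_glue_avoid[OF D far p(2)] by simp
      obtain k where k: "k < c" "p = (False, k) \<and> \<iota>1 p = Inl (\<beta>1 (False, k)) \<or> p = (True, k) \<and> \<iota>1 p = Inr (\<beta>2 (b, \<rho> k))"
        using box1[OF p(1)] by blast
      then show "p = (True, j) \<or> p = (True, Suc j)"
        using l \<iota>1'(2)[of j] j(1) cap[of "(b, \<rho> k)"] \<rho>(1)[OF k(1)] \<rho>_inj[OF k(1)] by (auto simp: linked_sum_rel)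
    qed
    then have "double = 0" unfolding double_eq by simp
    moreover have "skein c ?f P2 R2 \<beta>2 = 0" using skein_matched[OF M2] 2 by simp
    ultimately show ?thesis by simp
  next
    case 3
    have id1: "linked R1 (\<beta>1 (t, i)) (\<beta>1 (u, j)) \<longleftrightarrow> i = j" and id2: "linked R2 (\<beta>2 (t, i)) (\<beta>2 (u, j)) \<longleftrightarrow> i = j"
      if "i < c" "j < c" for t u i j
      using matched_id[of c P1 R1 \<beta>1 i j t u] matched_id[of c P2 R2 \<beta>2 i j t u] M1 M2 3 that by auto
    have zero: "skein c ?f ?P (?R \<union> glue \<iota>2 D) \<iota>1 = 0" if D: "D \<in> tl_diagrams c" "D \<noteq> tl_id c" for D
    proof -
      obtain k where k: "Suc k < c" "{(b, k), (b, Suc k)} \<in> D" using tl_cap[OF D] by blast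
      define j where "j = (if b then k else c - 1 - Suc k)"
      have j: "Suc j < c" and jk: "{\<rho> k, \<rho> (Suc k)} = {j, Suc j}" using k(1) by (auto simp: \<rho>_def j_def)
      let ?r = "?R \<union> glue \<iota>2 D"
      have up: "linked ?R (\<iota>1 (False, \<rho> i)) (\<iota>2 (b, i))" if "i < c" for i
        using that \<rho>(1)[OF that] \<iota>1'(1) \<iota>2'(1) id1 by (simp add: linked_sum_rel)
      have "linked ?r (\<iota>2 (b, k)) (\<iota>2 (b, Suc k))" using k(2) by (intro linked_base) (auto intro: glueI)
      then have kk: "linked ?r (\<iota>1 (False, \<rho> k)) (\<iota>1 (False, \<rho> (Suc k)))"
        by (rule linked_link[OF mono[OF up] mono[OF up], rotated 2]) (use k(1) in auto)
      have iso: "p = (False, \<rho> k) \<or> p = (False, \<rho> (Suc k))"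
        if p: "p \<in> box_points c" "linked ?r (\<iota>1 p) (\<iota>1 (False, \<rho> k))" for p
      proof -
        have sep: "q = (b, k) \<or> q = (b, Suc k)"
          if q: "q \<in> box_points c" "linked ?R (\<iota>2 q) (\<iota>2 (b, k)) \<or> linked ?R (\<iota>2 q) (\<iota>2 (b, Suc k))" for q
          using box2[OF q(1)] q(2) k(1) \<iota>2'(1) id1 \<rho>(1) \<rho>_inj by (fastforce simp: linked_sum_rel)
        have "linked ?r (\<iota>1 p) (\<iota>2 (b, k))" using linked_trans[OF p(2) mono[OF up[of k]]] k(1) by simp
        then have "linked ?R (\<iota>1 p) (\<iota>2 (b, k)) \<or> linked ?R (\<iota>1 p) (\<iota>2 (b, Suc k))"
          by (rule linked_glue_cap[OF D(1) k(2) sep, rotated -1])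
        then show ?thesis using box1[OF p(1)] k(1) \<iota>2'(1) id1 \<rho>(1) by (fastforce simp: linked_sum_rel)
      qed
      show ?thesis
      proof (rule skein_jones_wenzl_cap[OF fP RP[OF D(1)] \<iota>1P j])
        have jj: "\<rho> k = j \<and> \<rho> (Suc k) = Suc j \<or> \<rho> k = Suc j \<and> \<rho> (Suc k) = j" using jk by (auto simp: doubleton_eq_iff)
        then show "linked ?r (\<iota>1 (False, j)) (\<iota>1 (False, Suc j))" using kk linked_sym by auto
        then show "p = (False, j) \<or> p = (False, Suc j)" if "p \<in> box_points c" "linked ?r (\<iota>1 p) (\<iota>1 (False, j))" for p
          using jj iso[OF that(1)] that(2) linked_trans[OF that(2)] by auto
      qed
    qed
    let ?r = "?R \<union> glue \<iota>2 (tl_id c)"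
    let ?u = "\<lambda>i. \<beta>1 (True, \<rho> i)" and ?v = "\<lambda>i. \<beta>2 (\<not> b, i)"
    have br: "linked ?r = linked (bridged R1 R2 ?u ?v c)"
    proof (rule linked_cong)
      have e: "\<iota>2 (b, i) = Inl (?u i)" "\<iota>2 (\<not> b, i) = Inr (?v i)" if "i < c" for i using that \<iota>2' by auto
      have e': "linked (bridged R1 R2 ?u ?v c) (\<iota>2 (t, i)) (\<iota>2 (\<not> t, i))" if "i < c" for t i
      proof -
        have "linked (bridged R1 R2 ?u ?v c) (Inl (?u i)) (Inr (?v i))"
          using that by (intro linked_base) (auto simp: bridged_def)
        from this linked_sym[OF this] show ?thesis using e[OF that] by (cases "t = b") auto
      qed
      show "linked (bridged R1 R2 ?u ?v c) x y" if "(x, y) \<in> ?r" for x y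
        using that
      proof
        assume "(x, y) \<in> glue \<iota>2 (tl_id c)"
        then show ?thesis unfolding glue_tl_id using e'[of _ False] e'[of _ True] by auto
      qed (auto simp: bridged_def intro: linked_base)
      show "linked ?r x y" if "(x, y) \<in> bridged R1 R2 ?u ?v c" for x y
        using that unfolding bridged_def
      proof
        assume "(x, y) \<in> (\<lambda>i. (Inl (?u i), Inr (?v i))) ` {..<c}"
        then obtain i where i: "i < c" "x = \<iota>2 (b, i)" "y = \<iota>2 (\<not> b, i)" using e by auto
        then show ?thesis using glueI[OF tl_idI[OF i(1), of b]] by (intro linked_base) auto
      qed (auto intro: linked_base)
    qed
    have u: "i = j" if "i < c" "j < c" "linked R1 (?u i) (?u j)" for i j using that id1 \<rho>(1) \<rho>_inj by simp
    have v: "i = j" if "i < c" "j < c" "linked R2 (?v i) (?v j)" for i j using that id2 by simp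
    have lb1: "linked (bridged R1 R2 ?u ?v c) (Inl p) (Inl q) \<longleftrightarrow> linked R1 p q" for p q
      by (rule linked_bridged(1)) (erule (2) u, erule (2) v)
    have lb3: "linked (bridged R1 R2 ?u ?v c) (Inl p) (Inr q) \<longleftrightarrow> (\<exists>i<c. linked R1 p (?u i) \<and> linked R2 (?v i) q)" for p q
      by (rule linked_bridged(3)) (erule (2) u, erule (2) v)
    have A: "comps ?P ?r + c = comps P1 R1 + comps P2 R2"
      unfolding comps_cong_linked[OF br] using \<beta>P \<rho>(1) by (intro comps_bridged m1(2) m2(2) u v) auto
    have B: "loop_value ^ c * skein c ?f ?P ?r \<iota>1 = Delta c * loop_value ^ comps ?P ?r"
    proof (rule skein_jones_wenzl_trace[OF fP RP[OF tl_id_in] \<iota>1P])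
      fix i assume i: "i < c"
      have "linked R1 (\<beta>1 (False, i)) (?u (\<rho> i))" "linked R2 (?v (\<rho> i)) (\<beta>2 (b, \<rho> i))" "\<rho> i < c"
        using i \<rho> id1 id2 by auto
      then show "linked ?r (\<iota>1 (False, i)) (\<iota>1 (True, i))"
        unfolding br using \<iota>1'[OF i] lb3 by auto
    next
      fix i j assume "i < c" "j < c" "linked ?r (\<iota>1 (False, i)) (\<iota>1 (False, j))"
      then show "i = j" unfolding br using \<iota>1'(1) lb1 id1 by auto
    qed
    have C: "double = skein c ?f ?P ?r \<iota>1"
      unfolding double_eq by (rule sum_only_id[OF zero])
    \<comment> \<open>One factor \<open>loop_value ^ c\<close> belongs to the trace in
      \<open>B\<close>, the other restores the \<open>c\<close> components lost to the bridges in
      \<open>A\<close>.\<close>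
    have d: "loop_value ^ c * loop_value ^ c * double = Delta c * loop_value ^ (comps P1 R1 + comps P2 R2)"
      unfolding A[symmetric] C mult.assoc B by (simp only: power_add mult_ac)
    have "loop_value ^ c * loop_value ^ c * (Delta c * double) =
        Delta c * (loop_value ^ c * loop_value ^ c * double)" by (simp only: mult_ac)
    also have "\<dots> = (Delta c * loop_value ^ comps P1 R1) * (Delta c * loop_value ^ comps P2 R2)"
      unfolding d by (simp add: power_add mult_ac)
    also have "\<dots> = (loop_value ^ c * skein c ?f P1 R1 \<beta>1) * (loop_value ^ c * skein c ?f P2 R2 \<beta>2)"
      using skein_matched[OF M1] skein_matched[OF M2] 3 by simp
    also have "\<dots> = loop_value ^ c * loop_value ^ c * (skein c ?f P1 R1 \<beta>1 * skein c ?f P2 R2 \<beta>2)"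
      by (simp only: mult_ac)
    finally show ?thesis by simp
  qed
  then show ?thesis by (simp add: double_def)
qed

section \<open>Evaluation of a connected sum\<close>

lemma sum_PiE_insert:
  assumes "e \<in> A"
  shows "(\<Sum>s\<in>PiE A F. h s) = (\<Sum>s\<in>PiE (A - {e}) F. \<Sum>D\<in>F e. h (s(e := D)))"
proof -
  have eq: "PiE A F = (\<lambda>(y, g). g(e := y)) ` (F e \<times> PiE (A - {e}) F)"
    using PiE_insert_eq[of e "A - {e}" F] assms by (simp add: insert_absorb)
  have inj: "inj_on (\<lambda>(y, g). g(e := y)) (F e \<times> PiE (A - {e}) F)"
    by (rule inj_combinator) simp
  have "(\<Sum>s\<in>PiE A F. h s) = (\<Sum>(D, s)\<in>F e \<times> PiE (A - {e}) F. h (s(e := D)))"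
    unfolding eq sum.reindex[OF inj] by (intro sum.cong refl) auto
  also have "\<dots> = (\<Sum>D\<in>F e. \<Sum>s\<in>PiE (A - {e}) F. h (s(e := D)))"
    by (rule sum.cartesian_product[symmetric])
  finally show ?thesis by (simp only: sum.swap[of _ "F e"])
qed

lemma sum_PiE_Plus:
  "(\<Sum>s\<in>PiE (A <+> B) (case_sum F G). h s) = (\<Sum>s1\<in>PiE A F. \<Sum>s2\<in>PiE B G. h (case_sum s1 s2))"
proof -
  have "(\<Sum>s\<in>PiE (A <+> B) (case_sum F G). h s) = (\<Sum>(s1, s2)\<in>PiE A F \<times> PiE B G. h (case_sum s1 s2))"
  proof (rule sum.reindex_bij_witness[where i = "\<lambda>(s1, s2). case_sum s1 s2" and j = "\<lambda>s. (s \<circ> Inl, s \<circ> Inr)"])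
    fix s assume s: "s \<in> PiE (A <+> B) (case_sum F G)"
    have eq: "case_sum (s \<circ> Inl) (s \<circ> Inr) = s" by (rule ext) (auto split: sum.split)
    then show "(case (s \<circ> Inl, s \<circ> Inr) of (s1, s2) \<Rightarrow> case_sum s1 s2) = s" by simp
    show "(case (s \<circ> Inl, s \<circ> Inr) of (s1, s2) \<Rightarrow> h (case_sum s1 s2)) = h s" using eq by simp
    have "(s \<circ> Inl) x \<in> F x" if "x \<in> A" for x using PiE_mem[OF s, of "Inl x"] that by auto
    moreover have "(s \<circ> Inr) x \<in> G x" if "x \<in> B" for x using PiE_mem[OF s, of "Inr x"] that by auto
    moreover have "(s \<circ> Inl) x = undefined" if "x \<notin> A" for x using PiE_arb[OF s, of "Inl x"] that by auto
    moreover have "(s \<circ> Inr) x = undefined" if "x \<notin> B" for x using PiE_arb[OF s, of "Inr x"] that by auto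
    ultimately show "(s \<circ> Inl, s \<circ> Inr) \<in> PiE A F \<times> PiE B G" by (intro SigmaI PiE_I)
  next
    fix p assume p: "p \<in> PiE A F \<times> PiE B G"
    obtain s1 s2 where s: "p = (s1, s2)" "s1 \<in> PiE A F" "s2 \<in> PiE B G" using p by auto
    then show "(\<lambda>s. (s \<circ> Inl, s \<circ> Inr)) (case p of (s1, s2) \<Rightarrow> case_sum s1 s2) = p" by (simp add: comp_def)
    have "case_sum s1 s2 \<in> PiE (A <+> B) (case_sum F G)"
    proof (rule PiE_I)
      show "case_sum s1 s2 x \<in> case_sum F G x" if "x \<in> A <+> B" for x
        using that PiE_mem[OF s(2)] PiE_mem[OF s(3)] by (cases x) auto
      show "case_sum s1 s2 x = undefined" if "x \<notin> A <+> B" for x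
        using that PiE_arb[OF s(2)] PiE_arb[OF s(3)] by (cases x) auto
    qed
    then show "(case p of (s1, s2) \<Rightarrow> case_sum s1 s2) \<in> PiE (A <+> B) (case_sum F G)" using s by simp
  qed
  then show ?thesis by (simp only: sum.cartesian_product)
qed

lemma strand_rel_glue:
  assumes "D \<in> tl_diagrams c"
  shows "strand_rel ((`) \<kappa> ` D) = glue \<kappa> D"
  unfolding glue_def using perfect_matching_onD(2)[OF tl_diagramsD(1)[OF assms]] by (rule strand_rel_image)

lemma glue_comp: "glue (h \<circ> \<iota>) D = map_prod h h ` glue \<iota> D"
  unfolding glue_def image_Collect_ex2 by simp

lemma circles_cut:
  assumes "e \<in> edges N" "D \<in> tl_diagrams c"
  shows "card (circles N (s(e := D))) = comps (points N) (strand_rel (cut_strands N e s) \<union> glue (box_to_edge N e) D)"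
proof -
  have "(\<Union>e'\<in>edges N. (`) (box_to_edge N e') ` (s(e := D)) e') =
      (\<Union>e'\<in>edges N - {e}. (`) (box_to_edge N e') ` s e') \<union> (`) (box_to_edge N e) ` D"
    using assms(1) by (auto split: if_splits)
  then show ?thesis
    unfolding circles_def comps_def cut_strands_def strand_rel_glue[OF assms(2), symmetric] strand_rel_Un[symmetric]
    by (simp add: Un_assoc)
qed

definition cut_weight :: "('e, 'z) network_scheme \<Rightarrow> 'e \<Rightarrow> ('e \<Rightarrow> tl_diagram) \<Rightarrow> ratfun" where
  "cut_weight N e s = (\<Prod>e'\<in>edges N - {e}. jones_wenzl (colour N e') (s e'))"

lemma prod_cut:
  assumes "finite (edges N)" "e \<in> edges N"
  shows "(\<Prod>e'\<in>edges N. jones_wenzl (colour N e') ((s(e := D)) e')) = jones_wenzl (colour N e) D * cut_weight N e s"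
proof -
  have "(\<Prod>e'\<in>edges N. jones_wenzl (colour N e') ((s(e := D)) e')) =
      jones_wenzl (colour N e) D * (\<Prod>e'\<in>edges N - {e}. jones_wenzl (colour N e') ((s(e := D)) e'))"
    using prod.remove[OF assms, of "\<lambda>e'. jones_wenzl (colour N e') ((s(e := D)) e')"] by simp
  also have "(\<Prod>e'\<in>edges N - {e}. jones_wenzl (colour N e') ((s(e := D)) e')) = cut_weight N e s"
    unfolding cut_weight_def by (rule prod.cong) auto
  finally show ?thesis .
qed

text \<open>Fixing the state on all other edges isolates the box of \<open>e\<close> in a context,
  so cap killing and the trace formula apply to each term separately.\<close>

lemma evaluation_cut:
  assumes "finite (edges N)" "e \<in> edges N"
  shows "evaluation N = (\<Sum>s\<in>(\<Pi>\<^sub>E e'\<in>edges N - {e}. tl_diagrams (colour N e')). cut_weight N e s *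
     skein (colour N e) (jones_wenzl (colour N e)) (points N) (strand_rel (cut_strands N e s)) (box_to_edge N e))"
  unfolding evaluation_def sum_PiE_insert[OF assms(2)] skein_def sum_distrib_left
  by (intro sum.cong refl) (simp only: prod_cut[OF assms] circles_cut[OF assms(2)] mult_ac)

lemma vertex_strands_UN:
  "vertex_strands N = (\<Union>d\<in>darts N. (\<lambda>k. {(d, dcol N d - 1 - k), (rot N d, k)}) `
     {..<(dcol N d + dcol N (rot N d) - dcol N (rot N (rot N d))) div 2})"
  unfolding vertex_strands_def by blast

lemma (in cut_network) card_cut_strands: "t \<in> cut_strands N e s \<Longrightarrow> card t = 2"
  using perfect_matching_onD(2)[OF vertex_matching, of t] perfect_matching_onD(2)[OF edges_matching, of t]
  unfolding cut_strands_def Un_iff by argo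

section \<open>The connected sum as a disjoint union with two loose ends exchanged\<close>

locale network_sum =
  fixes N1 :: "'a network" and N2 :: "'b network" and e1 :: 'a and e2 :: 'b and b :: bool and c :: nat
  assumes adm1: "admissible_spin_network N1" and adm2: "admissible_spin_network N2"
    and e1: "e1 \<in> edges N1" "colour N1 e1 = c" and e2: "e2 \<in> edges N2" "colour N2 e2 = c"
begin

definition M where "M = connected_sum N1 e1 N2 e2 b"
definition sw :: "('a + 'b) \<times> bool \<Rightarrow> ('a + 'b) \<times> bool" where "sw = transpose (Inl e1, True) (Inr e2, b)"
text \<open>An end of a summand keeps its vertex in the sum but may change its name;
  \<open>J1\<close> and \<open>J2\<close> give the new names. They intertwine the rotations because
  \<open>connected_sum\<close> conjugates by \<open>sw\<close>.\<close>

definition J1 where "J1 d = sw (map_prod Inl id d)"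
definition J2 where "J2 d = sw (map_prod Inr id d)"
definition \<theta>1 where "\<theta>1 = (\<lambda>(d, k :: nat). (J1 d, k))"
definition \<theta>2 where "\<theta>2 = (\<lambda>(d, k :: nat). (J2 d, k))"
definition \<theta> where "\<theta> = case_sum \<theta>1 \<theta>2"

lemma sw_sw [simp]: "sw (sw d) = d"
  by (simp add: sw_def)

lemma M_simps [simp]: "edges M = edges N1 <+> edges N2" "colour M (Inl e) = colour N1 e" "colour M (Inr e') = colour N2 e'"
  by (simp_all add: M_def connected_sum_def Let_def)

lemma rot_M: "rot M (J1 d) = J1 (rot N1 d)" "rot M (J2 d') = J2 (rot N2 d')"
proof -
  have r: "rot M x = sw (disjoint_rot N1 N2 (sw x))" for x by (simp add: M_def connected_sum_def Let_def sw_def)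
  show "rot M (J1 d) = J1 (rot N1 d)" "rot M (J2 d') = J2 (rot N2 d')"
    unfolding r J1_def J2_def sw_sw by (cases d; simp add: disjoint_rot_def) (cases d'; simp add: disjoint_rot_def)
qed

lemma dcol_sw: "dcol M (sw d) = dcol M d"
  unfolding sw_def transpose_def dcol_def using e1(2) e2(2) by simp

lemma dcol_M [simp]: "dcol M (J1 d) = dcol N1 d" "dcol M (J2 d') = dcol N2 d'"
  unfolding J1_def J2_def dcol_sw by (simp_all add: dcol_def)

lemma sw_darts: "sw ` darts M = darts M"
proof -
  have "sw d \<in> darts M" if "d \<in> darts M" for d
    using that e1(1) e2(1) by (auto simp: sw_def transpose_def darts_def)
  then have "sw ` darts M \<subseteq> darts M" by blast
  moreover have "darts M \<subseteq> sw ` darts M"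
  proof
    fix d assume "d \<in> darts M"
    then have "sw d \<in> darts M" using \<open>\<And>d. d \<in> darts M \<Longrightarrow> sw d \<in> darts M\<close> by blast
    then show "d \<in> sw ` darts M" by (intro image_eqI[of _ _ "sw d"]) auto
  qed
  ultimately show ?thesis by blast
qed

lemma darts_M: "darts M = J1 ` darts N1 \<union> J2 ` darts N2"
proof -
  have "darts M = map_prod Inl id ` darts N1 \<union> map_prod Inr id ` darts N2"
  proof (rule set_eqI)
    fix d :: "('a + 'b) \<times> bool"
    have mem: "(Inl x, t) \<in> map_prod Inl id ` X \<longleftrightarrow> (x, t) \<in> X" "(Inr y, t) \<in> map_prod Inr id ` Y \<longleftrightarrow> (y, t) \<in> Y"
      "(Inr y, t) \<notin> map_prod Inl id ` X" "(Inl x, t) \<notin> map_prod Inr id ` Y"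
      for x :: 'a and y :: 'b and t :: bool and X Y by force+
    show "d \<in> darts M \<longleftrightarrow> d \<in> map_prod Inl id ` darts N1 \<union> map_prod Inr id ` darts N2"
      by (cases d; cases "fst d") (auto simp: darts_def mem)
  qed
  then have "sw ` darts M = J1 ` darts N1 \<union> J2 ` darts N2"
    by (simp add: image_Un image_image J1_def J2_def)
  then show ?thesis by (simp add: sw_darts)
qed

lemma inj_\<theta>: "inj \<theta>"
proof (rule inj_on_inverseI)
  fix x :: "('a \<times> bool) \<times> nat + ('b \<times> bool) \<times> nat"
  show "(\<lambda>(d, k). case sw d of (Inl e, t) \<Rightarrow> Inl ((e, t), k) | (Inr e, t) \<Rightarrow> Inr ((e, t), k)) (\<theta> x) = x"
  proof (cases x)
    case (Inl p)
    then show ?thesis by (cases p; cases "fst p") (simp add: \<theta>_def \<theta>1_def J1_def)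
  next
    case (Inr p)
    then show ?thesis by (cases p; cases "fst p") (simp add: \<theta>_def \<theta>2_def J2_def)
  qed
qed

lemma points_M: "\<theta> ` (points N1 <+> points N2) = points M"
proof -
  have "\<theta>1 ` points N1 = (\<Union>d\<in>J1 ` darts N1. {d} \<times> {..<dcol M d})"
    "\<theta>2 ` points N2 = (\<Union>d\<in>J2 ` darts N2. {d} \<times> {..<dcol M d})"
    unfolding points_def Sigma_def \<theta>1_def \<theta>2_def by (auto simp: image_iff)
  moreover have "\<theta> ` (points N1 <+> points N2) = \<theta>1 ` points N1 \<union> \<theta>2 ` points N2"
    unfolding Plus_def image_Un image_image \<theta>_def by simp
  moreover have "points M = (\<Union>d\<in>darts M. {d} \<times> {..<dcol M d})"
    by (auto simp: points_def)
  ultimately show ?thesis unfolding darts_M by (simp only: UN_Un)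
qed

lemma vertex_strands_M: "vertex_strands M = (`) \<theta>1 ` vertex_strands N1 \<union> (`) \<theta>2 ` vertex_strands N2"
  unfolding vertex_strands_UN darts_M UN_Un image_UN image_image
  by (simp add: rot_M \<theta>1_def \<theta>2_def)

text \<open>The boundary of the box on the new edge \<open>Inl e1\<close>, in the names of the
  summands: its bottom is the loose end \<open>(e1, False)\<close> and its top the loose end
  \<open>(e2, b)\<close>, numbered backwards there as in \<open>box_to_edge\<close>. The definition
  of \<open>\<iota>2\<close> does the same for \<open>Inr e2\<close>.\<close>

definition \<iota>1 :: "bool \<times> nat \<Rightarrow> (('a \<times> bool) \<times> nat) + (('b \<times> bool) \<times> nat)" where
  "\<iota>1 p = (if fst p then Inr ((e2, b), c - 1 - snd p) else Inl ((e1, False), snd p))"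

definition \<iota>2 :: "bool \<times> nat \<Rightarrow> (('a \<times> bool) \<times> nat) + (('b \<times> bool) \<times> nat)" where
  "\<iota>2 p = (let k = if fst p then c - 1 - snd p else snd p in
     if fst p = b then Inl ((e1, True), k) else Inr ((e2, \<not> b), k))"

lemma box_M:
  "e \<noteq> e1 \<Longrightarrow> box_to_edge M (Inl e) = \<theta>1 \<circ> box_to_edge N1 e"
  "e' \<noteq> e2 \<Longrightarrow> box_to_edge M (Inr e') = \<theta>2 \<circ> box_to_edge N2 e'"
  "box_to_edge M (Inl e1) = \<theta> \<circ> \<iota>1" "box_to_edge M (Inr e2) = \<theta> \<circ> \<iota>2"
  unfolding fun_eq_iff box_to_edge_def comp_def M_simps e1(2) e2(2)
  by (auto simp: \<theta>_def \<theta>1_def \<theta>2_def J1_def J2_def sw_def transpose_def \<iota>1_def \<iota>2_def Let_def)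

lemma cut_networks:
  "s1 \<in> (\<Pi>\<^sub>E e\<in>edges N1 - {e1}. tl_diagrams (colour N1 e)) \<Longrightarrow> cut_network N1 e1 s1"
  "s2 \<in> (\<Pi>\<^sub>E e\<in>edges N2 - {e2}. tl_diagrams (colour N2 e)) \<Longrightarrow> cut_network N2 e2 s2"
  using adm1 adm2 e1(1) e2(1) unfolding cut_network_def by (blast dest: PiE_mem)+

text \<open>Through the injection \<open>\<theta>\<close> the strands of the sum are those of the
  two cut networks and of the two new boxes, so its circles can be counted in the disjoint union of
  the point sets.\<close>

lemma circles_M:
  assumes s1: "s1 \<in> (\<Pi>\<^sub>E e\<in>edges N1 - {e1}. tl_diagrams (colour N1 e))"
    and s2: "s2 \<in> (\<Pi>\<^sub>E e\<in>edges N2 - {e2}. tl_diagrams (colour N2 e))"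
    and D: "D1 \<in> tl_diagrams c" "D2 \<in> tl_diagrams c"
  shows "card (circles M (case_sum (s1(e1 := D1)) (s2(e2 := D2)))) =
    comps (points N1 <+> points N2) (sum_rel (strand_rel (cut_strands N1 e1 s1)) (strand_rel (cut_strands N2 e2 s2)) \<union>
      glue \<iota>1 D1 \<union> glue \<iota>2 D2)"
proof -
  interpret c1: cut_network N1 e1 s1 by (rule cut_networks(1)[OF s1])
  interpret c2: cut_network N2 e2 s2 by (rule cut_networks(2)[OF s2])
  let ?s = "case_sum (s1(e1 := D1)) (s2(e2 := D2))"
  let ?X = "sum_rel (strand_rel (cut_strands N1 e1 s1)) (strand_rel (cut_strands N2 e2 s2)) \<union> glue \<iota>1 D1 \<union> glue \<iota>2 D2"
  note card2 = c1.card_cut_strands c2.card_cut_strands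
  have E: "(\<Union>e\<in>edges M. (`) (box_to_edge M e) ` ?s e) =
      (\<Union>e\<in>edges N1 - {e1}. (`) (\<theta>1 \<circ> box_to_edge N1 e) ` s1 e) \<union> (`) (\<theta> \<circ> \<iota>1) ` D1 \<union>
      ((\<Union>e\<in>edges N2 - {e2}. (`) (\<theta>2 \<circ> box_to_edge N2 e) ` s2 e) \<union> (`) (\<theta> \<circ> \<iota>2) ` D2)"
  proof -
    have "(\<Union>e\<in>edges N1. (`) (box_to_edge M (Inl e)) ` (s1(e1 := D1)) e) =
        (\<Union>e\<in>edges N1 - {e1}. (`) (box_to_edge M (Inl e)) ` s1 e) \<union> (`) (box_to_edge M (Inl e1)) ` D1"
      using e1(1) by (auto split: if_splits)
    moreover have "(\<Union>e\<in>edges N2. (`) (box_to_edge M (Inr e)) ` (s2(e2 := D2)) e) =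
        (\<Union>e\<in>edges N2 - {e2}. (`) (box_to_edge M (Inr e)) ` s2 e) \<union> (`) (box_to_edge M (Inr e2)) ` D2"
      using e2(1) by (auto split: if_splits)
    moreover have "(\<Union>e\<in>edges N1 - {e1}. (`) (box_to_edge M (Inl e)) ` s1 e) =
        (\<Union>e\<in>edges N1 - {e1}. (`) (\<theta>1 \<circ> box_to_edge N1 e) ` s1 e)"
      "(\<Union>e\<in>edges N2 - {e2}. (`) (box_to_edge M (Inr e)) ` s2 e) =
        (\<Union>e\<in>edges N2 - {e2}. (`) (\<theta>2 \<circ> box_to_edge N2 e) ` s2 e)"
      by (rule SUP_cong[OF refl], simp add: box_M)+
    moreover have "(\<Union>e\<in>edges M. (`) (box_to_edge M e) ` ?s e) =
        (\<Union>e\<in>edges N1. (`) (box_to_edge M (Inl e)) ` (s1(e1 := D1)) e) \<union>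
        (\<Union>e\<in>edges N2. (`) (box_to_edge M (Inr e)) ` (s2(e2 := D2)) e)"
      by (simp add: Plus_def UN_Un del: fun_upd_apply)
    ultimately show ?thesis by (simp only: box_M(3,4))
  qed
  have "vertex_strands M \<union> (\<Union>e\<in>edges M. (`) (box_to_edge M e) ` ?s e) =
      (`) \<theta>1 ` cut_strands N1 e1 s1 \<union> (`) \<theta>2 ` cut_strands N2 e2 s2 \<union> (`) (\<theta> \<circ> \<iota>1) ` D1 \<union> (`) (\<theta> \<circ> \<iota>2) ` D2"
    unfolding E vertex_strands_M cut_strands_def by (simp add: image_Un image_UN image_image image_comp[symmetric] Un_ac)
  then have "strand_rel (vertex_strands M \<union> (\<Union>e\<in>edges M. (`) (box_to_edge M e) ` ?s e)) =
      strand_rel ((`) \<theta>1 ` cut_strands N1 e1 s1) \<union> strand_rel ((`) \<theta>2 ` cut_strands N2 e2 s2) \<union>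
      glue (\<theta> \<circ> \<iota>1) D1 \<union> glue (\<theta> \<circ> \<iota>2) D2"
    by (simp only: strand_rel_Un strand_rel_glue[OF D(1)] strand_rel_glue[OF D(2)])
  also have "\<dots> = map_prod \<theta> \<theta> ` ?X"
  proof -
    have "strand_rel ((`) \<theta>1 ` cut_strands N1 e1 s1) = map_prod \<theta>1 \<theta>1 ` strand_rel (cut_strands N1 e1 s1)"
      "strand_rel ((`) \<theta>2 ` cut_strands N2 e2 s2) = map_prod \<theta>2 \<theta>2 ` strand_rel (cut_strands N2 e2 s2)"
      using strand_rel_image[of "cut_strands N1 e1 s1" \<theta>1] strand_rel_image[of "cut_strands N2 e2 s2" \<theta>2] card2
        image_Collect_ex2[of \<theta>1 "\<lambda>x. x" "\<lambda>x y. {x, y} \<in> cut_strands N1 e1 s1"]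
        image_Collect_ex2[of \<theta>2 "\<lambda>x. x" "\<lambda>x y. {x, y} \<in> cut_strands N2 e2 s2"]
      by (simp_all add: strand_rel_def)
    moreover have "map_prod \<theta> \<theta> ` map_prod Inl Inl ` A = map_prod \<theta>1 \<theta>1 ` A"
      "map_prod \<theta> \<theta> ` map_prod Inr Inr ` B = map_prod \<theta>2 \<theta>2 ` B" for A B
      by (auto simp: \<theta>_def image_image map_prod_def split_def)
    ultimately show ?thesis
      unfolding image_Un sum_rel_def by (simp add: glue_comp)
  qed
  finally have *: "strand_rel (vertex_strands M \<union> (\<Union>e\<in>edges M. (`) (box_to_edge M e) ` ?s e)) = map_prod \<theta> \<theta> ` ?X" .
  have \<iota>P: "\<iota>1 ` box_points c \<subseteq> points N1 <+> points N2" "\<iota>2 ` box_points c \<subseteq> points N1 <+> points N2"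
    using e1 e2 by (auto simp: \<iota>1_def \<iota>2_def Let_def points_def darts_def dcol_def box_points_def)
  have "?X \<subseteq> (points N1 <+> points N2) \<times> (points N1 <+> points N2)"
    using sum_rel_sub[OF c1.R_sub c2.R_sub] glue_sub[OF D(1) \<iota>P(1)] glue_sub[OF D(2) \<iota>P(2)] by simp
  then have "comps (points M) (map_prod \<theta> \<theta> ` ?X) = comps (points N1 <+> points N2) ?X"
    unfolding points_M[symmetric] by (intro comps_relabel) (auto intro: inj_on_subset[OF inj_\<theta>])
  then show ?thesis unfolding circles_def * comps_def .
qed

text \<open>For each pair of states outside the cut edges the identity is
  \<open>skein_sum_matched\<close>. The weights of the states multiply, so the sum over pairs
  factors into the two evaluations.\<close>

lemma evaluation_M: "evaluation M * Delta c = evaluation N1 * evaluation N2"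
proof -
  let ?f = "jones_wenzl c"
  let ?A = "\<Pi>\<^sub>E e\<in>edges N1 - {e1}. tl_diagrams (colour N1 e)" and ?B = "\<Pi>\<^sub>E e\<in>edges N2 - {e2}. tl_diagrams (colour N2 e)"
  let ?k1 = "\<lambda>s. skein c ?f (points N1) (strand_rel (cut_strands N1 e1 s)) (box_to_edge N1 e1)"
  let ?k2 = "\<lambda>s. skein c ?f (points N2) (strand_rel (cut_strands N2 e2 s)) (box_to_edge N2 e2)"
  let ?dd = "\<lambda>s1 s2. \<Sum>D1\<in>tl_diagrams c. \<Sum>D2\<in>tl_diagrams c. ?f D1 * ?f D2 *
      loop_value ^ comps (points N1 <+> points N2) (sum_rel (strand_rel (cut_strands N1 e1 s1)) (strand_rel (cut_strands N2 e2 s2)) \<union>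
      glue \<iota>1 D1 \<union> glue \<iota>2 D2)"
  have fin: "finite (edges N1)" "finite (edges N2)"
    using adm1 adm2 by (simp_all add: admissible_spin_network_def trivalent_def)
  have F: "(\<lambda>e. tl_diagrams (colour M e)) = case_sum (\<lambda>e. tl_diagrams (colour N1 e)) (\<lambda>e. tl_diagrams (colour N2 e))"
    by (rule ext) (simp split: sum.split)
  have P: "(\<Prod>e\<in>edges M. jones_wenzl (colour M e) (case_sum s1 s2 e)) =
      (\<Prod>e\<in>edges N1. jones_wenzl (colour N1 e) (s1 e)) * (\<Prod>e\<in>edges N2. jones_wenzl (colour N2 e) (s2 e))" for s1 s2
    using prod.Plus[OF fin, of "\<lambda>e. jones_wenzl (colour M e) (case_sum s1 s2 e)"] by simp
  have key: "?dd s1 s2 * Delta c = ?k1 s1 * ?k2 s2" if s: "s1 \<in> ?A" "s2 \<in> ?B" for s1 s2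
  proof -
    interpret c1: cut_network N1 e1 s1 by (rule cut_networks(1)[OF s(1)])
    interpret c2: cut_network N2 e2 s2 by (rule cut_networks(2)[OF s(2)])
    obtain K1 K2 where K: "matched c (points N1) (strand_rel (cut_strands N1 e1 s1)) (box_to_edge N1 e1) K1"
      "matched c (points N2) (strand_rel (cut_strands N2 e2 s2)) (box_to_edge N2 e2) K2"
      using c1.cut_matched c2.cut_matched e1(2) e2(2) by auto
    show ?thesis
      unfolding mult.commute[of _ "Delta c"]
      by (rule skein_sum_matched[OF K, where b = b])
        (use e1(2) e2(2) in \<open>auto simp: \<iota>1_def \<iota>2_def box_to_edge_def Let_def\<close>)
  qed
  have "evaluation M = (\<Sum>s1\<in>(\<Pi>\<^sub>E e\<in>edges N1. tl_diagrams (colour N1 e)). \<Sum>s2\<in>(\<Pi>\<^sub>E e\<in>edges N2. tl_diagrams (colour N2 e)).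
      (\<Prod>e\<in>edges N1. jones_wenzl (colour N1 e) (s1 e)) * (\<Prod>e\<in>edges N2. jones_wenzl (colour N2 e) (s2 e)) *
      loop_value ^ card (circles M (case_sum s1 s2)))"
    unfolding evaluation_def F M_simps(1) sum_PiE_Plus P[unfolded M_simps(1)] ..
  also have "\<dots> = (\<Sum>s1\<in>?A. \<Sum>D1\<in>tl_diagrams c. \<Sum>s2\<in>?B. \<Sum>D2\<in>tl_diagrams c.
      (?f D1 * cut_weight N1 e1 s1) * (?f D2 * cut_weight N2 e2 s2) *
      loop_value ^ card (circles M (case_sum (s1(e1 := D1)) (s2(e2 := D2)))))"
    unfolding sum_PiE_insert[OF e1(1)] sum_PiE_insert[OF e2(1)] prod_cut[OF fin(1) e1(1)] prod_cut[OF fin(2) e2(1)] e1(2) e2(2) ..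
  also have "\<dots> = (\<Sum>s1\<in>?A. \<Sum>s2\<in>?B. cut_weight N1 e1 s1 * cut_weight N2 e2 s2 * ?dd s1 s2)"
  proof (intro sum.cong refl)
    fix s1 assume s1: "s1 \<in> ?A"
    have "(\<Sum>D1\<in>tl_diagrams c. \<Sum>s2\<in>?B. \<Sum>D2\<in>tl_diagrams c.
        (?f D1 * cut_weight N1 e1 s1) * (?f D2 * cut_weight N2 e2 s2) *
        loop_value ^ card (circles M (case_sum (s1(e1 := D1)) (s2(e2 := D2))))) =
      (\<Sum>s2\<in>?B. \<Sum>D1\<in>tl_diagrams c. \<Sum>D2\<in>tl_diagrams c.
        (?f D1 * cut_weight N1 e1 s1) * (?f D2 * cut_weight N2 e2 s2) *
        loop_value ^ card (circles M (case_sum (s1(e1 := D1)) (s2(e2 := D2)))))"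
      by (rule sum.swap)
    also have "\<dots> = (\<Sum>s2\<in>?B. cut_weight N1 e1 s1 * cut_weight N2 e2 s2 * ?dd s1 s2)"
      unfolding sum_distrib_left by (intro sum.cong refl) (simp only: circles_M[OF s1] mult_ac)
    finally show "(\<Sum>D1\<in>tl_diagrams c. \<Sum>s2\<in>?B. \<Sum>D2\<in>tl_diagrams c.
        (?f D1 * cut_weight N1 e1 s1) * (?f D2 * cut_weight N2 e2 s2) *
        loop_value ^ card (circles M (case_sum (s1(e1 := D1)) (s2(e2 := D2))))) =
        (\<Sum>s2\<in>?B. cut_weight N1 e1 s1 * cut_weight N2 e2 s2 * ?dd s1 s2)" .
  qed
  finally have "evaluation M * Delta c = (\<Sum>s1\<in>?A. \<Sum>s2\<in>?B. cut_weight N1 e1 s1 * cut_weight N2 e2 s2 * (?dd s1 s2 * Delta c))"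
    by (simp only: sum_distrib_right mult.assoc)
  also have "\<dots> = (\<Sum>s1\<in>?A. \<Sum>s2\<in>?B. (cut_weight N1 e1 s1 * ?k1 s1) * (cut_weight N2 e2 s2 * ?k2 s2))"
  proof (intro sum.cong refl)
    fix s1 s2 assume s: "s1 \<in> ?A" "s2 \<in> ?B"
    show "cut_weight N1 e1 s1 * cut_weight N2 e2 s2 * (?dd s1 s2 * Delta c) =
        (cut_weight N1 e1 s1 * ?k1 s1) * (cut_weight N2 e2 s2 * ?k2 s2)"
      unfolding key[OF s] by (simp only: mult_ac)
  qed
  also have "\<dots> = evaluation N1 * evaluation N2"
    unfolding evaluation_cut[OF fin(1) e1(1)] evaluation_cut[OF fin(2) e2(1)] e1(2) e2(2) sum_product ..
  finally show ?thesis .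
qed

end

theorem theorem5p2:
  fixes \<Upsilon>1 :: "nat \<Rightarrow> 'a network" and \<Upsilon>2 :: "nat \<Rightarrow> 'b network"
    and e1 :: "nat \<Rightarrow> 'a" and e2 :: "nat \<Rightarrow> 'b"
    and b :: "nat \<Rightarrow> bool" and i :: nat and c :: "nat \<Rightarrow> nat"
    and T1 T2 :: "int fps"
  assumes "i \<in> {2, 3}"
    and "\<And>n. c n = (if i = 2 then 2 * n else n)"
    and "\<And>n. admissible_spin_network (\<Upsilon>1 n)" and "\<And>n. admissible_spin_network (\<Upsilon>2 n)"
    and "\<And>n e. e \<in> edges (\<Upsilon>1 n) \<Longrightarrow> colour (\<Upsilon>1 n) e \<in> {n, 2 * n}"
    and "\<And>n e. e \<in> edges (\<Upsilon>2 n) \<Longrightarrow> colour (\<Upsilon>2 n) e \<in> {n, 2 * n}"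
    and "\<And>n. e1 n \<in> edges (\<Upsilon>1 n) \<and> colour (\<Upsilon>1 n) (e1 n) = c n"
    and "\<And>n. e2 n \<in> edges (\<Upsilon>2 n) \<and> colour (\<Upsilon>2 n) (e2 n) = c n"
    and "is_tail (\<lambda>n. evaluation (\<Upsilon>1 n)) T1" and "is_tail (\<lambda>n. evaluation (\<Upsilon>2 n)) T2"
  shows "\<forall>n. agree_upto n
           (expand (evaluation (connected_sum (\<Upsilon>1 n) (e1 n) (\<Upsilon>2 n) (e2 n) (b n))))
           (int_q_series ((1 - fps_X) * T1 * T2))"
proof
  fix n
  interpret network_sum "\<Upsilon>1 n" "\<Upsilon>2 n" "e1 n" "e2 n" "b n" "c n"
    by unfold_locales (use assms in auto)
  \<comment> \<open>Both colours \<open>2 * n\<close> and \<open>n\<close> are at least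
    \<open>n\<close>, so the deviation in degree c + 1 lies beyond the coefficients that are
    compared.\<close>
  have "n \<le> c n" using assms(2)[of n] by simp
  moreover have "agree_upto n (int_q_series T1) (expand (evaluation (\<Upsilon>1 n)))"
    "agree_upto n (int_q_series T2) (expand (evaluation (\<Upsilon>2 n)))"
    using assms(9,10) by (simp_all add: is_tail_def)
  ultimately show "agree_upto n
      (expand (evaluation (connected_sum (\<Upsilon>1 n) (e1 n) (\<Upsilon>2 n) (e2 n) (b n))))
      (int_q_series ((1 - fps_X) * T1 * T2))"
    using agree_connected_sum[OF evaluation_M] unfolding M_def by blast
qed

end
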